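(* Let $G,H$ be finitely generated groups, and let $C$ be a finite group that embeds in $G$ and in $H$ (with fixed embeddings). If $\mathbf{AGWP}(G)\in\mathbf{P}$ and $\mathbf{AGWP}(H)\in\mathbf{P}$, then $\mathbf{AGWP}(G*_C H)\in\mathbf{P}$.
   Context: For a group $G$ with a finite generating set $X$, the acyclic graph word problem $\mathbf{AGWP}(G)$ is the following decision problem. Input: a finite acyclic directed graph $\Gamma$ with edges labeled by letters in $X\cup X^{-1}\cup\{\varepsilon\}$ ($\varepsilon$ the empty word), with two marked vertices $\alpha$ and $\omega$. Question: is there an oriented path in $\Gamma$ from $\alpha$ to $\omega$ labeled by a word $w$ such that $w=1$ in $G$? The size of an instance is the number of vertices plus the number of edges plus the total length of edge labels. Up to linear-time equivalence the problem does not depend on the finite generating set $X$, so $X$ is arbitrary and omitted from notation. $\mathbf{P}$ is the class of problems decidable in polynomial time. $G*_C H$ is the amalgamated free product. *)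

theory Defs
  imports "HOL-Algebra.Generated_Groups" "HOL-Computational_Algebra.Polynomial"
begin

section \<open>Polynomial time\<close>

text \<open>
  The machine model is the deterministic multi-stack machine over the binary alphabet: finitely many
  stacks of bits, a finite control, and unit-cost steps that push a constant bit, pop, or branch on
  the top symbol (\<^term>\<open>None\<close> signals the empty stack).  A Turing machine tape is a pair of stacks,
  so this is the multi-tape Turing machine up to a constant factor in running time.  The finite
  control is written as a structured program.
\<close>

datatype prog =
    Skip
  | Push nat bool
  | Pop nat
  | Seq prog prog
  | Cond nat "bool option set" prog prog
  | While nat "bool option set" prog

type_synonym store = "nat \<Rightarrow> bool list"

definition top_of :: "bool list \<Rightarrow> bool option" where
  "top_of xs = (case xs of [] \<Rightarrow> None | x # _ \<Rightarrow> Some x)"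

text \<open>\<open>exec p s t s'\<close>: started in store \<open>s\<close>, \<open>p\<close> halts in store \<open>s'\<close> after exactly \<open>t\<close> steps.\<close>

inductive exec :: "prog \<Rightarrow> store \<Rightarrow> nat \<Rightarrow> store \<Rightarrow> bool" where
  Skip: "exec Skip s 1 s"
| Push: "exec (Push k b) s 1 (s(k := b # s k))"
| Pop: "exec (Pop k) s 1 (s(k := tl (s k)))"
| Seq: "\<lbrakk>exec p s t s'; exec q s' u s''\<rbrakk> \<Longrightarrow> exec (Seq p q) s (t + u) s''"
| CondTrue: "\<lbrakk>top_of (s k) \<in> T; exec p s t s'\<rbrakk> \<Longrightarrow> exec (Cond k T p q) s (Suc t) s'"
| CondFalse: "\<lbrakk>top_of (s k) \<notin> T; exec q s t s'\<rbrakk> \<Longrightarrow> exec (Cond k T p q) s (Suc t) s'"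
| WhileFalse: "top_of (s k) \<notin> T \<Longrightarrow> exec (While k T p) s 1 s"
| WhileTrue: "\<lbrakk>top_of (s k) \<in> T; exec p s t s'; exec (While k T p) s' u s''\<rbrakk>
    \<Longrightarrow> exec (While k T p) s (Suc (t + u)) s''"

lemma exec_deterministic:
  assumes "exec p s t s'" and "exec p s u s''"
  shows "u = t \<and> s'' = s'"
  using assms
proof (induction arbitrary: u s'' rule: exec.induct)
  case (Seq p s t s' q v s1)
  from Seq.prems obtain t2 s2 u2 where "exec p s t2 s2" "exec q s2 u2 s''" "u = t2 + u2"
    by (cases rule: exec.cases) auto
  with Seq.IH show ?case by metis
next
  case (CondTrue s k T p t s' q)
  from CondTrue.prems CondTrue.hyps(1) obtain t2 where "exec p s t2 s''" "u = Suc t2"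
    by (cases rule: exec.cases) auto
  with CondTrue.IH show ?case by metis
next
  case (CondFalse s k T q t s' p)
  from CondFalse.prems CondFalse.hyps(1) obtain t2 where "exec q s t2 s''" "u = Suc t2"
    by (cases rule: exec.cases) auto
  with CondFalse.IH show ?case by metis
next
  case (WhileTrue s k T p t s' v s1)
  from WhileTrue.prems WhileTrue.hyps(1) obtain t2 s2 u2
    where "exec p s t2 s2" "exec (While k T p) s2 u2 s''" "u = Suc (t2 + u2)"
    by (cases rule: exec.cases) auto
  with WhileTrue.IH show ?case by metis
qed (erule exec.cases; simp)+

text \<open>The input is on stack 0, all other stacks are initially empty; the answer is read off stack 0.\<close>

definition input_store :: "bool list \<Rightarrow> store" where
  "input_store w = (\<lambda>_. [])(0 := w)"

definition accepting :: "store \<Rightarrow> bool" where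
  "accepting s \<longleftrightarrow> top_of (s 0) = Some True"

definition PTIME :: "bool list set set" where
  "PTIME = {L. \<exists>(p :: prog) (b :: nat poly). \<forall>w. \<exists>t s.
     exec p (input_store w) t s \<and> t \<le> poly b (length w) \<and> (accepting s \<longleftrightarrow> w \<in> L)}"


section \<open>The acyclic graph word problem\<close>

text \<open>
  Generators are given as a list \<open>xs\<close> of group elements.  The letter \<open>(i, True)\<close> stands for
  \<open>xs ! i\<close> and \<open>(i, False)\<close> for its inverse; an edge label \<^term>\<open>None\<close> is the empty word.
\<close>

type_synonym letter = "nat \<times> bool"

definition generating_list :: "('a, 'm) monoid_scheme \<Rightarrow> 'a list \<Rightarrow> bool" where
  "generating_list G xs \<longleftrightarrow> set xs \<subseteq> carrier G \<and> generate G (set xs) = carrier G"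

fun letter_value :: "('a, 'm) monoid_scheme \<Rightarrow> 'a list \<Rightarrow> letter \<Rightarrow> 'a" where
  "letter_value G xs (i, b) = (if b then xs ! i else inv\<^bsub>G\<^esub> (xs ! i))"

definition word_value :: "('a, 'm) monoid_scheme \<Rightarrow> 'a list \<Rightarrow> letter list \<Rightarrow> 'a" where
  "word_value G xs w = foldr (\<lambda>l a. letter_value G xs l \<otimes>\<^bsub>G\<^esub> a) w \<one>\<^bsub>G\<^esub>"

text \<open>
  The vertices are \<open>{..<num_verts \<Gamma>}\<close>; parallel edges are allowed, and the order of the edge list
  only matters for the encoding.
\<close>

record graph =
  num_verts :: nat
  edges :: "(nat \<times> letter option \<times> nat) list"
  source :: nat
  target :: nat

definition label_word :: "letter option \<Rightarrow> letter list" where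
  "label_word l = (case l of None \<Rightarrow> [] | Some a \<Rightarrow> [a])"

definition edge_rel :: "graph \<Rightarrow> (nat \<times> nat) set" where
  "edge_rel \<Gamma> = {(u, v). \<exists>l. (u, l, v) \<in> set (edges \<Gamma>)}"

text \<open>\<open>k\<close> is the number of generators.\<close>

definition acyclic_graph :: "nat \<Rightarrow> graph \<Rightarrow> bool" where
  "acyclic_graph k \<Gamma> \<longleftrightarrow>
     source \<Gamma> < num_verts \<Gamma> \<and> target \<Gamma> < num_verts \<Gamma> \<and>
     (\<forall>(u, l, v) \<in> set (edges \<Gamma>). u < num_verts \<Gamma> \<and> v < num_verts \<Gamma> \<and>
        (\<forall>i b. l = Some (i, b) \<longrightarrow> i < k)) \<and>
     acyclic (edge_rel \<Gamma>)"

inductive labelled_path :: "graph \<Rightarrow> nat \<Rightarrow> letter list \<Rightarrow> nat \<Rightarrow> bool" for \<Gamma> where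
  Nil: "u < num_verts \<Gamma> \<Longrightarrow> labelled_path \<Gamma> u [] u"
| Cons: "\<lbrakk>(u, l, v) \<in> set (edges \<Gamma>); labelled_path \<Gamma> v w z\<rbrakk>
    \<Longrightarrow> labelled_path \<Gamma> u (label_word l @ w) z"

definition graph_size :: "graph \<Rightarrow> nat" where
  "graph_size \<Gamma> = num_verts \<Gamma> + length (edges \<Gamma>) +
     (\<Sum>(u, l, v) \<leftarrow> edges \<Gamma>. length (label_word l))"

text \<open>
  Numbers are written in unary.  Since vertices are numbered below \<^term>\<open>num_verts \<Gamma>\<close>, the length
  of the encoding and \<^term>\<open>graph_size \<Gamma>\<close> bound each other polynomially (see below).
\<close>

definition encode_nats :: "nat list \<Rightarrow> bool list" where
  "encode_nats ns = concat (map (\<lambda>n. replicate n True @ [False]) ns)"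

fun label_code :: "letter option \<Rightarrow> nat" where
  "label_code None = 0"
| "label_code (Some (i, True)) = 2 * i + 1"
| "label_code (Some (i, False)) = 2 * i + 2"

definition encode_graph :: "graph \<Rightarrow> bool list" where
  "encode_graph \<Gamma> = encode_nats ([num_verts \<Gamma>, source \<Gamma>, target \<Gamma>] @
     concat (map (\<lambda>(u, l, v). [u, label_code l, v]) (edges \<Gamma>)))"

definition AGWP :: "('a, 'm) monoid_scheme \<Rightarrow> 'a list \<Rightarrow> bool list set" where
  "AGWP G xs = encode_graph ` {\<Gamma>. acyclic_graph (length xs) \<Gamma> \<and>
     (\<exists>w. labelled_path \<Gamma> (source \<Gamma>) w (target \<Gamma>) \<and> word_value G xs w = \<one>\<^bsub>G\<^esub>)}"

lemma encode_nats_simps [simp]: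
  "encode_nats [] = []"
  "encode_nats (n # ns) = replicate n True @ False # encode_nats ns"
  by (simp_all add: encode_nats_def)

lemma replicate_True_False_eq:
  "replicate m True @ False # xs = replicate n True @ False # ys \<longleftrightarrow> m = n \<and> xs = ys"
proof (induction m arbitrary: n)
  case 0
  then show ?case by (cases n) auto
next
  case (Suc m)
  then show ?case by (cases n) auto
qed

lemma inj_encode_nats: "inj encode_nats"
proof (rule injI)
  fix ms ns :: "nat list"
  assume "encode_nats ms = encode_nats ns"
  then show "ms = ns"
  proof (induction ms arbitrary: ns)
    case Nil
    then show ?case by (cases ns) auto
  next
    case (Cons m ms)
    then show ?case by (cases ns) (auto simp: replicate_True_False_eq)
  qed
qed

lemma inj_label_code: "inj label_code"
proof (rule injI)
  fix l m :: "letter option"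
  assume "label_code l = label_code m"
  then show "l = m"
    by (cases l rule: label_code.cases; cases m rule: label_code.cases) (simp_all, presburger+)
qed

lemma inj_encode_graph: "inj encode_graph"
proof (rule injI)
  have edges: "es = fs"
    if "concat (map (\<lambda>(u, l, v). [u, label_code l, v]) es) =
        concat (map (\<lambda>(u, l, v). [u, label_code l, v]) fs)"
    for es fs :: "(nat \<times> letter option \<times> nat) list"
    using that
  proof (induction es arbitrary: fs)
    case Nil
    then show ?case by (cases fs) auto
  next
    case (Cons e es)
    then show ?case by (cases e; cases fs) (auto dest: injD[OF inj_label_code])
  qed
  fix \<Gamma> \<Delta> :: graph
  assume "encode_graph \<Gamma> = encode_graph \<Delta>"
  from injD[OF inj_encode_nats this[unfolded encode_graph_def]] edges show "\<Gamma> = \<Delta>"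
    by simp
qed

lemma length_encode_nats: "length (encode_nats ns) = sum_list ns + length ns"
  by (induction ns) auto

lemma graph_size_le_length_encode: "graph_size \<Gamma> \<le> length (encode_graph \<Gamma>)"
proof -
  have "length es + (\<Sum>(u, l, v) \<leftarrow> es. length (label_word l)) \<le>
      length (encode_nats (concat (map (\<lambda>(u, l, v). [u, label_code l, v]) es)))" for es
  proof (induction es)
    case (Cons e es)
    obtain u l v where [simp]: "e = (u, l, v)" by (cases e)
    have "length (label_word l) \<le> 1" by (cases l) (auto simp: label_word_def)
    with Cons show ?case by simp
  qed simp
  from this[of "edges \<Gamma>"] show ?thesis
    by (simp add: graph_size_def encode_graph_def)
qed

lemma length_encode_le_graph_size:
  assumes "acyclic_graph k \<Gamma>"
  shows "length (encode_graph \<Gamma>) \<le> (2 * k + 7) * (graph_size \<Gamma> + 1)\<^sup>2"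
proof -
  define n where "n = num_verts \<Gamma>"
  let ?S = "graph_size \<Gamma>"
  have edges: "length (encode_nats (concat (map (\<lambda>(u, l, v). [u, label_code l, v]) es)))
      \<le> length es * (2 * n + 2 * k + 3)"
    if "\<forall>(u, l, v) \<in> set es. u < n \<and> v < n \<and> (\<forall>i b. l = Some (i, b) \<longrightarrow> i < k)" for es
    using that
  proof (induction es)
    case (Cons e es)
    obtain u l v where [simp]: "e = (u, l, v)" by (cases e)
    have "label_code l \<le> 2 * k"
      using Cons.prems by (cases l rule: label_code.cases) auto
    with Cons show ?case by auto
  qed simp
  have S: "n \<le> ?S" "length (edges \<Gamma>) \<le> ?S"
    by (simp_all add: graph_size_def n_def)
  have "length (encode_graph \<Gamma>) \<le> 3 * n + 3 + length (edges \<Gamma>) * (2 * n + 2 * k + 3)"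
    using assms edges[of "edges \<Gamma>"] by (simp add: acyclic_graph_def encode_graph_def n_def)
  also have "\<dots> \<le> 3 * ?S + 3 + ?S * (2 * ?S + 2 * k + 3)"
    by (intro add_mono mult_mono) (use S in auto)
  also have "\<dots> \<le> (2 * k + 7) * (?S + 1)\<^sup>2"
    by (simp add: power2_eq_square algebra_simps)
  finally show ?thesis .
qed


section \<open>Amalgamated free products\<close>

text \<open>
  Words over the disjoint union of the carriers of \<open>G\<close> and \<open>H\<close>, modulo the congruence generated by
  the multiplication tables of \<open>G\<close> and \<open>H\<close> (which gives the free product) and by identifying
  \<open>\<phi> c\<close> with \<open>\<psi> c\<close>.
\<close>

inductive amalg_eq ::
  "('a, 'm) monoid_scheme \<Rightarrow> ('b, 'n) monoid_scheme \<Rightarrow> ('c, 'k) monoid_scheme \<Rightarrow>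
   ('c \<Rightarrow> 'a) \<Rightarrow> ('c \<Rightarrow> 'b) \<Rightarrow> ('a + 'b) list \<Rightarrow> ('a + 'b) list \<Rightarrow> bool"
  for G H C \<phi> \<psi> where
  refl: "w \<in> lists (carrier G <+> carrier H) \<Longrightarrow> amalg_eq G H C \<phi> \<psi> w w"
| sym: "amalg_eq G H C \<phi> \<psi> v w \<Longrightarrow> amalg_eq G H C \<phi> \<psi> w v"
| trans: "\<lbrakk>amalg_eq G H C \<phi> \<psi> u v; amalg_eq G H C \<phi> \<psi> v w\<rbrakk> \<Longrightarrow> amalg_eq G H C \<phi> \<psi> u w"
| append: "\<lbrakk>amalg_eq G H C \<phi> \<psi> v v'; amalg_eq G H C \<phi> \<psi> w w'\<rbrakk>
    \<Longrightarrow> amalg_eq G H C \<phi> \<psi> (v @ w) (v' @ w')"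
| oneG: "amalg_eq G H C \<phi> \<psi> [Inl \<one>\<^bsub>G\<^esub>] []"
| oneH: "amalg_eq G H C \<phi> \<psi> [Inr \<one>\<^bsub>H\<^esub>] []"
| multG: "\<lbrakk>x \<in> carrier G; y \<in> carrier G\<rbrakk> \<Longrightarrow> amalg_eq G H C \<phi> \<psi> [Inl x, Inl y] [Inl (x \<otimes>\<^bsub>G\<^esub> y)]"
| multH: "\<lbrakk>x \<in> carrier H; y \<in> carrier H\<rbrakk> \<Longrightarrow> amalg_eq G H C \<phi> \<psi> [Inr x, Inr y] [Inr (x \<otimes>\<^bsub>H\<^esub> y)]"
| amalg: "c \<in> carrier C \<Longrightarrow> amalg_eq G H C \<phi> \<psi> [Inl (\<phi> c)] [Inr (\<psi> c)]"

definition amalg_rel ::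
  "('a, 'm) monoid_scheme \<Rightarrow> ('b, 'n) monoid_scheme \<Rightarrow> ('c, 'k) monoid_scheme \<Rightarrow>
   ('c \<Rightarrow> 'a) \<Rightarrow> ('c \<Rightarrow> 'b) \<Rightarrow> (('a + 'b) list \<times> ('a + 'b) list) set" where
  "amalg_rel G H C \<phi> \<psi> = {(v, w). amalg_eq G H C \<phi> \<psi> v w}"

definition amalgamated_product ::
  "('a, 'm) monoid_scheme \<Rightarrow> ('b, 'n) monoid_scheme \<Rightarrow> ('c, 'k) monoid_scheme \<Rightarrow>
   ('c \<Rightarrow> 'a) \<Rightarrow> ('c \<Rightarrow> 'b) \<Rightarrow> ('a + 'b) list set monoid" where
  "amalgamated_product G H C \<phi> \<psi> =
     \<lparr>carrier = lists (carrier G <+> carrier H) // amalg_rel G H C \<phi> \<psi>,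
      monoid.mult = (\<lambda>A B. \<Union>v\<in>A. \<Union>w\<in>B. amalg_rel G H C \<phi> \<psi> `` {v @ w}),
      one = amalg_rel G H C \<phi> \<psi> `` {[]}\<rparr>"

context
  fixes G :: "('a, 'm) monoid_scheme" and H :: "('b, 'n) monoid_scheme"
    and C :: "('c, 'k) monoid_scheme" and \<phi> :: "'c \<Rightarrow> 'a" and \<psi> :: "'c \<Rightarrow> 'b"
  assumes G: "group G" and H: "group H" and \<phi>: "\<phi> \<in> hom C G" and \<psi>: "\<psi> \<in> hom C H"
begin

interpretation G: group G by (rule G)
interpretation H: group H by (rule H)

private abbreviation (input) "W \<equiv> lists (carrier G <+> carrier H)"
private abbreviation (input) "R \<equiv> amalg_rel G H C \<phi> \<psi>"
private abbreviation (input) "P \<equiv> amalgamated_product G H C \<phi> \<psi>"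

private lemma Inl_in_Plus [simp]: "Inl x \<in> A <+> B \<longleftrightarrow> x \<in> A"
  by auto

private lemma Inr_in_Plus [simp]: "Inr y \<in> A <+> B \<longleftrightarrow> y \<in> B"
  by auto

lemma amalg_eq_in_lists:
  assumes "amalg_eq G H C \<phi> \<psi> v w"
  shows "v \<in> W \<and> w \<in> W"
  using assms
  by induction (use \<phi> \<psi> in \<open>auto simp: hom_def Pi_iff\<close>)

lemma equiv_amalg_rel: "equiv W R"
proof (rule equivI)
  show "R \<subseteq> W \<times> W"
    using amalg_eq_in_lists by (auto simp: amalg_rel_def)
  show "refl_on W R"
    by (auto simp: refl_on_def amalg_rel_def intro: amalg_eq.refl)
  show "Relation.sym R"
    by (auto simp: sym_def amalg_rel_def intro: amalg_eq.sym)
  show "Relation.trans R"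
    by (auto simp: trans_def amalg_rel_def intro: amalg_eq.trans)
qed

lemma amalg_class_eq_iff:
  assumes "v \<in> W" and "w \<in> W"
  shows "R `` {v} = R `` {w} \<longleftrightarrow> amalg_eq G H C \<phi> \<psi> v w"
  using eq_equiv_class_iff[OF equiv_amalg_rel assms] by (simp add: amalg_rel_def)

lemma amalg_mult_class:
  assumes "v \<in> W" and "w \<in> W"
  shows "R `` {v} \<otimes>\<^bsub>P\<^esub> R `` {w} = R `` {v @ w}"
proof -
  have "congruent2 R R (\<lambda>v w. R `` {v @ w})"
  proof (rule congruent2I')
    fix a b c d assume "(a, b) \<in> R" "(c, d) \<in> R"
    then have "(a @ c, b @ d) \<in> R"
      by (auto simp: amalg_rel_def intro: amalg_eq.append)
    then show "R `` {a @ c} = R `` {b @ d}"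
      by (rule equiv_class_eq[OF equiv_amalg_rel])
  qed
  from UN_equiv_class2[OF equiv_amalg_rel equiv_amalg_rel this assms]
  show ?thesis by (simp add: amalgamated_product_def)
qed

lemma amalg_carrier: "carrier P = (\<lambda>w. R `` {w}) ` W"
  by (auto simp: amalgamated_product_def quotient_def)

lemma amalg_one: "\<one>\<^bsub>P\<^esub> = R `` {[]}"
  by (simp add: amalgamated_product_def)

lemma amalg_left_inverse:
  assumes "w \<in> W"
  shows "\<exists>v\<in>W. amalg_eq G H C \<phi> \<psi> (v @ w) []"
  using assms
proof (induction w)
  case Nil
  then show ?case by (intro bexI[of _ "[]"]) (auto intro: amalg_eq.refl)
next
  case (Cons x w)
  then obtain v where v: "v \<in> W" "amalg_eq G H C \<phi> \<psi> (v @ w) []" by auto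
  obtain y where y: "y \<in> carrier G <+> carrier H" "amalg_eq G H C \<phi> \<psi> [y, x] []"
  proof (cases x)
    case (Inl g)
    with Cons have g: "g \<in> carrier G" by auto
    have "amalg_eq G H C \<phi> \<psi> [Inl (inv\<^bsub>G\<^esub> g), Inl g] []"
      using amalg_eq.trans[OF amalg_eq.multG[of "inv\<^bsub>G\<^esub> g" G g] , of H C \<phi> \<psi> "[]"]
        amalg_eq.oneG[of G H C \<phi> \<psi>] g by simp
    with Inl g that[of "Inl (inv\<^bsub>G\<^esub> g)"] show ?thesis by simp
  next
    case (Inr h)
    with Cons have h: "h \<in> carrier H" by auto
    have "amalg_eq G H C \<phi> \<psi> [Inr (inv\<^bsub>H\<^esub> h), Inr h] []"
      using amalg_eq.trans[OF amalg_eq.multH[of "inv\<^bsub>H\<^esub> h" H h] , of G C \<phi> \<psi> "[]"]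
        amalg_eq.oneH[of G H C \<phi> \<psi>] h by simp
    with Inr h that[of "Inr (inv\<^bsub>H\<^esub> h)"] show ?thesis by simp
  qed
  have "w \<in> W" using Cons by auto
  then have "amalg_eq G H C \<phi> \<psi> (v @ [y, x] @ w) (v @ [] @ w)"
    using v y by (intro amalg_eq.append amalg_eq.refl)
  with v have "amalg_eq G H C \<phi> \<psi> ((v @ [y]) @ x # w) []"
    using amalg_eq.trans by fastforce
  then show ?case using v y by (intro bexI[of _ "v @ [y]"]) auto
qed

lemma group_amalgamated_product: "group P"
proof (rule groupI)
  fix x y assume "x \<in> carrier P" "y \<in> carrier P"
  then obtain v w where "v \<in> W" "w \<in> W" "x = R `` {v}" "y = R `` {w}"
    by (auto simp only: amalg_carrier)
  moreover from this have "v @ w \<in> W" by (simp only: append_in_lists_conv simp_thms)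
  ultimately show "x \<otimes>\<^bsub>P\<^esub> y \<in> carrier P"
    unfolding amalg_carrier by (simp only: amalg_mult_class image_eqI)
next
  show "\<one>\<^bsub>P\<^esub> \<in> carrier P" by (auto simp: amalg_carrier amalg_one)
next
  fix x y z assume "x \<in> carrier P" "y \<in> carrier P" "z \<in> carrier P"
  then obtain u v w where "u \<in> W" "v \<in> W" "w \<in> W" "x = R `` {u}" "y = R `` {v}" "z = R `` {w}"
    by (auto simp only: amalg_carrier)
  then show "x \<otimes>\<^bsub>P\<^esub> y \<otimes>\<^bsub>P\<^esub> z = x \<otimes>\<^bsub>P\<^esub> (y \<otimes>\<^bsub>P\<^esub> z)"
    by (simp only: amalg_mult_class append_in_lists_conv append_assoc simp_thms)
next
  fix x assume "x \<in> carrier P"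
  then obtain w where "w \<in> W" "x = R `` {w}"
    by (auto simp only: amalg_carrier)
  then show "\<one>\<^bsub>P\<^esub> \<otimes>\<^bsub>P\<^esub> x = x"
    using amalg_mult_class[OF lists.Nil] by (simp only: amalg_one append_Nil)
next
  fix x assume "x \<in> carrier P"
  then obtain w where w: "w \<in> W" "x = R `` {w}" by (auto simp: amalg_carrier)
  obtain v where v: "v \<in> W" "amalg_eq G H C \<phi> \<psi> (v @ w) []"
    using amalg_left_inverse[OF w(1)] by auto
  have "R `` {v} \<otimes>\<^bsub>P\<^esub> x = \<one>\<^bsub>P\<^esub>"
    using v w amalg_class_eq_iff[of "v @ w" "[]"] by (simp add: amalg_mult_class amalg_one)
  then show "\<exists>y\<in>carrier P. y \<otimes>\<^bsub>P\<^esub> x = \<one>\<^bsub>P\<^esub>"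
    using v by (auto simp: amalg_carrier)
qed

lemma amalg_inl_hom: "(\<lambda>g. R `` {[Inl g]}) \<in> hom G P"
proof (rule homI)
  fix x y assume "x \<in> carrier G" "y \<in> carrier G"
  then show "R `` {[Inl (x \<otimes>\<^bsub>G\<^esub> y)]} = R `` {[Inl x]} \<otimes>\<^bsub>P\<^esub> R `` {[Inl y]}"
    using amalg_eq.sym[OF amalg_eq.multG[of x G y]]
    by (simp add: amalg_mult_class amalg_class_eq_iff)
qed (auto simp: amalg_carrier)

lemma amalg_inr_hom: "(\<lambda>h. R `` {[Inr h]}) \<in> hom H P"
proof (rule homI)
  fix x y assume "x \<in> carrier H" "y \<in> carrier H"
  then show "R `` {[Inr (x \<otimes>\<^bsub>H\<^esub> y)]} = R `` {[Inr x]} \<otimes>\<^bsub>P\<^esub> R `` {[Inr y]}"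
    using amalg_eq.sym[OF amalg_eq.multH[of x H y]]
    by (simp add: amalg_mult_class amalg_class_eq_iff)
qed (auto simp: amalg_carrier)

lemma amalg_commutes:
  assumes "c \<in> carrier C"
  shows "R `` {[Inl (\<phi> c)]} = R `` {[Inr (\<psi> c)]}"
proof -
  have "[Inl (\<phi> c)] \<in> W" "[Inr (\<psi> c)] \<in> W"
    using hom_in_carrier[OF \<phi> assms] hom_in_carrier[OF \<psi> assms] by simp_all
  then show ?thesis
    using amalg_eq.amalg[OF assms] by (simp only: amalg_class_eq_iff)
qed

text \<open>The universal property of the pushout; uniqueness holds on the carrier.\<close>

lemma amalg_lift:
  assumes K: "group K" and f: "f \<in> hom G K" and g: "g \<in> hom H K"
    and fg: "\<And>c. c \<in> carrier C \<Longrightarrow> f (\<phi> c) = g (\<psi> c)"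
  shows "\<exists>h \<in> hom P K. (\<forall>x \<in> carrier G. h (R `` {[Inl x]}) = f x) \<and>
                      (\<forall>y \<in> carrier H. h (R `` {[Inr y]}) = g y)"
proof -
  interpret K: group K by (rule K)
  interpret f: group_hom G K f by unfold_locales (rule f)
  interpret g: group_hom H K g by unfold_locales (rule g)
  define val where "val = (\<lambda>w. foldr (\<lambda>x a. case_sum f g x \<otimes>\<^bsub>K\<^esub> a) w \<one>\<^bsub>K\<^esub>)"
  have val_simps [simp]: "val [] = \<one>\<^bsub>K\<^esub>" "val (x # w) = case_sum f g x \<otimes>\<^bsub>K\<^esub> val w" for x w
    by (simp_all add: val_def)
  have letter_closed: "case_sum f g x \<in> carrier K" if "x \<in> carrier G <+> carrier H" for x
    using that by auto
  have val_closed: "val w \<in> carrier K" if "w \<in> W" for w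
    using that by (induction w) (auto simp: letter_closed)
  have val_append: "val (v @ w) = val v \<otimes>\<^bsub>K\<^esub> val w" if "v \<in> W" "w \<in> W" for v w
    using that by (induction v) (auto simp: letter_closed val_closed K.m_assoc)
  have val_eq: "val v = val w" if "amalg_eq G H C \<phi> \<psi> v w" for v w
    using that
  proof induction
    case (append v v' w w')
    then show ?case
      using amalg_eq_in_lists[OF append.hyps(1)] amalg_eq_in_lists[OF append.hyps(2)]
      by (metis val_append)
  next
    case (amalg c)
    then show ?case
      using fg[OF amalg] hom_in_carrier[OF \<phi> amalg] hom_in_carrier[OF \<psi> amalg] by simp
  qed simp_all
  define h where "h = (\<lambda>A. val (SOME w. w \<in> A))"
  have h: "h (R `` {w}) = val w" if "w \<in> W" for w
  proof -
    have "w \<in> R `` {w}" using equiv_class_self[OF equiv_amalg_rel that] .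
    then have "(SOME v. v \<in> R `` {w}) \<in> R `` {w}" by (rule someI)
    then have "amalg_eq G H C \<phi> \<psi> w (SOME v. v \<in> R `` {w})" by (simp add: amalg_rel_def)
    from val_eq[OF this] show ?thesis by (simp add: h_def)
  qed
  have "h \<in> hom P K"
  proof (rule homI)
    fix x assume "x \<in> carrier P"
    then obtain w where "w \<in> W" "x = R `` {w}" by (auto simp only: amalg_carrier)
    then show "h x \<in> carrier K" by (simp only: h val_closed)
  next
    fix x y assume "x \<in> carrier P" "y \<in> carrier P"
    then obtain v w where "v \<in> W" "w \<in> W" "x = R `` {v}" "y = R `` {w}"
      by (auto simp only: amalg_carrier)
    moreover from this have "v @ w \<in> W" by (simp only: append_in_lists_conv simp_thms)
    ultimately show "h (x \<otimes>\<^bsub>P\<^esub> y) = h x \<otimes>\<^bsub>K\<^esub> h y"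
      by (simp only: amalg_mult_class h val_append)
  qed
  then show ?thesis
    by (rule bexI[rotated]) (simp_all add: h)
qed

lemma amalg_lift_unique:
  assumes K: "group K" and h: "h \<in> hom P K" and k: "k \<in> hom P K"
    and "\<And>x. x \<in> carrier G \<Longrightarrow> h (R `` {[Inl x]}) = k (R `` {[Inl x]})"
    and "\<And>y. y \<in> carrier H \<Longrightarrow> h (R `` {[Inr y]}) = k (R `` {[Inr y]})"
    and "z \<in> carrier P"
  shows "h z = k z"
proof -
  have "h (R `` {w}) = k (R `` {w})" if "w \<in> W" for w
    using that
  proof (induction rule: lists.induct)
    case Nil
    show ?case
      using hom_one[OF h group_amalgamated_product K] hom_one[OF k group_amalgamated_product K]
      by (simp add: amalg_one)
  next
    case (Cons x w)
    have x: "[x] \<in> W" using Cons.hyps(1) by simp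
    have P: "R `` {[x]} \<in> carrier P" "R `` {w} \<in> carrier P"
      using x Cons.hyps(2) unfolding amalg_carrier by blast+
    have "h (R `` {[x]}) = k (R `` {[x]})"
      using Cons.hyps(1) assms(4,5) by (cases x) auto
    moreover have "R `` {x # w} = R `` {[x]} \<otimes>\<^bsub>P\<^esub> R `` {w}"
      using amalg_mult_class[OF x Cons.hyps(2)] by simp
    ultimately show ?case
      using hom_mult[OF h P] hom_mult[OF k P] Cons.IH by simp
  qed
  with \<open>z \<in> carrier P\<close> show ?thesis by (auto simp only: amalg_carrier)
qed

end

end

theory Submission
  imports Defs
begin

text \<open>
  Let \<open>P\<close> be the amalgamated product of \<open>G\<close> and \<open>H\<close> over the finite group \<open>C\<close>, and let a graph be given
  whose edges are labelled by generators of \<open>G\<close>, generators of \<open>H\<close> and elements of \<open>C\<close>.  If it has a path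
  from \<open>u\<close> to \<open>v\<close> whose value is some \<open>c \<in> C\<close>, then adding an edge \<open>(u, c, v)\<close> does not change the answer.
  Whether there is such a path inside one of the factors, that is, through edges with labels in \<open>G\<close>
  (or in \<open>H\<close>) and added edges only, can be asked of the decider for this factor (\<open>query_value\<close>).
  Saturation adds such edges in rounds.  As \<open>C\<close> is finite, a graph with \<open>n\<close> vertices has at most
  \<open>card C * n^2\<close> candidate edges, and as many rounds as candidates suffice.  The answer is the one that
  the decider for \<open>G\<close> gives on the saturated graph.

  The algorithm is sound because added edges run parallel to paths (\<open>path_partG\<close>, \<open>path_partH\<close>); for
  the same reason the graph remains acyclic, which the deciders insist on.  It is complete because
  of the normal form theorem (\<open>reduced_not_amalgamated\<close>): a nonempty word that alternates between the
  factors and has no syllable from \<open>C\<close> has no value in \<open>C\<close>.  So a path of value 1, cut into syllables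
  from \<open>G\<close> and \<open>H\<close>, has two neighbouring syllables in the same factor or a syllable from \<open>C\<close>.  In a
  saturated graph a syllable from \<open>C\<close> can be moved to the other factor, and so two neighbours can be
  merged.  Repeating this leaves one syllable (\<open>chain_collapse\<close>).  The normal form theorem is proved
  by letting both factors act on the set of normal forms.

  All of this assumes generators that contain \<open>C\<close> and are numbered alike in \<open>G\<close>, \<open>H\<close> and \<open>P\<close>.  This is
  no restriction, since the complexity does not depend on the generators
  (\<open>AGWP_PTIME_change_generators\<close>): one may adjoin a product of two letters by subdividing edges, and
  every element is reached in finitely many such steps.

  That everything takes polynomial time is shown through a class of functions on data that are
  encoded as binary trees (\<open>pt\<close>).  It is closed under composition, pairing, case distinction, and folds
  whose intermediate values are polynomially bounded, and it contains the characteristic function of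
  every problem in \<^const>\<open>PTIME\<close>.  A tree is stored by a prefix code, so programs recognise where a tree
  ends and can be nested like those of a stack-based language.
\<close>

section \<open>Polynomial bounds\<close>

lemma poly_nat_mono: "m \<le> n \<Longrightarrow> poly (p :: nat poly) m \<le> poly p n"
  by (induction p) (auto intro!: add_mono mult_mono)

definition poly_bounded :: "(nat \<Rightarrow> nat) \<Rightarrow> bool" where
  "poly_bounded f \<longleftrightarrow> (\<exists>p. \<forall>n. f n \<le> poly p n)"

lemma poly_bounded_poly: "poly_bounded (poly p)"
  by (auto simp: poly_bounded_def)

lemma poly_bounded_const [intro!]: "poly_bounded (\<lambda>_. c)"
  unfolding poly_bounded_def by (rule exI[of _ "[:c:]"]) simp

lemma poly_bounded_id [intro!]: "poly_bounded (\<lambda>n. n)"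
  unfolding poly_bounded_def by (rule exI[of _ "[:0, 1:]"]) simp

lemma poly_bounded_add [intro!]:
  assumes "poly_bounded f" "poly_bounded g" shows "poly_bounded (\<lambda>n. f n + g n)"
proof -
  obtain p q where "\<forall>n. f n \<le> poly p n" "\<forall>n. g n \<le> poly q n"
    using assms by (auto simp: poly_bounded_def)
  then show ?thesis unfolding poly_bounded_def
    by (intro exI[of _ "p + q"]) (auto intro: add_mono)
qed

lemma poly_bounded_mult [intro!]:
  assumes "poly_bounded f" "poly_bounded g" shows "poly_bounded (\<lambda>n. f n * g n)"
proof -
  obtain p q where "\<forall>n. f n \<le> poly p n" "\<forall>n. g n \<le> poly q n"
    using assms by (auto simp: poly_bounded_def)
  then show ?thesis unfolding poly_bounded_def
    by (intro exI[of _ "p * q"]) (auto intro: mult_mono)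
qed

lemma poly_bounded_Suc [intro!]: "poly_bounded f \<Longrightarrow> poly_bounded (\<lambda>n. Suc (f n))"
  using poly_bounded_add[of "\<lambda>_. 1" f] by auto

lemma poly_bounded_compose:
  assumes "poly_bounded f" "poly_bounded g" shows "poly_bounded (\<lambda>n. f (g n))"
proof -
  obtain p q where pq: "\<forall>n. f n \<le> poly p n" "\<forall>n. g n \<le> poly q n"
    using assms by (auto simp: poly_bounded_def)
  have "f (g n) \<le> poly (pcompose p q) n" for n
    using pq poly_nat_mono[of "g n" "poly q n" p] order_trans[of "f (g n)" "poly p (g n)"] by (simp add: poly_pcompose)
  then show ?thesis by (auto simp: poly_bounded_def)
qed

lemma poly_bounded_poly_comp [intro!]: "poly_bounded f \<Longrightarrow> poly_bounded (\<lambda>n. poly p (f n))"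
  by (rule poly_bounded_compose[OF poly_bounded_poly])

section \<open>Executions of stack programs\<close>

text \<open>
  Only upper bounds on running times matter, so exact step counts are given up at once.
\<close>

definition runs :: "prog \<Rightarrow> store \<Rightarrow> nat \<Rightarrow> store \<Rightarrow> bool" where
  "runs p s n s' \<longleftrightarrow> (\<exists>t\<le>n. exec p s t s')"

lemma runs_exec: "exec p s t s' \<Longrightarrow> runs p s t s'"
  by (auto simp: runs_def)

lemma runs_mono: "runs p s m s' \<Longrightarrow> m \<le> n \<Longrightarrow> runs p s n s'"
  unfolding runs_def by (meson le_trans)

lemma runs_Seq: "runs p s m s' \<Longrightarrow> runs q s' n s'' \<Longrightarrow> runs (Seq p q) s (m + n) s''"
  unfolding runs_def by (meson add_mono exec.Seq)

lemma runs_Cond: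
  assumes "top_of (s k) \<in> T \<Longrightarrow> runs p s n s'" "top_of (s k) \<notin> T \<Longrightarrow> runs q s n s'"
  shows "runs (Cond k T p q) s (Suc n) s'"
proof (cases "top_of (s k) \<in> T")
  case True
  with assms(1) obtain t where "t \<le> n" "exec p s t s'" by (auto simp: runs_def)
  with True show ?thesis unfolding runs_def by (intro exI[of _ "Suc t"]) (auto intro: exec.CondTrue)
next
  case False
  with assms(2) obtain t where "t \<le> n" "exec q s t s'" by (auto simp: runs_def)
  with False show ?thesis unfolding runs_def by (intro exI[of _ "Suc t"]) (auto intro: exec.CondFalse)
qed

lemma runs_While_step:
  assumes "top_of (s k) \<in> T" "runs p s m s'" "runs (While k T p) s' n s''"
  shows "runs (While k T p) s (Suc (m + n)) s''"
  using assms unfolding runs_def by (meson Suc_le_mono add_mono exec.WhileTrue)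

lemma runs_While_stop: "top_of (s k) \<notin> T \<Longrightarrow> runs (While k T p) s 1 s"
  by (intro runs_exec exec.WhileFalse)

lemma runs_Push: "runs (Push k b) s 1 (s(k := b # s k))"
  and runs_Pop: "runs (Pop k) s 1 (s(k := tl (s k)))"
  and runs_Skip: "runs Skip s 1 s"
  by (intro runs_exec exec.intros)+

lemma top_of_simps [simp]: "top_of [] = None" "top_of (x # xs) = Some x"
  by (auto simp: top_of_def)

lemma exec_length: "exec p s t s' \<Longrightarrow> length (s' k) \<le> length (s k) + t"
proof (induction rule: exec.induct)
  case (Pop j s) show ?case by (cases "j = k") auto
qed auto

section \<open>Trees as data\<close>

datatype tree = Leaf | Node tree tree

text \<open>A prefix code: a program can recognise the end of a tree that lies on top of other data.\<close>

fun flat :: "tree \<Rightarrow> bool list" where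
  "flat Leaf = [False]"
| "flat (Node x y) = True # flat x @ flat y"

abbreviation tsize :: "tree \<Rightarrow> nat" where
  "tsize x \<equiv> length (flat x)"

text \<open>
  The calling convention of all programs below: data lie on stacks 0, 1 and 2, every other stack is
  empty between calls and serves as scratch space.
\<close>

definition stk :: "bool list \<Rightarrow> bool list \<Rightarrow> bool list \<Rightarrow> store" where
  "stk a b c = (\<lambda>k. if k = 0 then a else if k = 1 then b else if k = 2 then c else [])"

lemma stk_simps [simp]: "stk a b c 0 = a" "stk a b c (Suc 0) = b" "stk a b c 2 = c"
  "k \<ge> 3 \<Longrightarrow> stk a b c k = []"
  by (auto simp: stk_def)

subsection \<open>Moving trees between stacks\<close>

text \<open>
  Takes a tree off stack \<open>i\<close> and leaves its code, reversed, on stack 3.  Stack 4 counts in unary the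
  trees that are still to be read: a \<^const>\<open>Node\<close> replaces one tree by two, a \<^const>\<open>Leaf\<close> completes one.
\<close>

definition unstack :: "nat \<Rightarrow> prog" where
  "unstack i = While 4 {Some True} (Cond i {Some True}
     (Seq (Pop i) (Seq (Push 3 True) (Push 4 True)))
     (Seq (Pop i) (Seq (Push 3 False) (Pop 4))))"

text \<open>
  The loop does not stop at the end of a subtree, so the induction needs a statement about the rest
  of the run: \<open>n\<close> bounds the steps from the moment when \<open>x\<close> has been read.
\<close>

lemma runs_unstack:
  assumes "i < 3" "s i = flat x @ r" "s 4 = replicate (Suc m) True"
    "runs (unstack i) (s(i := r, 3 := rev (flat x) @ s 3, 4 := replicate m True)) n s'"
  shows "runs (unstack i) s (5 * tsize x + n) s'"
  using assms
proof (induction x arbitrary: s r m n)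
  case Leaf
  have "runs (Cond i {Some True}
     (Seq (Pop i) (Seq (Push 3 True) (Push 4 True)))
     (Seq (Pop i) (Seq (Push 3 False) (Pop 4)))) s (Suc (1 + (1 + 1))) (s(i := r, 3 := False # s 3, 4 := replicate m True))"
  proof -
    have "runs (Seq (Pop i) (Seq (Push 3 False) (Pop 4))) s (1 + (1 + 1))
        (let s1 = s(i := tl (s i)); s2 = s1(3 := False # s1 3) in s2(4 := tl (s2 4)))"
      unfolding Let_def by (rule runs_Seq runs_Push runs_Pop)+
    also have "(let s1 = s(i := tl (s i)); s2 = s1(3 := False # s1 3) in s2(4 := tl (s2 4)))
      = s(i := r, 3 := False # s 3, 4 := replicate m True)"
      using Leaf by (auto simp: Let_def fun_eq_iff)
    finally have "runs (Seq (Pop i) (Seq (Push 3 False) (Pop 4))) s (1 + (1 + 1)) (s(i := r, 3 := False # s 3, 4 := replicate m True))" .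
    then have "runs (Cond i {Some True}
       (Seq (Pop i) (Seq (Push 3 True) (Push 4 True)))
       (Seq (Pop i) (Seq (Push 3 False) (Pop 4)))) s (Suc (1 + (1 + 1))) (s(i := r, 3 := False # s 3, 4 := replicate m True))"
      by (intro runs_Cond) (use Leaf in auto)
    then show ?thesis by simp
  qed
  moreover have "runs (unstack i) (s(i := r, 3 := False # s 3, 4 := replicate m True)) n s'"
    using Leaf(4) by (simp only: flat.simps rev.simps append_Nil append_Cons)
  note this[unfolded unstack_def]
  ultimately have "runs (unstack i) s (Suc (Suc (1 + (1 + 1)) + n)) s'"
    unfolding unstack_def by (intro runs_While_step) (use Leaf in auto)
  then show ?case by (rule runs_mono) simp
next
  case (Node x y)
  let ?s1 = "s(i := flat x @ flat y @ r, 3 := True # s 3, 4 := replicate (Suc (Suc m)) True)"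
  let ?s2 = "?s1(i := flat y @ r, 3 := rev (flat x) @ True # s 3, 4 := replicate (Suc m) True)"
  have "runs (Seq (Pop i) (Seq (Push 3 True) (Push 4 True))) s (1 + (1 + 1))
      (let s1 = s(i := tl (s i)); s2 = s1(3 := True # s1 3) in s2(4 := True # s2 4))"
    unfolding Let_def by (rule runs_Seq runs_Push runs_Pop)+
  also have "(let s1 = s(i := tl (s i)); s2 = s1(3 := True # s1 3) in s2(4 := True # s2 4)) = ?s1"
    using Node.prems by (auto simp: Let_def fun_eq_iff)
  finally have "runs (Seq (Pop i) (Seq (Push 3 True) (Push 4 True))) s (1 + (1 + 1)) ?s1" .
  then have 1: "runs (Cond i {Some True}
     (Seq (Pop i) (Seq (Push 3 True) (Push 4 True)))
     (Seq (Pop i) (Seq (Push 3 False) (Pop 4)))) s (Suc (1 + (1 + 1))) ?s1"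
    by (intro runs_Cond) (use Node.prems in auto)
  have eq: "?s2(i := r, 3 := rev (flat y) @ ?s2 3, 4 := replicate m True)
      = s(i := r, 3 := rev (flat (Node x y)) @ s 3, 4 := replicate m True)"
    using Node.prems by (auto simp: fun_eq_iff)
  have "runs (unstack i) (?s2(i := r, 3 := rev (flat y) @ ?s2 3, 4 := replicate m True)) n s'"
    unfolding eq by (rule Node.prems(4))
  then have "runs (unstack i) ?s2 (5 * tsize y + n) s'"
    by (rule Node.IH(2)[where r = r and m = m, rotated 3]) (use Node.prems in auto)
  note IH2 = this
  have eq2: "?s1(i := flat y @ r, 3 := rev (flat x) @ ?s1 3, 4 := replicate (Suc m) True) = ?s2"
    by simp
  have "runs (unstack i) (?s1(i := flat y @ r, 3 := rev (flat x) @ ?s1 3, 4 := replicate (Suc m) True)) (5 * tsize y + n) s'"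
    unfolding eq2 by (rule IH2)
  then have "runs (unstack i) ?s1 (5 * tsize x + (5 * tsize y + n)) s'"
    by (rule Node.IH(1)[where r = "flat y @ r" and m = "Suc m", rotated 3]) (use Node.prems in auto)
  note 2 = this
  have "runs (unstack i) s (Suc (Suc (1 + (1 + 1)) + (5 * tsize x + (5 * tsize y + n)))) s'"
    unfolding unstack_def by (rule runs_While_step[OF _ 1 2[unfolded unstack_def]]) (simp add: Node.prems)
  then show ?case by (rule runs_mono) simp
qed

fun pushes :: "nat list \<Rightarrow> bool \<Rightarrow> prog" where
  "pushes [] b = Skip"
| "pushes (j # js) b = Seq (Push j b) (pushes js b)"

lemma runs_pushes:
  "distinct js \<Longrightarrow> runs (pushes js b) s (Suc (length js)) (\<lambda>k. if k \<in> set js then b # s k else s k)"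
proof (induction js arbitrary: s)
  case Nil
  then show ?case using runs_Skip by simp
next
  case (Cons j js)
  have "runs (pushes (j # js) b) s (1 + Suc (length js))
      (\<lambda>k. if k \<in> set js then b # (s(j := b # s j)) k else (s(j := b # s j)) k)"
    unfolding pushes.simps by (rule runs_Seq runs_Push Cons.IH | use Cons.prems in force)+
  then show ?case
    by (rule back_subst[where P = "\<lambda>s'. runs _ s _ s'", THEN runs_mono]) (use Cons.prems in \<open>auto simp: fun_eq_iff\<close>)
qed

text \<open>
  Moves all of stack \<open>i\<close>, reversing it, onto each of the stacks \<open>js\<close>; no targets means clearing, two
  targets mean copying.
\<close>

definition drain :: "nat \<Rightarrow> nat list \<Rightarrow> prog" where
  "drain i js = While i {Some True, Some False}
     (Cond i {Some True} (Seq (Pop i) (pushes js True)) (Seq (Pop i) (pushes js False)))"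

lemma runs_drain:
  assumes "distinct js" "i \<notin> set js"
  shows "runs (drain i js) s ((length js + 4) * length (s i) + 1)
    (\<lambda>k. if k = i then [] else if k \<in> set js then rev (s i) @ s k else s k)"
proof (induction "s i" arbitrary: s)
  case Nil
  then have "(\<lambda>k. if k = i then [] else if k \<in> set js then rev (s i) @ s k else s k) = s"
    by (auto simp: fun_eq_iff)
  with Nil show ?case
    using runs_While_stop[of s i "{Some True, Some False}"] by (simp add: drain_def)
next
  case (Cons b z)
  let ?s1 = "s(i := tl (s i))"
  let ?s2 = "\<lambda>k. if k \<in> set js then b # ?s1 k else ?s1 k"
  have *: "runs (Seq (Pop i) (pushes js b)) s (1 + Suc (length js)) ?s2"
    by (rule runs_Seq runs_Pop runs_pushes assms)+
  have "runs (Cond i {Some True} (Seq (Pop i) (pushes js True)) (Seq (Pop i) (pushes js False))) s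
      (Suc (1 + Suc (length js))) ?s2"
    by (rule runs_Cond) (use * Cons(2)[symmetric] in \<open>auto\<close>)
  moreover have "z = ?s2 i" using assms Cons(2)[symmetric] by auto
  note Cons(1)[of ?s2, OF this]
  ultimately have "runs (drain i js) s (Suc ((Suc (1 + Suc (length js))) + ((length js + 4) * length (?s2 i) + 1)))
    (\<lambda>k. if k = i then [] else if k \<in> set js then rev (?s2 i) @ ?s2 k else ?s2 k)"
    unfolding drain_def by (intro runs_While_step) (use Cons(2)[symmetric] in auto)
  then have "runs (drain i js) s ((length js + 4) * length (s i) + 1)
    (\<lambda>k. if k = i then [] else if k \<in> set js then rev (?s2 i) @ ?s2 k else ?s2 k)"
    by (rule runs_mono) (use Cons(2)[symmetric] assms in \<open>auto simp: algebra_simps\<close>)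
  then show ?case
    by (rule back_subst[where P = "\<lambda>s'. runs _ s _ s'"])
      (use Cons(2)[symmetric] assms in \<open>auto simp: fun_eq_iff\<close>)
qed

text \<open>
  Passing through stack 3 reverses the code a second time, which restores its order.
\<close>

definition transfer :: "nat \<Rightarrow> nat list \<Rightarrow> prog" where
  "transfer i js = Seq (Push 4 True) (Seq (unstack i) (drain 3 js))"

lemma runs_transfer:
  assumes "i < 3" "distinct js" "set js \<subseteq> {..<3}" "s i = flat x @ r" "s 3 = []" "s 4 = []"
  shows "runs (transfer i js) s ((length js + 9) * tsize x + 3)
    (\<lambda>k. if k \<in> set js then flat x @ (s(i := r)) k else (s(i := r)) k)"
proof -
  let ?s1 = "s(4 := True # s 4)" and ?s2 = "s(i := r, 3 := rev (flat x), 4 := [])"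
  have "runs (unstack i) ?s2 1 ?s2"
    unfolding unstack_def by (rule runs_While_stop) auto
  then have "runs (unstack i) (?s1(i := r, 3 := rev (flat x) @ ?s1 3, 4 := replicate 0 True)) 1 ?s2"
    using assms by (elim back_subst[where P = "\<lambda>s. runs _ s _ _"]) (auto simp: fun_eq_iff)
  then have A: "runs (unstack i) ?s1 (5 * tsize x + 1) ?s2"
    by (intro runs_unstack[where m = 0 and r = r]) (use assms in auto)
  have B: "runs (drain 3 js) ?s2 ((length js + 4) * length (?s2 3) + 1)
    (\<lambda>k. if k = 3 then [] else if k \<in> set js then rev (?s2 3) @ ?s2 k else ?s2 k)"
    by (rule runs_drain) (use assms in auto)
  have "runs (transfer i js) s (1 + ((5 * tsize x + 1) + ((length js + 4) * length (?s2 3) + 1)))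
    (\<lambda>k. if k = 3 then [] else if k \<in> set js then rev (?s2 3) @ ?s2 k else ?s2 k)"
    unfolding transfer_def by (rule runs_Seq[OF runs_Push runs_Seq[OF A B]])
  then have "runs (transfer i js) s ((length js + 9) * tsize x + 3)
    (\<lambda>k. if k = 3 then [] else if k \<in> set js then rev (?s2 3) @ ?s2 k else ?s2 k)"
    by (rule runs_mono) (auto simp: algebra_simps)
  then show ?thesis
    by (rule back_subst[where P = "\<lambda>s'. runs _ s _ s'"]) (use assms in \<open>auto simp: fun_eq_iff\<close>)
qed

lemma runs_transfer_stk:
  assumes "i < 3" "distinct js" "set js \<subseteq> {..<3}" "stk a b c i = flat x @ r"
    "stk a' b' c' = (\<lambda>k. if k \<in> set js then flat x @ ((stk a b c)(i := r)) k else ((stk a b c)(i := r)) k)"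
  shows "runs (transfer i js) (stk a b c) (12 * tsize x + 3) (stk a' b' c')"
proof -
  have "length js \<le> 3"
    using assms(2,3) card_mono[of "{..<3}" "set js"] by (simp add: distinct_card)
  then have "(length js + 9) * tsize x + 3 \<le> 12 * tsize x + 3" by simp
  moreover have "runs (transfer i js) (stk a b c) ((length js + 9) * tsize x + 3) (stk a' b' c')"
    unfolding assms(5) by (rule runs_transfer) (use assms in auto)
  ultimately show ?thesis by (rule runs_mono[rotated])
qed

lemma runs_move:
  "runs (transfer 0 [1]) (stk (flat x @ r) b c) (12 * tsize x + 3) (stk r (flat x @ b) c)"
  "runs (transfer 0 [2]) (stk (flat x @ r) b c) (12 * tsize x + 3) (stk r b (flat x @ c))"
  "runs (transfer 1 [0]) (stk a (flat x @ r) c) (12 * tsize x + 3) (stk (flat x @ a) r c)"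
  "runs (transfer 2 [0]) (stk a b (flat x @ r)) (12 * tsize x + 3) (stk (flat x @ a) b r)"
  "runs (transfer 0 []) (stk (flat x @ r) b c) (12 * tsize x + 3) (stk r b c)"
  "runs (transfer 0 [0, 1]) (stk (flat x @ r) b c) (12 * tsize x + 3) (stk (flat x @ r) (flat x @ b) c)"
  by (rule runs_transfer_stk; force simp: stk_def)+

definition swap :: prog where
  "swap = Seq (transfer 0 [1]) (Seq (transfer 0 [2]) (Seq (transfer 1 [0]) (transfer 2 [0])))"

lemma runs_swap:
  "runs swap (stk (flat x @ flat y @ r) b c) (24 * tsize x + 24 * tsize y + 12) (stk (flat y @ flat x @ r) b c)"
  unfolding swap_def
  by (rule runs_mono, (rule runs_Seq runs_move)+) simp

definition dup :: prog where
  "dup = Seq (transfer 0 [0, 1]) (transfer 1 [0])"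

lemma runs_dup:
  "runs dup (stk (flat x @ r) b c) (24 * tsize x + 6) (stk (flat x @ flat x @ r) b c)"
  unfolding dup_def
  by (rule runs_mono, (rule runs_Seq runs_move)+) simp

lemma runs_push_stk: "runs (Push 0 v) (stk a b c) 1 (stk (v # a) b c)"
  using runs_Push[of 0 v "stk a b c"] by (rule back_subst[where P = "\<lambda>s'. runs _ _ _ s'"]) (auto simp: stk_def)

lemma runs_pop_stk: "runs (Pop 0) (stk (v # a) b c) 1 (stk a b c)"
  using runs_Pop[of 0 "stk (v # a) b c"] by (rule back_subst[where P = "\<lambda>s'. runs _ _ _ s'"]) (auto simp: stk_def)

section \<open>Polynomial-time functions on encoded data\<close>

class enc =
  fixes enc :: "'a \<Rightarrow> tree"

instantiation unit :: enc
begin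
definition "enc (_ :: unit) = Leaf"
instance ..
end

instantiation bool :: enc
begin
definition "enc b = (if b then Node Leaf Leaf else Leaf)"
instance ..
end

text \<open>
  Numbers are unary, so a number and a list of units of that length have the same code; loops over
  a number are loops over a list.
\<close>

instantiation nat :: enc
begin
primrec enc_nat :: "nat \<Rightarrow> tree" where
  "enc_nat 0 = Leaf"
| "enc_nat (Suc n) = Node Leaf (enc_nat n)"
instance ..
end

instantiation prod :: (enc, enc) enc
begin
definition "enc p = Node (enc (fst p)) (enc (snd p))"
instance ..
end

instantiation list :: (enc) enc
begin
primrec enc_list :: "'a list \<Rightarrow> tree" where
  "enc_list [] = Leaf"
| "enc_list (x # xs) = Node (enc x) (enc_list xs)"
instance ..
end

abbreviation sz :: "'a::enc \<Rightarrow> nat" where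
  "sz x \<equiv> tsize (enc x)"

lemma enc_simps [simp]:
  "enc () = Leaf" "enc True = Node Leaf Leaf" "enc False = Leaf" "enc (a, b) = Node (enc a) (enc b)"
  by (auto simp: enc_unit_def enc_bool_def enc_prod_def)

lemma sz_nat: "sz (n :: nat) = 2 * n + 1"
  by (induction n) auto

lemma sz_append: "sz (xs @ ys) \<le> sz xs + sz ys"
  by (induction xs) auto

text \<open>
  The rest \<open>r\<close> of stack 0 and the contents of stacks 1 and 2 are arbitrary and are left untouched.  So
  a program can be called while its caller keeps data beneath the argument and on the other stacks,
  and composition of functions is sequencing of programs.
\<close>

definition pt :: "('a::enc \<Rightarrow> 'b::enc) \<Rightarrow> bool" where
  "pt f \<longleftrightarrow> (\<exists>p h. \<forall>x r b c.
     runs p (stk (flat (enc x) @ r) b c) (poly h (sz x)) (stk (flat (enc (f x)) @ r) b c))"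

named_theorems pt_intros

lemma ptI:
  assumes "poly_bounded h"
    and "\<And>x r b c. runs p (stk (flat (enc x) @ r) b c) (h (sz x)) (stk (flat (enc (f x)) @ r) b c)"
  shows "pt f"
proof -
  obtain q where "\<forall>n. h n \<le> poly q n" using assms(1) by (auto simp: poly_bounded_def)
  with assms(2) show ?thesis unfolding pt_def by (metis runs_mono)
qed

text \<open>
  A step pushes at most one bit, so a polynomial time bound also bounds the size of the result.
\<close>

lemma ptE:
  assumes "pt f"
  obtains p h where
    "\<And>x r b c. runs p (stk (flat (enc x) @ r) b c) (poly h (sz x)) (stk (flat (enc (f x)) @ r) b c)"
    "\<And>x. sz (f x) \<le> sz x + poly h (sz x)"
proof -
  obtain p h where 1: "\<And>x r b c. runs p (stk (flat (enc x) @ r) b c) (poly h (sz x)) (stk (flat (enc (f x)) @ r) b c)"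
    using assms unfolding pt_def by blast
  have "sz (f x) \<le> sz x + poly h (sz x)" for x
  proof -
    obtain t where "t \<le> poly h (sz x)" "exec p (stk (flat (enc x) @ []) [] []) t (stk (flat (enc (f x)) @ []) [] [])"
      using 1[of x "[]" "[]" "[]"] by (auto simp: runs_def)
    from this(1) exec_length[OF this(2), of 0] show ?thesis by simp
  qed
  with 1 that show ?thesis by blast
qed

lemma pt_sz:
  assumes "pt f" obtains h where "poly_bounded h" "\<And>x. sz (f x) \<le> h (sz x)" "mono h"
proof -
  obtain p h where "\<And>x. sz (f x) \<le> sz x + poly h (sz x)"
    using assms by (elim ptE) blast
  moreover have "poly_bounded (\<lambda>n. n + poly h n)"
    by (intro poly_bounded_add poly_bounded_id poly_bounded_poly)
  moreover have "mono (\<lambda>n. n + poly h n)"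
    by (auto simp: mono_def intro: add_mono poly_nat_mono)
  ultimately show ?thesis using that by blast
qed

lemma pt_cast:
  assumes "\<And>x. enc (f x) = enc x" shows "pt f"
  by (rule ptI[of "\<lambda>_. 1" Skip]) (blast, simp only: assms runs_Skip)

lemma pt_id [pt_intros]: "pt (\<lambda>x. x)"
  by (rule pt_cast) simp

lemma pt_compose:
  assumes "pt f" "pt g" shows "pt (\<lambda>x. f (g x))"
proof -
  obtain p h where f: "\<And>x r b c. runs p (stk (flat (enc x) @ r) b c) (poly h (sz x)) (stk (flat (enc (f x)) @ r) b c)"
    by (rule ptE[OF assms(1)], rule that)
  obtain q k where g: "\<And>x r b c. runs q (stk (flat (enc x) @ r) b c) (poly k (sz x)) (stk (flat (enc (g x)) @ r) b c)"
    and gs: "\<And>x. sz (g x) \<le> sz x + poly k (sz x)"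
    by (rule ptE[OF assms(2)], rule that)
  show ?thesis
  proof (rule ptI[of "\<lambda>n. poly k n + poly h (n + poly k n)"])
    fix x r b c
    have "runs (Seq q p) (stk (flat (enc x) @ r) b c) (poly k (sz x) + poly h (sz (g x))) (stk (flat (enc (f (g x))) @ r) b c)"
      by (rule runs_Seq g f)+
    then show "runs (Seq q p) (stk (flat (enc x) @ r) b c) (poly k (sz x) + poly h (sz x + poly k (sz x)))
       (stk (flat (enc (f (g x))) @ r) b c)"
      by (rule runs_mono) (use gs poly_nat_mono in auto)
  qed (intro poly_bounded_add poly_bounded_poly poly_bounded_poly_comp poly_bounded_id)
qed

lemma pt_Pair [pt_intros]:
  assumes "pt f" "pt g" shows "pt (\<lambda>x. (f x, g x))"
proof -
  obtain p h where f: "\<And>x r b c. runs p (stk (flat (enc x) @ r) b c) (poly h (sz x)) (stk (flat (enc (f x)) @ r) b c)"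
    by (rule ptE[OF assms(1)], rule that)
  obtain q k where g: "\<And>x r b c. runs q (stk (flat (enc x) @ r) b c) (poly k (sz x)) (stk (flat (enc (g x)) @ r) b c)"
    and gs: "\<And>x. sz (g x) \<le> sz x + poly k (sz x)"
    by (rule ptE[OF assms(2)], rule that)
  let ?p = "Seq dup (Seq q (Seq swap (Seq p (Push 0 True))))"
  show ?thesis
  proof (rule ptI[of "\<lambda>n. (24 * n + 6) + (poly k n + ((24 * (n + poly k n) + 24 * n + 12) + (poly h n + 1)))"])
    fix x r b c
    have "runs ?p (stk (flat (enc x) @ r) b c) ((24 * sz x + 6) + (poly k (sz x) + ((24 * sz (g x) + 24 * sz x + 12)
        + (poly h (sz x) + 1)))) (stk (True # (flat (enc (f x)) @ flat (enc (g x)) @ r)) b c)"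
      by (rule runs_Seq g f runs_dup runs_swap runs_push_stk)+
    then show "runs ?p (stk (flat (enc x) @ r) b c) ((24 * sz x + 6) + (poly k (sz x) + ((24 * (sz x + poly k (sz x)) + 24 * sz x + 12)
        + (poly h (sz x) + 1)))) (stk (flat (enc (f x, g x)) @ r) b c)"
      using gs[of x] by (auto elim!: runs_mono)
  qed (intro poly_bounded_add poly_bounded_mult poly_bounded_poly poly_bounded_poly_comp poly_bounded_id poly_bounded_const)
qed

fun right :: "tree \<Rightarrow> tree" where
  "right Leaf = Leaf" | "right (Node x y) = y"

lemma pt_right:
  assumes "\<And>x. enc (f x) = right (enc x)" shows "pt f"
proof -
  let ?q = "Seq (Pop 0) (transfer 0 [])"
  show ?thesis
  proof (rule ptI[of "\<lambda>n. Suc (50 * n + 20)"])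
    fix x :: 'a and r b c
    show "runs (Cond 0 {Some True} ?q Skip) (stk (flat (enc x) @ r) b c) (Suc (50 * sz x + 20)) (stk (flat (enc (f x)) @ r) b c)"
    proof (cases "enc x")
      case Leaf
      then show ?thesis
        by (intro runs_Cond) (auto intro: runs_mono[OF runs_Skip] simp: assms)
    next
      case (Node y z)
      have "runs ?q (stk (True # flat y @ flat z @ r) b c) (1 + (12 * tsize y + 3)) (stk (flat z @ r) b c)"
        by (rule runs_Seq runs_pop_stk runs_move)+
      with Node show ?thesis by (intro runs_Cond) (auto elim!: runs_mono simp: assms)
    qed
  qed (intro poly_bounded_Suc poly_bounded_add poly_bounded_mult poly_bounded_id poly_bounded_const)
qed

lemma pt_snd [pt_intros]: "pt f \<Longrightarrow> pt (\<lambda>x. snd (f x))"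
  by (rule pt_compose[of snd]) (rule pt_right, auto simp: enc_prod_def)

lemma pt_fst [pt_intros]:
  assumes "pt f" shows "pt (\<lambda>x. fst (f x))"
proof (rule pt_compose[OF _ assms])
  let ?q = "Seq (Pop 0) (Seq swap (transfer 0 []))"
  show "pt (fst :: 'b \<times> 'c \<Rightarrow> 'b)"
  proof (rule ptI[of "\<lambda>n. 50 * n + 20"])
    fix x :: "'b \<times> 'c" and r b c
    obtain y z where x: "x = (y, z)" by (cases x)
    have "runs ?q (stk (True # flat (enc y) @ flat (enc z) @ r) b c)
        (1 + ((24 * sz y + 24 * sz z + 12) + (12 * sz z + 3))) (stk (flat (enc y) @ r) b c)"
      by (rule runs_Seq runs_pop_stk runs_swap runs_move)+
    then show "runs ?q (stk (flat (enc x) @ r) b c) (50 * sz x + 20) (stk (flat (enc (fst x)) @ r) b c)"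
      by (auto elim!: runs_mono simp: x)
  qed (intro poly_bounded_add poly_bounded_mult poly_bounded_id poly_bounded_const)
qed

lemma runs_push_tree:
  "\<exists>p. \<forall>r b c. runs p (stk r b c) (tsize x) (stk (flat x @ r) b c)"
proof (induction x)
  case Leaf
  show ?case using runs_push_stk[of False] by auto
next
  case (Node x y)
  then obtain p q where p: "\<And>r b c. runs p (stk r b c) (tsize x) (stk (flat x @ r) b c)"
    and q: "\<And>r b c. runs q (stk r b c) (tsize y) (stk (flat y @ r) b c)" by blast
  have "runs (Seq q (Seq p (Push 0 True))) (stk r b c) (tsize y + (tsize x + 1)) (stk (True # flat x @ flat y @ r) b c)" for r b c
    by (rule runs_Seq p q runs_push_stk)+
  then show ?case by (intro exI[of _ "Seq q (Seq p (Push 0 True))"]) (auto simp: algebra_simps)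
qed

lemma pt_const [pt_intros]: "pt (\<lambda>_. y)"
proof -
  obtain p where p: "\<And>r b c. runs p (stk r b c) (sz y) (stk (flat (enc y) @ r) b c)"
    using runs_push_tree by blast
  show ?thesis
  proof (rule ptI[of "\<lambda>n. (12 * n + 3) + sz y" "Seq (transfer 0 []) p"])
    fix x :: 'a and r b c
    show "runs (Seq (transfer 0 []) p) (stk (flat (enc x) @ r) b c) ((12 * sz x + 3) + sz y) (stk (flat (enc y) @ r) b c)"
      by (rule runs_Seq runs_move p)+
  qed (intro poly_bounded_add poly_bounded_mult poly_bounded_id poly_bounded_const)
qed

text \<open>
  The machine tests only whether a code is \<^const>\<open>Leaf\<close>.  This distinguishes \<^const>\<open>False\<close> from \<^const>\<open>True\<close>,
  \<open>0\<close> from successors, and empty from nonempty lists.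
\<close>

lemma pt_cond:
  fixes B :: "'a::enc \<Rightarrow> 'b::enc" and h :: "'a \<Rightarrow> 'c::enc"
  assumes "pt B" "pt f" "pt g" "\<And>x. enc (B x) = Leaf \<Longrightarrow> h x = f x" "\<And>x. enc (B x) \<noteq> Leaf \<Longrightarrow> h x = g x"
  shows "pt h"
proof -
  obtain pB hB where B: "\<And>x r b c. runs pB (stk (flat (enc x) @ r) b c) (poly hB (sz x)) (stk (flat (enc (B x)) @ r) b c)"
    and Bs: "\<And>x. sz (B x) \<le> sz x + poly hB (sz x)"
    by (rule ptE[OF assms(1)], rule that)
  obtain p k1 where f: "\<And>x r b c. runs p (stk (flat (enc x) @ r) b c) (poly k1 (sz x)) (stk (flat (enc (f x)) @ r) b c)"
    by (rule ptE[OF assms(2)], rule that)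
  obtain q k2 where g: "\<And>x r b c. runs q (stk (flat (enc x) @ r) b c) (poly k2 (sz x)) (stk (flat (enc (g x)) @ r) b c)"
    by (rule ptE[OF assms(3)], rule that)
  let ?q = "Seq (transfer 0 []) q" and ?p = "Seq (transfer 0 []) p"
  show ?thesis
  proof (rule ptI)
    show "poly_bounded (\<lambda>n. (24 * n + 6) + (poly hB n + Suc ((12 * (n + poly hB n) + 3) + (poly k1 n + poly k2 n))))"
      by (intro poly_bounded_Suc poly_bounded_add poly_bounded_mult poly_bounded_poly poly_bounded_id poly_bounded_const)
    fix x :: 'a and r b c
    let ?n = "sz x"
    let ?T = "(12 * (?n + poly hB ?n) + 3) + (poly k1 ?n + poly k2 ?n)"
    have 1: "runs (Cond 0 {Some True} ?q ?p) (stk (flat (enc (B x)) @ flat (enc x) @ r) b c) (Suc ?T) (stk (flat (enc (h x)) @ r) b c)"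
    proof (rule runs_Cond)
      assume "top_of (stk (flat (enc (B x)) @ flat (enc x) @ r) b c 0) \<in> {Some True}"
      then have h: "h x = g x" using assms(5)[of x] by (cases "enc (B x)") auto
      have "runs ?q (stk (flat (enc (B x)) @ flat (enc x) @ r) b c) ((12 * sz (B x) + 3) + poly k2 ?n) (stk (flat (enc (g x)) @ r) b c)"
        by (rule runs_Seq runs_move g)+
      then show "runs ?q (stk (flat (enc (B x)) @ flat (enc x) @ r) b c) ?T (stk (flat (enc (h x)) @ r) b c)"
        unfolding h by (rule runs_mono) (use Bs[of x] in simp)
    next
      assume "top_of (stk (flat (enc (B x)) @ flat (enc x) @ r) b c 0) \<notin> {Some True}"
      then have h: "h x = f x" using assms(4)[of x] by (cases "enc (B x)") auto
      have "runs ?p (stk (flat (enc (B x)) @ flat (enc x) @ r) b c) ((12 * sz (B x) + 3) + poly k1 ?n) (stk (flat (enc (f x)) @ r) b c)"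
        by (rule runs_Seq runs_move f)+
      then show "runs ?p (stk (flat (enc (B x)) @ flat (enc x) @ r) b c) ?T (stk (flat (enc (h x)) @ r) b c)"
        unfolding h by (rule runs_mono) (use Bs[of x] in simp)
    qed
    show "runs (Seq dup (Seq pB (Cond 0 {Some True} ?q ?p))) (stk (flat (enc x) @ r) b c)
       ((24 * ?n + 6) + (poly hB ?n + Suc ?T)) (stk (flat (enc (h x)) @ r) b c)"
      by (rule runs_Seq runs_dup B 1)+
  qed
qed

text \<open>
  A turn finds the list \<open>a # l\<close> above the state \<open>s\<close>.  It sets \<open>l\<close> aside on stack 2, brings \<open>a\<close> back by way of
  stack 1, and pushes the bit that turns the codes of \<open>a\<close> and \<open>s\<close> into the code of the pair \<open>(a, s)\<close>.
\<close>

definition loop_prog :: "prog \<Rightarrow> prog" where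
  "loop_prog p = While 0 {Some True}
    (Seq (Pop 0) (Seq (transfer 0 [1]) (Seq (transfer 0 [2]) (Seq (transfer 1 [0]) (Seq (Push 0 True) (Seq p (transfer 2 [0])))))))"

lemma runs_loop:
  assumes p: "\<And>a s r b c. runs p (stk (flat (enc (a, s)) @ r) b c) (poly h (sz (a, s))) (stk (flat (enc (f a s)) @ r) b c)"
    and "\<And>pre suf. l = pre @ suf \<Longrightarrow> sz (fold f pre s) \<le> n"
  shows "runs (loop_prog p) (stk (flat (enc l) @ flat (enc s) @ r) b c) ((40 * sz l + 20 + poly h (sz l + n + 1)) * sz l)
     (stk (False # flat (enc (fold f l s)) @ r) b c)"
  using assms(2)
proof (induction l arbitrary: s)
  case Nil
  have "runs (loop_prog p) (stk (False # flat (enc s) @ r) b c) 1 (stk (False # flat (enc s) @ r) b c)"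
    unfolding loop_prog_def by (rule runs_While_stop) simp
  then show ?case by (auto elim: runs_mono)
next
  case (Cons a l)
  let ?s' = "f a s"
  let ?N = "sz (a # l)"
  let ?M = "40 * ?N + 20 + poly h (?N + n + 1)"
  have s: "sz s \<le> n" using Cons.prems[of "[]" "a # l"] by simp
  have pp: "runs p (stk (True # flat (enc a) @ flat (enc s) @ r) b (flat (enc l) @ c)) (poly h (sz (a, s))) (stk (flat (enc ?s') @ r) b (flat (enc l) @ c))"
    using p[of a s r b "flat (enc l) @ c"] by simp
  have 1: "runs (Seq (Pop 0) (Seq (transfer 0 [1]) (Seq (transfer 0 [2]) (Seq (transfer 1 [0]) (Seq (Push 0 True) (Seq p (transfer 2 [0])))))))
    (stk (True # flat (enc a) @ flat (enc l) @ flat (enc s) @ r) b c)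
    (1 + ((12 * sz a + 3) + ((12 * sz l + 3) + ((12 * sz a + 3) + (1 + (poly h (sz (a, s)) + (12 * sz l + 3)))))))
    (stk (flat (enc l) @ flat (enc ?s') @ r) b c)"
    by (rule runs_Seq runs_move runs_pop_stk runs_push_stk pp)+
  have 2: "runs (loop_prog p) (stk (flat (enc l) @ flat (enc ?s') @ r) b c) ((40 * sz l + 20 + poly h (sz l + n + 1)) * sz l)
     (stk (False # flat (enc (fold f l ?s')) @ r) b c)"
    by (rule Cons.IH) (use Cons.prems[of "a # _"] in simp)
  have "runs (loop_prog p) (stk (True # flat (enc a) @ flat (enc l) @ flat (enc s) @ r) b c)
    (Suc ((1 + ((12 * sz a + 3) + ((12 * sz l + 3) + ((12 * sz a + 3) + (1 + (poly h (sz (a, s)) + (12 * sz l + 3)))))))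
      + ((40 * sz l + 20 + poly h (sz l + n + 1)) * sz l)))
    (stk (False # flat (enc (fold f l ?s')) @ r) b c)"
    unfolding loop_prog_def by (rule runs_While_step[OF _ 1 2[unfolded loop_prog_def]]) simp
  moreover have "Suc ((1 + ((12 * sz a + 3) + ((12 * sz l + 3) + ((12 * sz a + 3) + (1 + (poly h (sz (a, s)) + (12 * sz l + 3)))))))
      + ((40 * sz l + 20 + poly h (sz l + n + 1)) * sz l)) \<le> ?M * ?N"
  proof -
    have "poly h (sz (a, s)) \<le> poly h (?N + n + 1)" using s by (intro poly_nat_mono) simp
    then have 1: "Suc (1 + ((12 * sz a + 3) + ((12 * sz l + 3) + ((12 * sz a + 3) + (1 + (poly h (sz (a, s)) + (12 * sz l + 3)))))))
      \<le> ?M" by simp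
    have "poly h (sz l + n + 1) \<le> poly h (?N + n + 1)" by (intro poly_nat_mono) simp
    then have "40 * sz l + 20 + poly h (sz l + n + 1) \<le> ?M" by simp
    then have 2: "(40 * sz l + 20 + poly h (sz l + n + 1)) * sz l \<le> ?M * sz l"
      by (intro mult_right_mono) auto
    have "?M + ?M * sz l = ?M * Suc (sz l)" by simp
    also have "\<dots> \<le> ?M * ?N" by (intro mult_left_mono) auto
    finally show ?thesis using 1 2 by linarith
  qed
  ultimately show ?case by (auto elim: runs_mono)
qed

text \<open>
  Iterating a polynomial-time step can produce exponentially large states; a polynomial bound on all
  intermediate states makes the number of turns times the cost of a turn polynomial.
\<close>

lemma pt_fold_closed:
  assumes "pt (\<lambda>p. f (fst p) (snd p))" "pt l" "pt i" and b: "poly_bounded B"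
    and bd: "\<And>x pre suf. l x = pre @ suf \<Longrightarrow> sz (fold f pre (i x)) \<le> B (sz x)"
  shows "pt (\<lambda>x. fold f (l x) (i x))"
proof -
  obtain p h where "\<And>x r b c. runs p (stk (flat (enc x) @ r) b c) (poly h (sz x)) (stk (flat (enc (f (fst x) (snd x))) @ r) b c)"
    by (rule ptE[OF assms(1)], rule that)
  from this[of "(_, _)"]
  have f: "\<And>a s r b c. runs p (stk (flat (enc (a, s)) @ r) b c) (poly h (sz (a, s))) (stk (flat (enc (f a s)) @ r) b c)"
    by simp
  obtain q k where g: "\<And>x r b c. runs q (stk (flat (enc x) @ r) b c) (poly k (sz x)) (stk (flat (enc (l x)) @ r) b c)"
    and gs: "\<And>x. sz (l x) \<le> sz x + poly k (sz x)"
    by (rule ptE[OF assms(2)], rule that)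
  obtain q' k' where i: "\<And>x r b c. runs q' (stk (flat (enc x) @ r) b c) (poly k' (sz x)) (stk (flat (enc (i x)) @ r) b c)"
    and isz: "\<And>x. sz (i x) \<le> sz x + poly k' (sz x)"
    by (rule ptE[OF assms(3)], rule that)
  let ?p = "Seq dup (Seq q' (Seq swap (Seq q (Seq (loop_prog p) (Pop 0)))))"
  let ?L = "\<lambda>n m. (40 * n + 20 + poly h (n + m + 1)) * n"
  show ?thesis
  proof (rule ptI)
    show "poly_bounded (\<lambda>n. (24 * n + 6) + (poly k' n + ((24 * (n + poly k' n) + 24 * n + 12) + (poly k n + (?L (n + poly k n) (B n) + 1)))))"
      by (intro poly_bounded_add poly_bounded_mult poly_bounded_poly poly_bounded_poly_comp poly_bounded_id poly_bounded_const b)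
    fix x r b c
    have "runs ?p (stk (flat (enc x) @ r) b c) ((24 * sz x + 6) + (poly k' (sz x) + ((24 * sz (i x) + 24 * sz x + 12)
        + (poly k (sz x) + (?L (sz (l x)) (B (sz x)) + 1))))) (stk (flat (enc (fold f (l x) (i x))) @ r) b c)"
      by (rule runs_Seq g i runs_dup runs_swap runs_pop_stk runs_loop[OF f bd] | assumption)+
    moreover have L: "?L (sz (l x)) (B (sz x)) \<le> ?L (sz x + poly k (sz x)) (B (sz x))"
      using gs[of x] by (intro mult_mono add_mono poly_nat_mono order_refl le0)
    have "(24 * sz x + 6) + (poly k' (sz x) + ((24 * sz (i x) + 24 * sz x + 12)
        + (poly k (sz x) + (?L (sz (l x)) (B (sz x)) + 1)))) \<le>
       (24 * sz x + 6) + (poly k' (sz x) + ((24 * (sz x + poly k' (sz x)) + 24 * sz x + 12)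
        + (poly k (sz x) + (?L (sz x + poly k (sz x)) (B (sz x)) + 1))))"
      by (intro add_mono mult_left_mono isz order_refl le0 L)
    ultimately show "runs ?p (stk (flat (enc x) @ r) b c) ((24 * sz x + 6) + (poly k' (sz x) + ((24 * (sz x + poly k' (sz x)) + 24 * sz x + 12)
        + (poly k (sz x) + (?L (sz x + poly k (sz x)) (B (sz x)) + 1))))) (stk (flat (enc (fold f (l x) (i x))) @ r) b c)"
      by (rule runs_mono)
  qed
qed

section \<open>Reading bit strings and calling deciders\<close>

text \<open>
  Stack 3 holds a string with its last bit on top, so consing its bits one after the other onto the
  code of a list builds the code of the string from the back.
\<close>

definition cons_bits :: prog where
  "cons_bits = While 3 {Some True, Some False} (Cond 3 {Some True}
     (Seq (Pop 3) (Seq (Push 0 False) (Seq (Push 0 False) (Seq (Push 0 True) (Push 0 True)))))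
     (Seq (Pop 3) (Seq (Push 0 False) (Push 0 True))))"

lemma runs_cons_bits:
  "s 0 = flat (enc w) \<Longrightarrow> runs cons_bits s (10 * length (s 3) + 1) (s(0 := flat (enc (rev (s 3) @ w)), 3 := []))"
proof (induction "s 3" arbitrary: s w)
  case Nil
  then have eq: "s(0 := flat (enc (rev (s 3) @ w)), 3 := []) = s" by (auto simp: fun_eq_iff)
  have "runs cons_bits s 1 s"
    unfolding cons_bits_def by (rule runs_While_stop) (simp add: Nil(1)[symmetric])
  then show ?case unfolding eq by (rule runs_mono) simp
next
  case (Cons b z)
  let ?p = "Seq (Pop 3) (Seq (Push 0 False) (Seq (Push 0 False) (Seq (Push 0 True) (Push 0 True))))"
  let ?q = "Seq (Pop 3) (Seq (Push 0 False) (Push 0 True))"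
  let ?s1 = "s(3 := z, 0 := flat (enc (b # w)))"
  have "runs ?p s (1 + (1 + (1 + (1 + 1))))
     (let s = s(3 := tl (s 3)); s = s(0 := False # s 0); s = s(0 := False # s 0); s = s(0 := True # s 0) in s(0 := True # s 0))"
    unfolding Let_def by (rule runs_Seq runs_Push runs_Pop)+
  then have p: "b \<Longrightarrow> runs ?p s (1 + (1 + (1 + (1 + 1)))) ?s1"
    by (elim back_subst[where P = "\<lambda>s'. runs _ s _ s'"]) (use Cons in \<open>auto simp: fun_eq_iff enc_bool_def Let_def simp flip: Cons(2)\<close>)
  have "runs ?q s (1 + (1 + 1))
     (let s = s(3 := tl (s 3)); s = s(0 := False # s 0) in s(0 := True # s 0))"
    unfolding Let_def by (rule runs_Seq runs_Push runs_Pop)+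
  then have q: "\<not> b \<Longrightarrow> runs ?q s (1 + (1 + 1)) ?s1"
    by (elim back_subst[where P = "\<lambda>s'. runs _ s _ s'"]) (use Cons in \<open>auto simp: fun_eq_iff enc_bool_def Let_def simp flip: Cons(2)\<close>)
  have "runs (Cond 3 {Some True} ?p ?q) s (Suc 5) ?s1"
  proof (rule runs_Cond)
    assume "top_of (s 3) \<in> {Some True}"
    then have b using Cons(2)[symmetric] by simp
    then show "runs ?p s 5 ?s1" by (rule runs_mono[OF p]) simp
  next
    assume "top_of (s 3) \<notin> {Some True}"
    then have "\<not> b" using Cons(2)[symmetric] by simp
    then show "runs ?q s 5 ?s1" by (rule runs_mono[OF q]) simp
  qed
  moreover have "runs cons_bits ?s1 (10 * length (?s1 3) + 1) (?s1(0 := flat (enc (rev (?s1 3) @ b # w)), 3 := []))"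
    by (rule Cons(1)) auto
  ultimately have "runs cons_bits s (Suc (Suc 5 + (10 * length (?s1 3) + 1))) (?s1(0 := flat (enc (rev (?s1 3) @ b # w)), 3 := []))"
    unfolding cons_bits_def by (intro runs_While_step) (use Cons(2)[symmetric] in auto)
  then have "runs cons_bits s (10 * length (s 3) + 1) (?s1(0 := flat (enc (rev (?s1 3) @ b # w)), 3 := []))"
    by (rule runs_mono) (use Cons(2)[symmetric] in auto)
  then show ?case
    by (rule back_subst[where P = "\<lambda>s'. runs _ s _ s'"]) (use Cons(2)[symmetric] in \<open>auto simp: fun_eq_iff\<close>)
qed

lemma sz_bits: "sz (w :: bool list) \<le> 4 * length w + 1"
  by (induction w) (auto simp: enc_bool_def)

text \<open>
  A string can be taken apart only by emptying its stack, since raw bits carry no end mark; the program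
  first rewrites it as the code of a list.
\<close>

lemma PTIME_if_pt:
  assumes "pt (\<lambda>w. w \<in> L)"
  shows "L \<in> PTIME"
proof -
  obtain p h where p: "\<And>w r b c. runs p (stk (flat (enc w) @ r) b c) (poly h (sz w)) (stk (flat (enc (w \<in> L)) @ r) b c)"
    by (rule ptE[OF assms], rule that)
  have "poly_bounded (\<lambda>n. (5 * n + 1) + (1 + ((10 * n + 1) + poly h (4 * n + 1))))"
    by (intro poly_bounded_add poly_bounded_mult poly_bounded_poly_comp poly_bounded_id poly_bounded_const)
  then obtain g where g: "\<And>n. (5 * n + 1) + (1 + ((10 * n + 1) + poly h (4 * n + 1))) \<le> poly g n"
    unfolding poly_bounded_def by blast
  let ?p = "Seq (drain 0 [3]) (Seq (Push 0 False) (Seq cons_bits p))"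
  have "\<exists>t s. exec ?p (input_store w) t s \<and> t \<le> poly g (length w) \<and> (accepting s \<longleftrightarrow> w \<in> L)" for w
  proof -
    let ?s1 = "((\<lambda>_. []) :: store)(3 := rev w)"
    let ?s2 = "?s1(0 := False # ?s1 0)"
    have "runs (drain 0 [3]) (input_store w) ((length [3::nat] + 4) * length (input_store w 0) + 1) ?s1"
      by (rule back_subst[where P = "\<lambda>s'. runs _ _ _ s'", OF runs_drain]) (auto simp: input_store_def fun_eq_iff)
    then have 1: "runs (drain 0 [3]) (input_store w) (5 * length w + 1) ?s1"
      by (simp add: input_store_def)
    have "runs cons_bits ?s2 (10 * length (?s2 3) + 1) (?s2(0 := flat (enc (rev (?s2 3) @ [])), 3 := []))"
      by (rule runs_cons_bits) auto
    moreover have "(?s2(0 := flat (enc (rev (?s2 3) @ [])), 3 := [])) = stk (flat (enc w) @ []) [] []"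
      by (auto simp: fun_eq_iff stk_def)
    ultimately have 2: "runs cons_bits ?s2 (10 * length w + 1) (stk (flat (enc w) @ []) [] [])" by simp
    have "runs ?p (input_store w) ((5 * length w + 1) + (1 + ((10 * length w + 1) + poly h (sz w)))) (stk (flat (enc (w \<in> L)) @ []) [] [])"
      by (rule runs_Seq 1 runs_Push 2 p)+
    moreover have "poly h (sz w) \<le> poly h (4 * length w + 1)"
      by (intro poly_nat_mono sz_bits)
    then have "(5 * length w + 1) + (1 + ((10 * length w + 1) + poly h (sz w))) \<le> poly g (length w)"
      using g[of "length w"] by linarith
    moreover have "accepting (stk (flat (enc (w \<in> L)) @ []) [] []) \<longleftrightarrow> w \<in> L"
      by (auto simp: accepting_def enc_bool_def)
    ultimately show ?thesis unfolding runs_def by (meson le_trans)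
  qed
  then show ?thesis unfolding PTIME_def by blast
qed

text \<open>
  The inverse of \<open>cons_bits\<close>: after the bit of a list cell, \<^const>\<open>True\<close> is coded by three bits and \<^const>\<open>False\<close>
  by one.
\<close>

definition uncons_bits :: prog where
  "uncons_bits = While 0 {Some True} (Seq (Pop 0) (Cond 0 {Some True}
     (Seq (Pop 0) (Seq (Pop 0) (Seq (Pop 0) (Push 3 True))))
     (Seq (Pop 0) (Push 3 False))))"

lemma runs_uncons_bits:
  "s 0 = flat (enc w) @ r \<Longrightarrow> runs uncons_bits s (10 * length w + 1) (s(0 := False # r, 3 := rev w @ s 3))"
proof (induction w arbitrary: s)
  case Nil
  then have eq: "s(0 := False # r, 3 := rev [] @ s 3) = s" by (auto simp: fun_eq_iff)
  have "runs uncons_bits s 1 s"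
    unfolding uncons_bits_def by (rule runs_While_stop) (simp add: Nil)
  then show ?case unfolding eq by (rule runs_mono) simp
next
  case (Cons b w)
  let ?p = "Seq (Pop 0) (Seq (Pop 0) (Seq (Pop 0) (Push 3 True)))"
  let ?q = "Seq (Pop 0) (Push 3 False)"
  let ?s0 = "s(0 := tl (s 0))"
  let ?s1 = "s(0 := flat (enc w) @ r, 3 := b # s 3)"
  have "runs ?p ?s0 (1 + (1 + (1 + 1)))
     (let s = ?s0; s = s(0 := tl (s 0)); s = s(0 := tl (s 0)); s = s(0 := tl (s 0)) in s(3 := True # s 3))"
    unfolding Let_def by (rule runs_Seq runs_Push runs_Pop)+
  then have p: "b \<Longrightarrow> runs ?p ?s0 (1 + (1 + (1 + 1))) ?s1"
    by (elim back_subst[where P = "\<lambda>s'. runs _ _ _ s'"]) (use Cons in \<open>auto simp: fun_eq_iff enc_bool_def Let_def\<close>)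
  have "runs ?q ?s0 (1 + 1) (let s = ?s0; s = s(0 := tl (s 0)) in s(3 := False # s 3))"
    unfolding Let_def by (rule runs_Seq runs_Push runs_Pop)+
  then have q: "\<not> b \<Longrightarrow> runs ?q ?s0 (1 + 1) ?s1"
    by (elim back_subst[where P = "\<lambda>s'. runs _ _ _ s'"]) (use Cons in \<open>auto simp: fun_eq_iff enc_bool_def Let_def\<close>)
  have "runs (Cond 0 {Some True} ?p ?q) ?s0 (Suc 4) ?s1"
  proof (rule runs_Cond)
    assume "top_of (?s0 0) \<in> {Some True}"
    then have b using Cons(2) by (auto simp: enc_bool_def split: if_splits)
    then show "runs ?p ?s0 4 ?s1" by (rule runs_mono[OF p]) simp
  next
    assume "top_of (?s0 0) \<notin> {Some True}"
    then have "\<not> b" using Cons(2) by (auto simp: enc_bool_def split: if_splits)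
    then show "runs ?q ?s0 4 ?s1" by (rule runs_mono[OF q]) simp
  qed
  note A = runs_Seq[OF runs_Pop this]
  have B: "runs uncons_bits ?s1 (10 * length w + 1) (?s1(0 := False # r, 3 := rev w @ ?s1 3))"
    by (rule Cons(1)) simp
  have "runs uncons_bits s (Suc ((1 + Suc 4) + (10 * length w + 1))) (?s1(0 := False # r, 3 := rev w @ ?s1 3))"
    unfolding uncons_bits_def by (rule runs_While_step[OF _ A B[unfolded uncons_bits_def]]) (simp add: Cons(2))
  then have "runs uncons_bits s (10 * length (b # w) + 1) (?s1(0 := False # r, 3 := rev w @ ?s1 3))"
    by (rule runs_mono) auto
  then show ?case
    by (rule back_subst[where P = "\<lambda>s'. runs _ s _ s'"]) (auto simp: fun_eq_iff)
qed

fun shift :: "nat \<Rightarrow> prog \<Rightarrow> prog" where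
  "shift n Skip = Skip"
| "shift n (Push k b) = Push (n + k) b"
| "shift n (Pop k) = Pop (n + k)"
| "shift n (Seq p q) = Seq (shift n p) (shift n q)"
| "shift n (Cond k T p q) = Cond (n + k) T (shift n p) (shift n q)"
| "shift n (While k T p) = While (n + k) T (shift n p)"

definition join :: "nat \<Rightarrow> store \<Rightarrow> store \<Rightarrow> store" where
  "join n z s = (\<lambda>k. if k < n then z k else s (k - n))"

lemma join_add [simp]: "join n z s (n + k) = s k"
  by (simp add: join_def)

lemma join_upd: "(join n z s)(n + k := v) = join n z (s(k := v))"
  by (auto simp: join_def fun_eq_iff)

lemma exec_shift: "exec p s t s' \<Longrightarrow> exec (shift n p) (join n z s) t (join n z s')"
proof (induction rule: exec.induct)
  case (Push k b s)
  then show ?case using exec.Push[of "n + k" b "join n z s"] by (simp only: join_add join_upd shift.simps)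
next
  case (Pop k s)
  then show ?case using exec.Pop[of "n + k" "join n z s"] by (simp only: join_add join_upd shift.simps)
qed (simp_all only: shift.simps, (rule exec.intros; simp)+)

text \<open>
  Stacks with this number or a larger one are not touched by the program.
\<close>

fun regs :: "prog \<Rightarrow> nat" where
  "regs Skip = 0"
| "regs (Push k b) = Suc k"
| "regs (Pop k) = Suc k"
| "regs (Seq p q) = max (regs p) (regs q)"
| "regs (Cond k T p q) = max (regs p) (regs q)"
| "regs (While k T p) = regs p"

lemma exec_regs: "exec p s t s' \<Longrightarrow> regs p \<le> k \<Longrightarrow> s' k = s k"
  by (induction rule: exec.induct) auto

fun clear :: "nat \<Rightarrow> nat \<Rightarrow> prog" where
  "clear n 0 = Skip"
| "clear n (Suc m) = Seq (drain (n + m) []) (clear n m)"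

lemma runs_clear:
  assumes "\<And>k. n \<le> k \<Longrightarrow> k < n + m \<Longrightarrow> length (s k) \<le> l"
  shows "runs (clear n m) s ((4 * l + 1) * m + 1) (\<lambda>k. if n \<le> k \<and> k < n + m then [] else s k)"
  using assms
proof (induction m arbitrary: s)
  case 0
  have "(\<lambda>k. if n \<le> k \<and> k < n + 0 then [] else s k) = s" by (auto simp: fun_eq_iff)
  then show ?case using runs_Skip[of s] by (simp only: clear.simps) simp
next
  case (Suc m)
  let ?s1 = "\<lambda>k. if k = n + m then [] else if k \<in> set [] then rev (s (n + m)) @ s k else s k"
  have "runs (drain (n + m) []) s ((length ([] :: nat list) + 4) * length (s (n + m)) + 1) ?s1"
    by (rule runs_drain) auto
  then have 1: "runs (drain (n + m) []) s (4 * l + 1) ?s1"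
    by (rule runs_mono) (use Suc.prems[of "n + m"] in auto)
  have "length (?s1 k) \<le> l" if "n \<le> k" "k < n + m" for k
    using Suc.prems[of k] that by auto
  from runs_Seq[OF 1 Suc.IH[OF this]]
  have "runs (clear n (Suc m)) s ((4 * l + 1) + ((4 * l + 1) * m + 1)) (\<lambda>k. if n \<le> k \<and> k < n + m then [] else ?s1 k)"
    by simp
  then have "runs (clear n (Suc m)) s ((4 * l + 1) * Suc m + 1) (\<lambda>k. if n \<le> k \<and> k < n + m then [] else ?s1 k)"
    by (simp add: algebra_simps)
  then show ?case
    by (rule back_subst[where P = "\<lambda>s'. runs _ s _ s'"]) (auto simp: fun_eq_iff)
qed

lemma length_le_sz: "length w \<le> sz w"
  by (induction w) auto

text \<open>
  A decider expects its input alone on stack 0 and all other stacks empty, and may leave anything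
  behind.  It is therefore run on the stacks from 5 on, which are empty under the calling convention;
  afterwards the finitely many stacks that it can have used are cleared.
\<close>

lemma pt_if_PTIME:
  assumes "L \<in> PTIME"
  shows "pt (\<lambda>w. w \<in> L)"
proof -
  obtain d g where d: "\<And>w. \<exists>t s. exec d (input_store w) t s \<and> t \<le> poly g (length w) \<and> (accepting s \<longleftrightarrow> w \<in> L)"
    using assms unfolding PTIME_def by auto
  \<comment> \<open>The successor covers stack 0 of the decider, which holds the input even if no instruction touches it.\<close>
  let ?clear = "clear 5 (Suc (regs d))"
  let ?p = "Seq uncons_bits (Seq (Pop 0) (Seq (drain 3 [5]) (Seq (shift 5 d)
     (Cond 5 {Some True} (Seq ?clear (Seq (Push 0 False) (Seq (Push 0 False) (Push 0 True)))) (Seq ?clear (Push 0 False))))))"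
  let ?C = "\<lambda>n. (4 * (n + poly g n) + 1) * Suc (regs d) + 1"
  let ?T = "\<lambda>n. (10 * n + 1) + (1 + ((5 * n + 1) + (poly g n + Suc (?C n + (1 + (1 + 1))))))"
  have "poly_bounded ?T"
    by (intro poly_bounded_add poly_bounded_Suc poly_bounded_mult poly_bounded_poly poly_bounded_id poly_bounded_const)
  then obtain h where h: "\<And>n. ?T n \<le> poly h n"
    unfolding poly_bounded_def by blast
  have "runs ?p (stk (flat (enc w) @ r) b c) (poly h (length w)) (stk (flat (enc (w \<in> L)) @ r) b c)" for w r b c
  proof -
    obtain t s where ts: "exec d (input_store w) t s" "t \<le> poly g (length w)" "accepting s \<longleftrightarrow> w \<in> L"
      using d by blast
    let ?z = "stk r b c"
    let ?s1 = "(stk (flat (enc w) @ r) b c)(0 := False # r, 3 := rev w @ (stk (flat (enc w) @ r) b c) 3)"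
    let ?s2 = "?s1(0 := tl (?s1 0))"
    let ?s3 = "join 5 ?z (input_store w)"
    let ?s4 = "join 5 ?z s"
    let ?l = "length w + poly g (length w)"
    have 1: "runs uncons_bits (stk (flat (enc w) @ r) b c) (10 * length w + 1) ?s1"
      by (rule runs_uncons_bits) simp
    have "runs (drain 3 [5]) ?s2 ((length [5::nat] + 4) * length (?s2 3) + 1) ?s3"
      by (rule back_subst[where P = "\<lambda>s'. runs _ _ _ s'", OF runs_drain])
        (auto simp: input_store_def fun_eq_iff stk_def join_def)
    then have 2: "runs (drain 3 [5]) ?s2 (5 * length w + 1) ?s3" by simp
    have 3: "runs (shift 5 d) ?s3 (poly g (length w)) ?s4"
      using runs_mono[OF runs_exec[OF exec_shift[OF ts(1)]] ts(2)] .
    have len: "length (s k) \<le> ?l" for k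
      using exec_length[OF ts(1), of k] ts(2) by (auto simp: input_store_def split: if_splits)
    have emp: "s k = []" if "k \<ge> Suc (regs d)" for k
      using exec_regs[OF ts(1), of k] that by (simp add: input_store_def)
    have eq: "(\<lambda>k. if 5 \<le> k \<and> k < 5 + Suc (regs d) then [] else ?s4 k) = join 5 ?z (\<lambda>_. [])"
      using emp by (auto simp: fun_eq_iff join_def)
    have eq2: "(join 5 ?z (\<lambda>_. []))(k := v) = join 5 (?z(k := v)) (\<lambda>_. [])" if "k < 5" for k v
      using that by (auto simp: fun_eq_iff join_def)
    have eq3: "join 5 (stk a b c) (\<lambda>_. []) = stk a b c" for a b c
      by (auto simp: fun_eq_iff join_def stk_def)
    have "runs ?clear ?s4 (?C (length w)) (\<lambda>k. if 5 \<le> k \<and> k < 5 + Suc (regs d) then [] else ?s4 k)"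
      by (rule runs_clear) (use len in \<open>auto simp: join_def\<close>)
    then have 4: "runs ?clear ?s4 (?C (length w)) (stk r b c)"
      unfolding eq eq3 .
    let ?yes = "Seq ?clear (Seq (Push 0 False) (Seq (Push 0 False) (Push 0 True)))"
    let ?no = "Seq ?clear (Push 0 False)"
    have yes: "runs ?yes ?s4 (?C (length w) + (1 + (1 + 1))) (stk (True # False # False # r) b c)"
      by (rule runs_Seq 4 runs_push_stk)+
    have no: "runs ?no ?s4 (?C (length w) + 1) (stk (False # r) b c)"
      by (rule runs_Seq 4 runs_push_stk)+
    have top: "top_of (?s4 5) \<in> {Some True} \<longleftrightarrow> w \<in> L"
      using ts(3) by (simp add: accepting_def join_def)
    have 5: "runs (Cond 5 {Some True} ?yes ?no) ?s4 (Suc (?C (length w) + (1 + (1 + 1)))) (stk (flat (enc (w \<in> L)) @ r) b c)"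
    proof (rule runs_Cond)
      assume "top_of (?s4 5) \<in> {Some True}"
      with yes top show "runs ?yes ?s4 (?C (length w) + (1 + (1 + 1))) (stk (flat (enc (w \<in> L)) @ r) b c)"
        by (simp add: enc_bool_def)
    next
      assume "top_of (?s4 5) \<notin> {Some True}"
      with no top have "runs ?no ?s4 (?C (length w) + 1) (stk (flat (enc (w \<in> L)) @ r) b c)"
        by (simp add: enc_bool_def)
      then show "runs ?no ?s4 (?C (length w) + (1 + (1 + 1))) (stk (flat (enc (w \<in> L)) @ r) b c)"
        by (rule runs_mono) simp
    qed
    have "runs ?p (stk (flat (enc w) @ r) b c) (?T (length w)) (stk (flat (enc (w \<in> L)) @ r) b c)"
      by (rule runs_Seq 1 runs_Pop 2 3 5)+
    then show ?thesis by (rule runs_mono) (rule h)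
  qed
  moreover have "poly h (length w) \<le> poly h (sz w)" for w
    by (intro poly_nat_mono length_le_sz)
  ultimately show ?thesis by (intro ptI[OF poly_bounded_poly]) (blast intro: runs_mono)
qed

section \<open>A library of polynomial-time functions\<close>

lemma pt_if [pt_intros]:
  assumes "pt b" "pt f" "pt g" shows "pt (\<lambda>x. if b x then f x else g x)"
  by (rule pt_cond[OF assms(1,3,2)]) (auto simp: enc_bool_def split: if_splits)

lemma pt_conj [pt_intros]: "pt f \<Longrightarrow> pt g \<Longrightarrow> pt (\<lambda>x. f x \<and> g x)"
  by (rule pt_cond[of f "\<lambda>_. False" g]) (auto simp: enc_bool_def intro: pt_intros split: if_splits)

lemma pt_not [pt_intros]: "pt f \<Longrightarrow> pt (\<lambda>x. \<not> f x)"
  by (rule pt_cond[of f "\<lambda>_. True" "\<lambda>_. False"]) (auto simp: enc_bool_def intro: pt_intros split: if_splits)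

lemma pt_disj [pt_intros]: "pt f \<Longrightarrow> pt g \<Longrightarrow> pt (\<lambda>x. f x \<or> g x)"
  by (rule pt_cond[of f g "\<lambda>_. True"]) (auto simp: enc_bool_def intro: pt_intros split: if_splits)

lemma pt_Suc [pt_intros]:
  assumes "pt f" shows "pt (\<lambda>x. Suc (f x))"
proof -
  have "pt (\<lambda>p :: unit \<times> nat. Suc (snd p))" by (rule pt_cast) (simp add: enc_prod_def enc_unit_def)
  from pt_compose[OF this pt_Pair[OF pt_const assms]] show ?thesis by simp
qed

lemma pt_Cons [pt_intros]:
  assumes "pt f" "pt g" shows "pt (\<lambda>x. f x # g x)"
proof -
  have "pt (\<lambda>p :: 'b \<times> 'b list. fst p # snd p)" by (rule pt_cast) (simp add: enc_prod_def)
  from pt_compose[OF this pt_Pair[OF assms]] show ?thesis by simp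
qed

lemma pt_pred: "pt (\<lambda>n :: nat. n - 1)"
proof (rule pt_right)
  show "enc (n - 1) = right (enc n)" for n :: nat by (cases n) auto
qed

lemma pt_case_nat [pt_intros]:
  assumes "pt n" "pt f" "pt (\<lambda>p. g (fst p) (snd p))"
  shows "pt (\<lambda>x. case n x of 0 \<Rightarrow> f x | Suc m \<Rightarrow> g x m)"
proof (rule pt_cond[OF assms(1,2)])
  from pt_compose[OF assms(3) pt_Pair[OF pt_id pt_compose[OF pt_pred assms(1)]]]
  show "pt (\<lambda>x. g x (n x - 1))" by simp
qed (auto split: nat.split)

text \<open>A nonempty list has the same encoding as the pair of its head and its tail.\<close>

lemma pt_uncons: "pt (\<lambda>l. case l of [] \<Rightarrow> d | y # ys \<Rightarrow> (y, ys))"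
proof -
  obtain p where p: "\<And>r b c. runs p (stk r b c) (sz d) (stk (flat (enc d) @ r) b c)"
    using runs_push_tree by blast
  show ?thesis
  proof (rule ptI[of "\<lambda>n. Suc (1 + sz d)" "Cond 0 {Some True} Skip (Seq (Pop 0) p)"])
    fix l :: "'a list" and r b c
    show "runs (Cond 0 {Some True} Skip (Seq (Pop 0) p)) (stk (flat (enc l) @ r) b c) (Suc (1 + sz d))
       (stk (flat (enc (case l of [] \<Rightarrow> d | y # ys \<Rightarrow> (y, ys))) @ r) b c)"
    proof (cases l)
      case Nil
      have "runs (Seq (Pop 0) p) (stk (False # r) b c) (1 + sz d) (stk (flat (enc d) @ r) b c)"
        by (rule runs_Seq runs_pop_stk p)+
      with Nil show ?thesis by (intro runs_Cond) auto
    next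
      case (Cons y ys)
      then show ?thesis by (intro runs_Cond) (auto intro: runs_mono[OF runs_Skip])
    qed
  qed blast
qed

lemma pt_case_list [pt_intros]:
  assumes "pt l" "pt f" "pt (\<lambda>p. g (fst p) (fst (snd p)) (snd (snd p)))"
  shows "pt (\<lambda>x. case l x of [] \<Rightarrow> f x | y # ys \<Rightarrow> g x y ys)"
proof (rule pt_cond[OF assms(1,2)])
  let ?u = "\<lambda>x. case l x of [] \<Rightarrow> (undefined, []) | y # ys \<Rightarrow> (y, ys)"
  from pt_compose[OF assms(3) pt_Pair[OF pt_id pt_compose[OF pt_uncons assms(1)]]]
  show "pt (\<lambda>x. g x (fst (?u x)) (snd (?u x)))" by simp
qed (auto split: list.split)

text \<open>
  The loop of a program works on one state, so a parameter of the step function travels inside it.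
\<close>

lemma pt_fold_bounded:
  assumes step: "pt (\<lambda>p. f (fst p) (fst (snd p)) (snd (snd p)))" and l: "pt l" and i: "pt i"
    and b: "poly_bounded B"
    and bd: "\<And>x pre suf. l x = pre @ suf \<Longrightarrow> sz (fold (f x) pre (i x)) \<le> B (sz x)"
  shows "pt (\<lambda>x. fold (f x) (l x) (i x))"
proof -
  let ?f = "\<lambda>a s. (fst s, f (fst s) a (snd s))"
  have fold: "fold ?f xs (x, s) = (x, fold (f x) xs s)" for xs x s
    by (induction xs arbitrary: s) auto
  have "pt (\<lambda>x. fold ?f (l x) (x, i x))"
  proof (rule pt_fold_closed)
    have "pt (\<lambda>p. f (fst (snd p)) (fst p) (snd (snd p)))"
      by (rule pt_compose[OF step, of "\<lambda>p. (fst (snd p), (fst p, snd (snd p)))", simplified]) (intro pt_intros)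
    then show "pt (\<lambda>p. ?f (fst p) (snd p))" by (intro pt_intros)
    show "poly_bounded (\<lambda>n. Suc (n + B n))" by (intro poly_bounded_Suc poly_bounded_add poly_bounded_id b)
    show "sz (fold ?f pre (x, i x)) \<le> Suc (sz x + B (sz x))" if "l x = pre @ suf" for x pre suf
      using bd[OF that] by (simp add: fold)
  qed (intro pt_intros l i)+
  then have "pt (\<lambda>x. snd (fold ?f (l x) (x, i x)))" by (rule pt_snd)
  then show ?thesis by (simp add: fold)
qed

lemma sz_mem: "a \<in> set l \<Longrightarrow> sz a \<le> sz l"
  by (induction l) auto

text \<open>
  If a turn enlarges the state only by an amount that depends on the parameter and the element, but
  not on the state, then the growth over a whole loop is polynomial.
\<close>

lemma pt_fold:
  assumes step: "pt (\<lambda>p. f (fst p) (fst (snd p)) (snd (snd p)))" and l: "pt l" and i: "pt i"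
    and q: "poly_bounded q" and grow: "\<And>x a s. sz (f x a s) \<le> sz s + q (sz x + sz a)"
  shows "pt (\<lambda>x. fold (f x) (l x) (i x))"
proof -
  obtain q' where q': "\<And>n. q n \<le> poly q' n" using q by (auto simp: poly_bounded_def)
  obtain L where L: "poly_bounded L" "\<And>x. sz (l x) \<le> L (sz x)" by (rule pt_sz[OF l]) blast
  obtain I where I: "poly_bounded I" "\<And>x. sz (i x) \<le> I (sz x)" by (rule pt_sz[OF i]) blast
  show ?thesis
  proof (rule pt_fold_bounded[OF step l i])
    show "poly_bounded (\<lambda>n. I n + L n * poly q' (n + L n))"
      by (intro poly_bounded_add poly_bounded_mult poly_bounded_poly_comp poly_bounded_id L I)
    fix x pre suf assume lx: "l x = pre @ suf"
    have *: "sz (fold (f x) xs s) \<le> sz s + length xs * poly q' (sz x + L (sz x))" if "set xs \<subseteq> set (l x)" for xs s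
      using that
    proof (induction xs arbitrary: s)
      case (Cons a xs)
      have "sz a \<le> L (sz x)" using Cons.prems sz_mem[of a "l x"] L(2)[of x] by auto
      then have "q (sz x + sz a) \<le> poly q' (sz x + L (sz x))"
        using q'[of "sz x + sz a"] poly_nat_mono[of "sz x + sz a" "sz x + L (sz x)" q'] by linarith
      with grow[of x a s] Cons.IH[of "f x a s"] Cons.prems show ?case by auto
    qed simp
    have "length pre \<le> L (sz x)"
      using length_le_sz[of "l x"] L(2)[of x] by (simp add: lx)
    then have "length pre * poly q' (sz x + L (sz x)) \<le> L (sz x) * poly q' (sz x + L (sz x))"
      by (rule mult_right_mono) simp
    moreover have "sz (fold (f x) pre (i x)) \<le> sz (i x) + length pre * poly q' (sz x + L (sz x))"
      by (rule *) (simp add: lx)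
    ultimately show "sz (fold (f x) pre (i x)) \<le> I (sz x) + L (sz x) * poly q' (sz x + L (sz x))"
      using I(2)[of x] by linarith
  qed
qed

subsection \<open>Lists\<close>

lemma pt_rev [pt_intros]:
  assumes "pt l" shows "pt (\<lambda>x. rev (l x))"
proof -
  have "pt (\<lambda>x. fold (\<lambda>a s. a # s) (l x) [])"
    by (rule pt_fold[where q = "\<lambda>n. Suc n"]) (intro pt_intros assms poly_bounded_Suc poly_bounded_id | simp)+
  then show ?thesis by (simp add: fold_Cons_rev)
qed

lemma pt_map [pt_intros]:
  assumes "pt l" "pt (\<lambda>p. f (fst p) (snd p))" shows "pt (\<lambda>x. map (f x) (l x))"
proof -
  obtain h where h: "poly_bounded h" "\<And>p. sz (f (fst p) (snd p)) \<le> h (sz p)"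
    by (rule pt_sz[OF assms(2)]) blast
  have f: "pt (\<lambda>p. f (fst p) (fst (snd p)))"
    by (rule pt_compose[OF assms(2), of "\<lambda>p. (fst p, fst (snd p))", simplified]) (intro pt_intros)
  have "pt (\<lambda>x. fold (\<lambda>a s. f x a # s) (l x) [])"
  proof (rule pt_fold[where q = "\<lambda>n. Suc (h (Suc n))"])
    show "sz (f x a # s) \<le> sz s + Suc (h (Suc (sz x + sz a)))" for x a s
      using h(2)[of "(x, a)"] by simp
  qed (intro pt_intros f assms poly_bounded_Suc poly_bounded_compose[OF h(1)] poly_bounded_id)+
  then have "pt (\<lambda>x. rev (fold (\<lambda>a s. f x a # s) (l x) []))"
    by (rule pt_rev)
  moreover have "rev (fold (\<lambda>a s. f x a # s) xs s) = rev s @ map (f x) xs" for x xs s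
    by (induction xs arbitrary: s) auto
  ultimately show ?thesis by simp
qed

lemma pt_append [pt_intros]:
  assumes "pt f" "pt g" shows "pt (\<lambda>x. f x @ g x)"
proof -
  have "pt (\<lambda>x. fold (\<lambda>a s. a # s) (rev (f x)) (g x))"
    by (rule pt_fold[where q = "\<lambda>n. Suc n"]) (intro pt_intros assms poly_bounded_Suc poly_bounded_id | simp)+
  then show ?thesis by (simp add: fold_Cons_rev)
qed

lemma pt_concat [pt_intros]:
  assumes "pt f" shows "pt (\<lambda>x. concat (f x))"
proof -
  have "pt (\<lambda>x. fold (\<lambda>a s. s @ a) (f x) [])"
  proof (rule pt_fold[where q = "\<lambda>n. n"])
    show "sz (s @ a) \<le> sz s + (sz x + sz a)" for x a s
      using sz_append[of s a] by linarith
  qed (intro pt_intros assms poly_bounded_id)+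
  moreover have "fold (\<lambda>a s. s @ a) xs s = s @ concat xs" for xs :: "'b list list" and s
    by (induction xs arbitrary: s) auto
  ultimately show ?thesis by simp
qed

lemma pt_filter [pt_intros]:
  assumes "pt l" "pt (\<lambda>p. P (fst p) (snd p))" shows "pt (\<lambda>x. filter (P x) (l x))"
proof -
  have "pt (\<lambda>x. concat (map (\<lambda>a. if P x a then [a] else []) (l x)))"
    by (intro pt_intros assms)
  moreover have "concat (map (\<lambda>a. if P x a then [a] else []) xs) = filter (P x) xs" for x xs
    by (induction xs) auto
  ultimately show ?thesis by simp
qed

lemma pt_list_all [pt_intros]:
  assumes "pt l" "pt (\<lambda>p. P (fst p) (snd p))" shows "pt (\<lambda>x. list_all (P x) (l x))"
proof -
  have "pt (\<lambda>x. case filter (\<lambda>a. \<not> P x a) (l x) of [] \<Rightarrow> True | _ # _ \<Rightarrow> False)"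
    by (intro pt_intros assms)
  moreover have "(case filter (\<lambda>a. \<not> P x a) xs of [] \<Rightarrow> True | _ # _ \<Rightarrow> False) = list_all (P x) xs" for x xs
    by (induction xs) auto
  ultimately show ?thesis by simp
qed

lemma pt_zip [pt_intros]:
  assumes "pt f" "pt g" shows "pt (\<lambda>x. zip (f x) (g x))"
proof -
  let ?step = "\<lambda>a s. case fst s of [] \<Rightarrow> s | b # bs \<Rightarrow> (bs, (a, b) # snd s)"
  have "pt (\<lambda>x. rev (snd (fold ?step (f x) (g x, []))))"
  proof (rule pt_rev, rule pt_snd, rule pt_fold[where q = "\<lambda>n. Suc (Suc n)"])
    show "sz (?step a s) \<le> sz s + Suc (Suc (sz x + sz a))" for x :: 'a and a :: 'b and s :: "'c list \<times> ('b \<times> 'c) list"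
      by (cases s; cases "fst s") auto
  qed (intro pt_intros assms poly_bounded_Suc poly_bounded_id)+
  moreover have "rev (snd (fold ?step xs (ys, zs))) = rev zs @ zip xs ys" for xs ys and zs :: "('b \<times> 'c) list"
  proof (induction xs arbitrary: ys zs)
    case (Cons a xs)
    show ?case
    proof (cases ys)
      case Nil
      with Cons[of ys zs] show ?thesis by simp
    next
      case (Cons b bs)
      with Cons.IH[of bs "(a, b) # zs"] show ?thesis by simp
    qed
  qed simp
  ultimately show ?thesis by simp
qed

subsection \<open>Numbers in unary\<close>

lemma enc_replicate: "enc (replicate n ()) = enc n"
  by (induction n) auto

lemma pt_replicate [pt_intros]:
  assumes "pt f" "pt g" shows "pt (\<lambda>x. replicate (f x) (g x))"
proof -
  have "pt (\<lambda>x. replicate (f x) ())"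
    by (rule pt_compose[OF pt_cast assms(1)]) (rule enc_replicate)
  note r = this
  have "pt (\<lambda>x. map (\<lambda>_. g x) (replicate (f x) ()))"
    by (rule pt_map[OF r pt_compose[OF assms(2)]]) (intro pt_intros)
  then show ?thesis by simp
qed

lemma pt_length [pt_intros]:
  assumes "pt f" shows "pt (\<lambda>x. length (f x))"
proof -
  have "enc (length l) = enc (l :: unit list)" for l
    using enc_replicate[of "length l"] by (simp add: replicate_length_same)
  then have c: "pt (length :: unit list \<Rightarrow> nat)"
    by (rule pt_cast)
  have "pt (\<lambda>x. length (map (\<lambda>_. ()) (f x)))"
    by (rule pt_compose[OF c]) (intro pt_intros assms)
  then show ?thesis by simp
qed

lemma pt_funpow:
  fixes f :: "'a::enc \<Rightarrow> 's::enc \<Rightarrow> 's"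
  assumes "pt (\<lambda>p. f (fst p) (snd p))" "pt n" "pt i" "poly_bounded q"
    and "\<And>x s. sz (f x s) \<le> sz s + q (sz x)"
  shows "pt (\<lambda>x. (f x ^^ n x) (i x))"
proof -
  obtain q' where q': "\<And>n. q n \<le> poly q' n" using assms(4) by (auto simp: poly_bounded_def)
  have f: "pt (\<lambda>p. f (fst p) (snd (snd p)))"
    by (rule pt_compose[OF assms(1), of "\<lambda>p. (fst p, snd (snd p))", simplified]) (intro pt_intros)
  have "pt (\<lambda>x. fold (\<lambda>_. f x) (replicate (n x) ()) (i x))"
  proof (rule pt_fold[where q = "poly q'"])
    show "sz (f x s) \<le> sz s + poly q' (sz x + sz a)" for x s and a :: unit
      using assms(5)[of x s] q'[of "sz x"] poly_nat_mono[of "sz x" "sz x + sz a" q'] by linarith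
  qed (intro f pt_intros assms poly_bounded_poly)+
  moreover have "fold (\<lambda>_. f x) (replicate k ()) s = (f x ^^ k) s" for x :: 'a and k and s :: 's
    by (induction k arbitrary: s) (simp_all add: funpow_swap1)
  ultimately show ?thesis by simp
qed

lemma pt_plus [pt_intros]:
  assumes "pt f" "pt g" shows "pt (\<lambda>x. f x + g x :: nat)"
proof -
  have "pt (\<lambda>x. (Suc ^^ f x) (g x))"
    by (rule pt_funpow[where q = "\<lambda>_. 2"]) (intro pt_intros assms poly_bounded_const | simp add: sz_nat)+
  then show ?thesis by (simp add: add.commute)
qed

lemma pt_minus [pt_intros]:
  assumes "pt f" "pt g" shows "pt (\<lambda>x. f x - g x :: nat)"
proof -
  have "pt (\<lambda>x. ((\<lambda>n. n - 1) ^^ g x) (f x))"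
    by (rule pt_funpow[where q = "\<lambda>_. 0"])
      (rule pt_compose[OF pt_pred], (intro pt_intros assms poly_bounded_const | simp add: sz_nat)+)
  moreover have "((\<lambda>n. n - 1) ^^ k) m = m - k" for k m :: nat
    by (induction k) auto
  ultimately show ?thesis by simp
qed

lemma pt_nat_eq [pt_intros]:
  assumes "pt f" "pt g" shows "pt (\<lambda>x. f x = (g x :: nat))"
proof -
  have "pt (\<lambda>x. case (f x - g x) + (g x - f x) of 0 \<Rightarrow> True | Suc _ \<Rightarrow> False)"
    by (intro pt_intros assms)
  moreover have "(case (m - n) + (n - m) of 0 \<Rightarrow> True | Suc _ \<Rightarrow> False) \<longleftrightarrow> m = n" for m n :: nat
    by (auto split: nat.split)
  ultimately show ?thesis by simp
qed

lemma pt_upt [pt_intros]: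
  assumes "pt f" shows "pt (\<lambda>x. [0..<f x])"
proof -
  obtain F where F: "poly_bounded F" "\<And>x. sz (f x) \<le> F (sz x)" by (rule pt_sz[OF assms]) blast
  have fold: "fold (\<lambda>_ s. s @ [length s]) l [0..<k] = [0..<k + length l]" for l :: "unit list" and k
  proof (induction l arbitrary: k)
    case (Cons a l)
    from Cons[of "Suc k"] show ?case by simp
  qed simp
  have sz_upt: "sz [0..<k] \<le> 1 + k * (2 * k + 3)" for k
  proof (induction k)
    case (Suc k)
    then show ?case using sz_append[of "[0..<k]" "[k]"] by (auto simp: sz_nat algebra_simps)
  qed simp
  have "pt (\<lambda>x. fold (\<lambda>_ s. s @ [length s]) (replicate (f x) ()) [])"
  proof (rule pt_fold_bounded)
    show "poly_bounded (\<lambda>n. 1 + F n * (2 * F n + 3))"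
      by (intro poly_bounded_add poly_bounded_mult poly_bounded_const F)
    fix x pre suf assume *: "replicate (f x) () = pre @ suf"
    have "length pre \<le> length (pre @ suf)" by simp
    also have "\<dots> = f x" using arg_cong[OF *, of length] by simp
    also have "\<dots> \<le> F (sz x)" using F(2)[of x] by (simp add: sz_nat)
    finally have "length pre \<le> F (sz x)" .
    then have "length pre * (2 * length pre + 3) \<le> F (sz x) * (2 * F (sz x) + 3)"
      by (intro mult_mono) auto
    with sz_upt[of "length pre"] show "sz (fold (\<lambda>_ s. s @ [length s]) pre []) \<le> 1 + F (sz x) * (2 * F (sz x) + 3)"
      using fold[where k = 0 and l = pre] by simp
  qed (intro pt_intros assms)+
  moreover have "fold (\<lambda>_ s. s @ [length s]) l [] = [0..<length l]" for l :: "unit list"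
    using fold[where k = 0] by simp
  ultimately show ?thesis by (simp only: length_replicate)
qed

text \<open>
  Such a function is a nested case distinction on its argument; all tables for the finitely many
  labels of a graph are of this kind.
\<close>

lemma pt_table:
  fixes f :: "nat \<Rightarrow> 'b::enc"
  assumes "pt n" "\<And>m. m \<ge> K \<Longrightarrow> f m = f K"
  shows "pt (\<lambda>x. f (n x))"
proof -
  have "pt f" using assms(2)
  proof (induction K arbitrary: f)
    case 0
    have "f = (\<lambda>_. f 0)" by (rule ext, rule 0) simp
    then show ?case by (rule ssubst) (rule pt_const)
  next
    case (Suc K)
    have "pt (\<lambda>m. f (Suc m))" by (rule Suc.IH, rule Suc.prems) simp
    then have "pt (\<lambda>p :: nat \<times> nat. f (Suc (snd p)))"
      by (rule pt_compose) (intro pt_intros)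
    then have "pt (\<lambda>m. case m of 0 \<Rightarrow> f 0 | Suc m' \<Rightarrow> f (Suc m'))"
      by (intro pt_intros)
    moreover have "(\<lambda>m. case m of 0 \<Rightarrow> f 0 | Suc m' \<Rightarrow> f (Suc m')) = f"
      by (auto split: nat.split)
    ultimately show ?case by simp
  qed
  from pt_compose[OF this assms(1)] show ?thesis .
qed

lemma pt_bits_eq [pt_intros]:
  assumes "pt f" "pt g" shows "pt (\<lambda>x. f x = (g x :: bool list))"
proof -
  let ?eq = "\<lambda>p. if fst p then snd p else \<not> snd p"
  have "pt (\<lambda>x. length (f x) = length (g x) \<and> list_all (\<lambda>p. ?eq p) (zip (f x) (g x)))"
    by (intro pt_intros assms)
  moreover have "(length v = length w \<and> list_all (\<lambda>p. ?eq p) (zip v w)) \<longleftrightarrow> v = w" for v w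
    by (simp add: list_eq_iff_zip_eq list_all_iff Ball_def split_beta cong: conj_cong) metis
  ultimately show ?thesis by simp
qed

lemma pt_decide: "L \<in> PTIME \<Longrightarrow> pt f \<Longrightarrow> pt (\<lambda>x. f x \<in> L)"
  by (rule pt_compose[OF pt_if_PTIME])

section \<open>Normal forms in amalgamated products\<close>

text \<open>
  One factor \<open>A\<close> of an amalgamated product, with the amalgamated subgroup embedded by \<open>f\<close>; the injection
  \<open>\<iota>\<close> marks elements of \<open>A\<close> as belonging to this factor.  A pair \<open>(c, [s\<^sub>1, s\<^sub>2, \<dots>])\<close> stands for the product
  \<open>c s\<^sub>1 s\<^sub>2 \<dots>\<close>, where the \<open>s\<^sub>i\<close> are chosen representatives of nontrivial right cosets of \<open>C\<close>, alternately in
  the two factors.  The group \<open>A\<close> acts on these normal forms by multiplication from the left.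
\<close>

locale amalg_factor = A: group A + C: group C
  for A :: "('x, 'p) monoid_scheme" and C :: "('c, 'k) monoid_scheme" +
  fixes f :: "'c \<Rightarrow> 'x" and \<iota> :: "'x \<Rightarrow> 'y"
  assumes f_mon: "f \<in> mon C A" and inj_\<iota>: "inj \<iota>"
begin

lemma f_hom: "f \<in> hom C A" and f_inj: "inj_on f (carrier C)"
  using f_mon by (auto simp: mon_def)

sublocale f: group_hom C A f
  by unfold_locales (rule f_hom)

text \<open>
  The chosen representative of the coset \<open>f(C) h\<close>: the set in the choice depends only on the coset.
\<close>

definition rep :: "'x \<Rightarrow> 'x" where
  "rep h = (SOME y. \<exists>c\<in>carrier C. y = f c \<otimes>\<^bsub>A\<^esub> h)"

definition part :: "'x \<Rightarrow> 'c" where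
  "part h = (THE c. c \<in> carrier C \<and> h = f c \<otimes>\<^bsub>A\<^esub> rep h)"

lemma rep_ex: "h \<in> carrier A \<Longrightarrow> \<exists>c\<in>carrier C. rep h = f c \<otimes>\<^bsub>A\<^esub> h"
  unfolding rep_def by (rule someI_ex) blast

lemma rep_closed [simp]: "h \<in> carrier A \<Longrightarrow> rep h \<in> carrier A"
  using rep_ex[of h] by auto

lemma part_ex:
  assumes "h \<in> carrier A" shows "\<exists>c\<in>carrier C. h = f c \<otimes>\<^bsub>A\<^esub> rep h"
proof -
  obtain c where c: "c \<in> carrier C" "rep h = f c \<otimes>\<^bsub>A\<^esub> h" using rep_ex[OF assms] by blast
  then have "h = f (inv\<^bsub>C\<^esub> c) \<otimes>\<^bsub>A\<^esub> rep h"
    using assms by (simp add: A.m_assoc[symmetric])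
  with c show ?thesis by blast
qed

lemma part_eqI:
  assumes "h \<in> carrier A" "c \<in> carrier C" "h = f c \<otimes>\<^bsub>A\<^esub> rep h"
  shows "part h = c"
  unfolding part_def
proof (rule the_equality)
  fix d assume "d \<in> carrier C \<and> h = f d \<otimes>\<^bsub>A\<^esub> rep h"
  with assms have "f d = f c" by (metis A.right_cancel f.hom_closed rep_closed)
  with assms \<open>d \<in> carrier C \<and> _\<close> show "d = c" using f_inj by (auto dest: inj_onD)
qed (use assms in auto)

lemma part: "h \<in> carrier A \<Longrightarrow> part h \<in> carrier C" "h \<in> carrier A \<Longrightarrow> f (part h) \<otimes>\<^bsub>A\<^esub> rep h = h"
  using part_ex part_eqI by metis+

lemma rep_mult:
  assumes "c \<in> carrier C" "h \<in> carrier A"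
  shows "rep (f c \<otimes>\<^bsub>A\<^esub> h) = rep h"
proof -
  have "(\<exists>d\<in>carrier C. y = f d \<otimes>\<^bsub>A\<^esub> (f c \<otimes>\<^bsub>A\<^esub> h)) \<longleftrightarrow> (\<exists>d\<in>carrier C. y = f d \<otimes>\<^bsub>A\<^esub> h)" for y
  proof
    assume "\<exists>d\<in>carrier C. y = f d \<otimes>\<^bsub>A\<^esub> (f c \<otimes>\<^bsub>A\<^esub> h)"
    then obtain d where "d \<in> carrier C" "y = f d \<otimes>\<^bsub>A\<^esub> (f c \<otimes>\<^bsub>A\<^esub> h)" by blast
    with assms show "\<exists>d\<in>carrier C. y = f d \<otimes>\<^bsub>A\<^esub> h"
      by (intro bexI[of _ "d \<otimes>\<^bsub>C\<^esub> c"]) (auto simp: A.m_assoc)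
  next
    assume "\<exists>d\<in>carrier C. y = f d \<otimes>\<^bsub>A\<^esub> h"
    then obtain d where "d \<in> carrier C" "y = f d \<otimes>\<^bsub>A\<^esub> h" by blast
    with assms show "\<exists>d\<in>carrier C. y = f d \<otimes>\<^bsub>A\<^esub> (f c \<otimes>\<^bsub>A\<^esub> h)"
      by (intro bexI[of _ "d \<otimes>\<^bsub>C\<^esub> inv\<^bsub>C\<^esub> c"]) (auto simp: A.m_assoc A.inv_solve_left' simp flip: A.m_assoc[of "inv\<^bsub>A\<^esub> f c"])
  qed
  then show ?thesis by (simp add: rep_def)
qed

lemma rep_rep: "h \<in> carrier A \<Longrightarrow> rep (rep h) = rep h"
  using rep_ex[of h] rep_mult by auto

lemma mult_in_image:
  assumes "c \<in> carrier C" "h \<in> carrier A"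
  shows "f c \<otimes>\<^bsub>A\<^esub> h \<in> f ` carrier C \<longleftrightarrow> h \<in> f ` carrier C"
    and "h \<otimes>\<^bsub>A\<^esub> f c \<in> f ` carrier C \<longleftrightarrow> h \<in> f ` carrier C"
proof -
  have s: "subgroup (f ` carrier C) A" by (rule f.img_is_subgroup)
  have c: "f c \<in> f ` carrier C" using assms by blast
  show "f c \<otimes>\<^bsub>A\<^esub> h \<in> f ` carrier C \<longleftrightarrow> h \<in> f ` carrier C"
    using subgroup.m_closed[OF s subgroup.m_inv_closed[OF s c]] subgroup.m_closed[OF s c] assms
    by (metis A.inv_solve_left A.inv_closed A.m_closed f.hom_closed A.l_inv A.l_one A.m_assoc)
  show "h \<otimes>\<^bsub>A\<^esub> f c \<in> f ` carrier C \<longleftrightarrow> h \<in> f ` carrier C"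
    using subgroup.m_closed[OF s _ subgroup.m_inv_closed[OF s c]] subgroup.m_closed[OF s _ c] assms
    by (metis A.inv_closed A.m_closed f.hom_closed A.r_inv A.r_one A.m_assoc)
qed

definition starts :: "'y list \<Rightarrow> bool" where
  "starts S \<longleftrightarrow> S \<noteq> [] \<and> hd S \<in> range \<iota>"

lemma starts_simps [simp]: "\<not> starts []" "starts (y # S) \<longleftrightarrow> y \<in> range \<iota>"
  by (auto simp: starts_def)

definition syllables :: "'y set" where
  "syllables = \<iota> ` {s \<in> carrier A. s \<notin> f ` carrier C \<and> rep s = s}"

definition nf :: "'c \<times> 'y list \<Rightarrow> bool" where
  "nf \<omega> \<longleftrightarrow> fst \<omega> \<in> carrier C \<and> (starts (snd \<omega>) \<longrightarrow> hd (snd \<omega>) \<in> syllables \<and> \<not> starts (tl (snd \<omega>)))"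

text \<open>
  Merges \<open>c\<close> with \<open>s\<^sub>1\<close> if \<open>s\<^sub>1\<close> lies in \<open>A\<close>.  Together with its inverse \<open>pack\<close>, this identifies normal forms with
  pairs of an element of \<open>A\<close> and a tail that does not start in \<open>A\<close>.  Left multiplication on the first
  component is then plainly an action, and no case distinction on cancellation is needed.
\<close>

definition unpack :: "'c \<times> 'y list \<Rightarrow> 'x \<times> 'y list" where
  "unpack \<omega> = (if starts (snd \<omega>) then (f (fst \<omega>) \<otimes>\<^bsub>A\<^esub> inv_into UNIV \<iota> (hd (snd \<omega>)), tl (snd \<omega>))
     else (f (fst \<omega>), snd \<omega>))"

definition pack :: "'x \<Rightarrow> 'y list \<Rightarrow> 'c \<times> 'y list" where
  "pack h S = (if h \<in> f ` carrier C then (inv_into (carrier C) f h, S) else (part h, \<iota> (rep h) # S))"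

definition act :: "'x \<Rightarrow> 'c \<times> 'y list \<Rightarrow> 'c \<times> 'y list" where
  "act g \<omega> = pack (g \<otimes>\<^bsub>A\<^esub> fst (unpack \<omega>)) (snd (unpack \<omega>))"

lemma unpack_pack:
  assumes "h \<in> carrier A" "\<not> starts S"
  shows "unpack (pack h S) = (h, S)"
  using assms part[of h] inj_\<iota> by (auto simp: pack_def unpack_def inv_into_f_f[OF f_inj])

lemma unpack_closed: "nf \<omega> \<Longrightarrow> fst (unpack \<omega>) \<in> carrier A" "nf \<omega> \<Longrightarrow> \<not> starts (snd (unpack \<omega>))"
  using inj_\<iota> by (auto simp: nf_def unpack_def syllables_def)

lemma pack_unpack:
  assumes "nf \<omega>" shows "pack (fst (unpack \<omega>)) (snd (unpack \<omega>)) = \<omega>"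
proof (cases "starts (snd \<omega>)")
  case False
  with assms show ?thesis by (auto simp: nf_def unpack_def pack_def inv_into_f_f[OF f_inj] prod_eq_iff)
next
  case True
  with assms obtain c s S where \<omega>: "\<omega> = (c, \<iota> s # S)" "c \<in> carrier C" "s \<in> carrier A" "s \<notin> f ` carrier C" "rep s = s"
    by (cases \<omega>; cases "snd \<omega>") (auto simp: nf_def syllables_def)
  have "part (f c \<otimes>\<^bsub>A\<^esub> s) = c"
    by (rule part_eqI) (use \<omega> in \<open>auto simp: rep_mult\<close>)
  with \<omega> show ?thesis
    by (auto simp: unpack_def pack_def mult_in_image rep_mult inv_into_f_f[OF inj_\<iota>])
qed

lemma nf_pack: "h \<in> carrier A \<Longrightarrow> \<not> starts S \<Longrightarrow> nf (pack h S)"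
  using mult_in_image(1)[of "part h" "rep h"] part[of h]
  by (auto simp: pack_def nf_def syllables_def rep_rep inv_into_f_f[OF f_inj])

lemma nf_act: "g \<in> carrier A \<Longrightarrow> nf \<omega> \<Longrightarrow> nf (act g \<omega>)"
  unfolding act_def by (intro nf_pack A.m_closed unpack_closed)

lemma act_one: "nf \<omega> \<Longrightarrow> act \<one>\<^bsub>A\<^esub> \<omega> = \<omega>"
  by (simp add: act_def unpack_closed pack_unpack)

lemma act_mult: "g \<in> carrier A \<Longrightarrow> h \<in> carrier A \<Longrightarrow> nf \<omega> \<Longrightarrow> act (g \<otimes>\<^bsub>A\<^esub> h) \<omega> = act g (act h \<omega>)"
  by (simp add: act_def unpack_closed unpack_pack A.m_assoc)

text \<open>
  Multiplication by an element of \<open>C\<close> has a description without \<open>A\<close>, hence both factors agree on \<open>C\<close>.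
\<close>

lemma act_image:
  assumes "c \<in> carrier C" "nf \<omega>" shows "act (f c) \<omega> = (c \<otimes>\<^bsub>C\<^esub> fst \<omega>, snd \<omega>)"
proof -
  let ?\<omega> = "(c \<otimes>\<^bsub>C\<^esub> fst \<omega>, snd \<omega>)"
  have "nf ?\<omega>" using assms by (auto simp: nf_def)
  moreover have "unpack ?\<omega> = (f c \<otimes>\<^bsub>A\<^esub> fst (unpack \<omega>), snd (unpack \<omega>))"
    using assms inj_\<iota> by (auto simp: unpack_def nf_def syllables_def A.m_assoc)
  ultimately show ?thesis using pack_unpack[of ?\<omega>] by (simp add: act_def)
qed

lemma act_grows:
  assumes "g \<in> carrier A" "g \<notin> f ` carrier C" "nf \<omega>" "\<not> starts (snd \<omega>)"
  shows "\<exists>s c. act g \<omega> = (c, \<iota> s # snd \<omega>)"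
  using assms mult_in_image(2)[of "fst \<omega>" g] by (auto simp: act_def unpack_def pack_def nf_def)

lemma act_tail:
  assumes "g \<in> carrier A" "nf \<omega>"
  shows "snd (act g \<omega>) = snd (unpack \<omega>) \<or> (\<exists>y\<in>syllables. snd (act g \<omega>) = y # snd (unpack \<omega>))"
proof -
  have "g \<otimes>\<^bsub>A\<^esub> fst (unpack \<omega>) \<in> carrier A" using assms unpack_closed by blast
  then show ?thesis
    using nf_pack[of "g \<otimes>\<^bsub>A\<^esub> fst (unpack \<omega>)" "snd (unpack \<omega>)"] unpack_closed[OF assms(2)]
    by (auto simp: act_def pack_def nf_def)
qed

lemma snd_unpack: "snd (unpack \<omega>) = (if starts (snd \<omega>) then tl (snd \<omega>) else snd \<omega>)"
  by (simp add: unpack_def)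

end

locale amalgam =
  fixes G :: "('a, 'm) monoid_scheme" and H :: "('b, 'n) monoid_scheme"
    and C :: "('c, 'k) monoid_scheme" and \<phi> :: "'c \<Rightarrow> 'a" and \<psi> :: "'c \<Rightarrow> 'b"
  assumes group_G: "group G" and group_H: "group H" and group_C: "group C"
    and \<phi>: "\<phi> \<in> mon C G" and \<psi>: "\<psi> \<in> mon C H"
begin

sublocale L: amalg_factor G C \<phi> "Inl :: 'a \<Rightarrow> 'a + 'b"
  using group_G group_C \<phi> by (simp add: amalg_factor_def amalg_factor_axioms_def)

sublocale R: amalg_factor H C \<psi> "Inr :: 'b \<Rightarrow> 'a + 'b"
  using group_H group_C \<psi> by (simp add: amalg_factor_def amalg_factor_axioms_def)

abbreviation amalg_equiv (infix "\<approx>" 50) where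
  "v \<approx> w \<equiv> amalg_eq G H C \<phi> \<psi> v w"

lemma amalg_equiv_lists:
  assumes "v \<approx> w"
  shows "v \<in> lists (carrier G <+> carrier H)" "w \<in> lists (carrier G <+> carrier H)"
  using amalg_eq_in_lists[OF group_G group_H L.f_hom R.f_hom assms] by auto

definition normal_forms :: "('c \<times> ('a + 'b) list) set" where
  "normal_forms = {(c, S). c \<in> carrier C \<and> set S \<subseteq> L.syllables \<union> R.syllables \<and>
     successively (\<lambda>x y. isl x \<noteq> isl y) S}"

lemma range_isl: "x \<in> range Inl \<longleftrightarrow> isl x" "x \<in> range Inr \<longleftrightarrow> \<not> isl x"
  by (cases x; auto)+

lemma syllables_isl: "x \<in> L.syllables \<Longrightarrow> isl x" "x \<in> R.syllables \<Longrightarrow> \<not> isl x"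
  by (auto simp: L.syllables_def R.syllables_def)

lemma normal_forms_nf: "\<omega> \<in> normal_forms \<Longrightarrow> L.nf \<omega>" "\<omega> \<in> normal_forms \<Longrightarrow> R.nf \<omega>"
  by (cases \<omega>; cases "snd \<omega>" rule: remdups_adj.cases;
      fastforce simp: normal_forms_def L.nf_def R.nf_def range_isl dest: syllables_isl)+

lemma normal_forms_tl: "(c, y # S) \<in> normal_forms \<Longrightarrow> d \<in> carrier C \<Longrightarrow> (d, S) \<in> normal_forms"
  by (auto simp: normal_forms_def successively_Cons)

lemma L_act_closed:
  assumes "g \<in> carrier G" "\<omega> \<in> normal_forms" shows "L.act g \<omega> \<in> normal_forms"
proof -
  let ?S = "snd (L.unpack \<omega>)"
  have nf: "L.nf (L.act g \<omega>)" using L.nf_act assms normal_forms_nf by blast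
  then have c: "fst (L.act g \<omega>) \<in> carrier C" by (simp add: L.nf_def)
  then have "(fst (L.act g \<omega>), ?S) \<in> normal_forms"
    using assms(2) normal_forms_tl
    by (cases \<omega>; cases "snd \<omega>") (auto simp: L.snd_unpack normal_forms_def successively_Cons)
  moreover have "\<not> L.starts ?S" using L.unpack_closed normal_forms_nf assms by blast
  ultimately show ?thesis
    using L.act_tail[OF assms(1), of \<omega>] normal_forms_nf(1)[OF assms(2)] c
    by (cases "L.act g \<omega>"; cases ?S) (auto simp: normal_forms_def range_isl dest: syllables_isl)
qed

lemma R_act_closed:
  assumes "g \<in> carrier H" "\<omega> \<in> normal_forms" shows "R.act g \<omega> \<in> normal_forms"
proof -
  let ?S = "snd (R.unpack \<omega>)"
  have nf: "R.nf (R.act g \<omega>)" using R.nf_act assms normal_forms_nf by blast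
  then have c: "fst (R.act g \<omega>) \<in> carrier C" by (simp add: R.nf_def)
  then have "(fst (R.act g \<omega>), ?S) \<in> normal_forms"
    using assms(2) normal_forms_tl
    by (cases \<omega>; cases "snd \<omega>") (auto simp: R.snd_unpack normal_forms_def successively_Cons)
  moreover have "\<not> R.starts ?S" using R.unpack_closed normal_forms_nf assms by blast
  ultimately show ?thesis
    using R.act_tail[OF assms(1), of \<omega>] normal_forms_nf(2)[OF assms(2)] c
    by (cases "R.act g \<omega>"; cases ?S) (auto simp: normal_forms_def range_isl dest: syllables_isl)
qed

definition action :: "('a + 'b) list \<Rightarrow> 'c \<times> ('a + 'b) list \<Rightarrow> 'c \<times> ('a + 'b) list" where
  "action w \<omega> = foldr (case_sum L.act R.act) w \<omega>"

lemma action_simps [simp]: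
  "action [] \<omega> = \<omega>" "action (x # w) \<omega> = case_sum L.act R.act x (action w \<omega>)"
  "action (v @ w) \<omega> = action v (action w \<omega>)"
  by (simp_all add: action_def)

lemma action_closed:
  "w \<in> lists (carrier G <+> carrier H) \<Longrightarrow> \<omega> \<in> normal_forms \<Longrightarrow> action w \<omega> \<in> normal_forms"
  by (induction w) (auto intro: L_act_closed R_act_closed)

text \<open>
  The actions of the two factors satisfy the defining relations of the amalgamated product, so equal
  words act equally (van der Waerden's argument).
\<close>

lemma action_equiv:
  assumes "v \<approx> w" "\<omega> \<in> normal_forms" shows "action v \<omega> = action w \<omega>"
  using assms
proof (induction arbitrary: \<omega> rule: amalg_eq.induct)
  case (append v v' w w')
  have "action w \<omega> \<in> normal_forms"
    using append.prems amalg_equiv_lists[OF append.hyps(2)] by (intro action_closed)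
  with append show ?case by simp
next
  case (amalg c)
  then show ?case using L.act_image R.act_image normal_forms_nf by simp
qed (simp_all add: normal_forms_nf L.act_one R.act_one L.act_mult R.act_mult)

definition in_C :: "'a + 'b \<Rightarrow> bool" where
  "in_C x \<longleftrightarrow> (\<exists>c\<in>carrier C. x = Inl (\<phi> c) \<or> x = Inr (\<psi> c))"

definition reduced :: "('a + 'b) list \<Rightarrow> bool" where
  "reduced w \<longleftrightarrow> successively (\<lambda>x y. isl x \<noteq> isl y) w \<and> (\<forall>x\<in>set w. \<not> in_C x)"

lemma one_normal_form: "(\<one>\<^bsub>C\<^esub>, []) \<in> normal_forms"
  using group.is_monoid[OF group_C] by (simp add: normal_forms_def monoid.one_closed)

text \<open>
  Applied to the trivial normal form, each letter of a reduced word meets a normal form that starts in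
  the other factor, so it adds a syllable that is never cancelled.
\<close>

lemma action_reduced:
  assumes "reduced w" "w \<in> lists (carrier G <+> carrier H)"
  shows "length (snd (action w (\<one>\<^bsub>C\<^esub>, []))) = length w \<and>
    (w \<noteq> [] \<longrightarrow> isl (hd (snd (action w (\<one>\<^bsub>C\<^esub>, [])))) = isl (hd w))"
  using assms
proof (induction w)
  case (Cons x w)
  let ?\<omega> = "action w (\<one>\<^bsub>C\<^esub>, [])"
  have red: "reduced w" and x: "\<not> in_C x" "w \<noteq> [] \<Longrightarrow> isl x \<noteq> isl (hd w)"
    using Cons.prems by (auto simp: reduced_def successively_Cons)
  have IH: "length (snd ?\<omega>) = length w" "w \<noteq> [] \<Longrightarrow> isl (hd (snd ?\<omega>)) = isl (hd w)"
    using Cons.IH[OF red] Cons.prems by auto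
  have \<omega>: "?\<omega> \<in> normal_forms" using Cons.prems one_normal_form by (auto intro: action_closed)
  have starts: "isl x \<Longrightarrow> \<not> L.starts (snd ?\<omega>)" "\<not> isl x \<Longrightarrow> \<not> R.starts (snd ?\<omega>)"
    using x IH by (cases "w = []"; auto simp: L.starts_def R.starts_def range_isl)+
  show ?case
  proof (cases x)
    case (Inl g)
    have "\<exists>s c. L.act g ?\<omega> = (c, Inl s # snd ?\<omega>)"
      by (rule L.act_grows) (use Cons.prems Inl x(1) starts \<omega> normal_forms_nf in \<open>auto simp: in_C_def\<close>)
    with Inl IH show ?thesis by auto
  next
    case (Inr h)
    have "\<exists>s c. R.act h ?\<omega> = (c, Inr s # snd ?\<omega>)"
      by (rule R.act_grows) (use Cons.prems Inr x(1) starts \<omega> normal_forms_nf in \<open>auto simp: in_C_def\<close>)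
    with Inr IH show ?thesis by auto
  qed
qed simp

lemma action_amalgamated:
  assumes "c \<in> carrier C" "w \<approx> [Inl (\<phi> c)]"
  shows "action w (\<one>\<^bsub>C\<^esub>, []) = (c, [])"
  using action_equiv[OF assms(2) one_normal_form] assms(1)
    L.act_image[OF assms(1), of "(\<one>\<^bsub>C\<^esub>, [])"] normal_forms_nf[OF one_normal_form]
  by (simp add: L.C.r_one)

text \<open>
  Elements of \<open>C\<close> lead from the trivial normal form to normal forms without syllables, and nonempty
  reduced words do not.
\<close>

theorem reduced_not_amalgamated:
  assumes "reduced w" "c \<in> carrier C" "w \<approx> [Inl (\<phi> c)]"
  shows "w = []"
  using action_reduced[OF assms(1)] amalg_equiv_lists[OF assms(3)] action_amalgamated[OF assms(2,3)] by simp

lemma amalgamated_inj: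
  assumes "c \<in> carrier C" "d \<in> carrier C" "[Inl (\<phi> c)] \<approx> [Inl (\<phi> d)]"
  shows "c = d"
  using action_amalgamated[OF assms(2,3)]
    action_amalgamated[OF assms(1) amalg_eq.refl[OF amalg_equiv_lists(1)[OF assms(3)]]] by simp

end

section \<open>Saturated relations\<close>

lemma not_successively:
  "\<not> successively P w \<Longrightarrow> \<exists>a x y b. w = a @ [x, y] @ b \<and> \<not> P x y"
proof (induction w rule: induct_list012)
  case (3 x y w)
  show ?case
  proof (cases "P x y")
    case True
    with 3 obtain a x' y' b where "y # w = a @ [x', y'] @ b" "\<not> P x' y'" by auto
    then show ?thesis by (intro exI[of _ "x # a"]) auto
  next
    case False
    then show ?thesis by (intro exI[of _ "[]"]) auto
  qed
qed auto

text \<open>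
  \<open>RG u g v\<close> says that a graph has a path from \<open>u\<close> to \<open>v\<close> of value \<open>g\<close> inside the first factor, and \<open>RH\<close> says
  the same for the second factor.  The assumption \<open>switch\<close> is saturation: a path with a value in \<open>C\<close> inside
  one factor has a counterpart inside the other.
\<close>

locale saturated = amalgam G H C \<phi> \<psi>
  for G :: "('a, 'm) monoid_scheme" and H :: "('b, 'n) monoid_scheme"
    and C :: "('c, 'k) monoid_scheme" and \<phi> :: "'c \<Rightarrow> 'a" and \<psi> :: "'c \<Rightarrow> 'b" +
  fixes RG :: "'v \<Rightarrow> 'a \<Rightarrow> 'v \<Rightarrow> bool" and RH :: "'v \<Rightarrow> 'b \<Rightarrow> 'v \<Rightarrow> bool"
  assumes RG_closed: "RG u g v \<Longrightarrow> g \<in> carrier G" and RH_closed: "RH u h v \<Longrightarrow> h \<in> carrier H"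
    and RG_trans: "RG u g v \<Longrightarrow> RG v g' w \<Longrightarrow> RG u (g \<otimes>\<^bsub>G\<^esub> g') w"
    and RH_trans: "RH u h v \<Longrightarrow> RH v h' w \<Longrightarrow> RH u (h \<otimes>\<^bsub>H\<^esub> h') w"
    and switch: "c \<in> carrier C \<Longrightarrow> RG u (\<phi> c) v \<longleftrightarrow> RH u (\<psi> c) v"
begin

fun chain :: "'v \<Rightarrow> ('a + 'b) list \<Rightarrow> 'v \<Rightarrow> bool" where
  "chain u [] v \<longleftrightarrow> u = v"
| "chain u (Inl g # w) v \<longleftrightarrow> (\<exists>z. RG u g z \<and> chain z w v)"
| "chain u (Inr h # w) v \<longleftrightarrow> (\<exists>z. RH u h z \<and> chain z w v)"

lemma chain_append: "chain u (w @ w') v \<longleftrightarrow> (\<exists>z. chain u w z \<and> chain z w' v)"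
proof (induction w arbitrary: u)
  case (Cons x w)
  then show ?case by (cases x) auto
qed simp

lemma chain_lists: "chain u w v \<Longrightarrow> w \<in> lists (carrier G <+> carrier H)"
proof (induction w arbitrary: u)
  case (Cons x w)
  then show ?case by (cases x) (auto dest: RG_closed RH_closed)
qed simp

lemma switch_side:
  assumes "in_C x" shows "\<exists>y. isl y \<noteq> isl x \<and> [x] \<approx> [y] \<and> (\<forall>u v. chain u [x] v \<longleftrightarrow> chain u [y] v)"
proof -
  obtain c where c: "c \<in> carrier C" and x: "x = Inl (\<phi> c) \<or> x = Inr (\<psi> c)"
    using assms by (auto simp: in_C_def)
  have e: "[Inl (\<phi> c)] \<approx> [Inr (\<psi> c)]" using c by (rule amalg_eq.amalg)
  from x show ?thesis
  proof
    assume "x = Inl (\<phi> c)"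
    with e c show ?thesis by (intro exI[of _ "Inr (\<psi> c)"]) (simp add: switch)
  next
    assume "x = Inr (\<psi> c)"
    with amalg_eq.sym[OF e] c show ?thesis by (intro exI[of _ "Inl (\<phi> c)"]) (simp add: switch)
  qed
qed

lemma merge_same_side:
  assumes "isl x = isl y" "chain u [x, y] v"
  shows "\<exists>z. [x, y] \<approx> [z] \<and> chain u [z] v"
proof (cases x)
  case (Inl g)
  with assms obtain g' where y: "y = Inl g'" by (cases y) auto
  with Inl assms have "g \<in> carrier G" "g' \<in> carrier G" by (auto dest: RG_closed)
  with Inl y assms show ?thesis
    by (intro exI[of _ "Inl (g \<otimes>\<^bsub>G\<^esub> g')"]) (auto intro: amalg_eq.multG RG_trans)
next
  case (Inr h)
  with assms obtain h' where y: "y = Inr h'" by (cases y) auto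
  with Inr assms have "h \<in> carrier H" "h' \<in> carrier H" by (auto dest: RH_closed)
  with Inr y assms show ?thesis
    by (intro exI[of _ "Inr (h \<otimes>\<^bsub>H\<^esub> h')"]) (auto intro: amalg_eq.multH RH_trans)
qed

text \<open>
  Saturation lets a syllable from \<open>C\<close> change sides; two neighbours on the same side are one syllable.
\<close>

lemma merge:
  assumes "isl x = isl y \<or> in_C x \<or> in_C y" "chain u [x, y] v"
  shows "\<exists>z. [x, y] \<approx> [z] \<and> chain u [z] v"
proof -
  have xy: "[x] \<approx> [x]" "[y] \<approx> [y]"
    using chain_lists[OF assms(2)] by (auto intro!: amalg_eq.refl)
  have "\<exists>x' y'. isl x' = isl y' \<and> [x, y] \<approx> [x', y'] \<and> chain u [x', y'] v"
  proof (cases "isl x = isl y")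
    case True
    with assms(2) xy show ?thesis using amalg_eq.append[OF xy] by auto
  next
    case False
    with assms(1) consider "in_C x" | "in_C y" by blast
    then show ?thesis
    proof cases
      case 1
      then obtain x' where x': "isl x' \<noteq> isl x" "[x] \<approx> [x']" "\<And>u v. chain u [x] v \<longleftrightarrow> chain u [x'] v"
        using switch_side by blast
      have "chain u ([x] @ [y]) v" using assms(2) by simp
      then have "chain u ([x'] @ [y]) v" unfolding chain_append x'(3) .
      with x' False amalg_eq.append[OF x'(2) xy(2)] show ?thesis by auto
    next
      case 2
      then obtain y' where y': "isl y' \<noteq> isl y" "[y] \<approx> [y']" "\<And>u v. chain u [y] v \<longleftrightarrow> chain u [y'] v"
        using switch_side by blast
      have "chain u ([x] @ [y]) v" using assms(2) by simp
      then have "chain u ([x] @ [y']) v" unfolding chain_append y'(3) .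
      with y' False amalg_eq.append[OF xy(1) y'(2)] show ?thesis by auto
    qed
  qed
  then show ?thesis using merge_same_side amalg_eq.trans by blast
qed

lemma shorten:
  assumes "chain u w v" "length w \<ge> 2" "\<not> reduced w"
  shows "\<exists>w'. Suc (length w') = length w \<and> w \<approx> w' \<and> chain u w' v"
proof -
  have "\<exists>a x y b. w = a @ [x, y] @ b \<and> (isl x = isl y \<or> in_C x \<or> in_C y)"
  proof (cases "successively (\<lambda>x y. isl x \<noteq> isl y) w")
    case False
    from not_successively[OF this] show ?thesis by blast
  next
    case True
    with assms(3) obtain x where "x \<in> set w" "in_C x" by (auto simp: reduced_def)
    then obtain a b where w: "w = a @ x # b" by (auto simp: in_set_conv_decomp)
    show ?thesis
    proof (cases b)
      case (Cons y b')
      with w \<open>in_C x\<close> show ?thesis by (intro exI[of _ a] exI[of _ x] exI[of _ y] exI[of _ b']) simp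
    next
      case Nil
      with w assms(2) obtain a' y where "a = a' @ [y]" by (cases a rule: rev_cases) auto
      with w Nil \<open>in_C x\<close> show ?thesis by (intro exI[of _ a'] exI[of _ y] exI[of _ x] exI[of _ "[]"]) simp
    qed
  qed
  then obtain a x y b where w: "w = a @ [x, y] @ b" and xy: "isl x = isl y \<or> in_C x \<or> in_C y" by blast
  from assms(1) obtain s t where ch: "chain u a s" "chain s [x, y] t" "chain t b v"
    unfolding w chain_append by blast
  from merge[OF xy ch(2)] obtain z where z: "[x, y] \<approx> [z]" "chain s [z] t" by blast
  have "a \<approx> a" "b \<approx> b" using chain_lists ch by (blast intro: amalg_eq.refl)+
  then have "w \<approx> a @ [z] @ b" unfolding w by (intro amalg_eq.append z)
  moreover have "chain u (a @ [z] @ b) v" unfolding chain_append using ch z by blast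
  ultimately show ?thesis using w by (intro exI[of _ "a @ [z] @ b"]) simp
qed

text \<open>
  A word with a value in \<open>C\<close> is not reduced, so it can be shortened along the path until one syllable is
  left; by the normal form theorem, that syllable is itself from \<open>C\<close>.
\<close>

theorem chain_collapse:
  assumes "chain u w v" "w \<noteq> []" "w \<approx> [Inl (\<phi> c)]" "c \<in> carrier C"
  shows "RG u (\<phi> c) v"
  using assms
proof (induction "length w" arbitrary: w rule: less_induct)
  case less
  have red: "\<not> reduced w" using reduced_not_amalgamated less.prems by blast
  show ?case
  proof (cases "length w \<ge> 2")
    case True
    from shorten[OF less.prems(1) True red] obtain w'
      where w': "Suc (length w') = length w" "w \<approx> w'" "chain u w' v" by blast
    show ?thesis
    proof (rule less.hyps[OF _ w'(3)])
      show "w' \<noteq> []" using w'(1) True by auto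
      show "w' \<approx> [Inl (\<phi> c)]" using amalg_eq.trans[OF amalg_eq.sym[OF w'(2)] less.prems(3)] .
    qed (use w' less.prems in auto)
  next
    case False
    then have "length w = Suc 0" using less.prems(2) length_greater_0_conv[of w] by linarith
    then obtain x where w: "w = [x]" by (auto simp: length_Suc_conv)
    with red obtain d where d: "d \<in> carrier C" "x = Inl (\<phi> d) \<or> x = Inr (\<psi> d)"
      by (auto simp: reduced_def in_C_def)
    have "[Inl (\<phi> d)] \<approx> [Inl (\<phi> c)]"
      using d(2)
    proof
      assume "x = Inl (\<phi> d)"
      with less.prems(3) show ?thesis by (simp add: w)
    next
      assume "x = Inr (\<psi> d)"
      with less.prems(3) amalg_eq.trans[OF amalg_eq.amalg[OF d(1)]] show ?thesis by (simp add: w)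
    qed
    then have "d = c" using amalgamated_inj d less.prems(4) by blast
    with d less.prems(1) show ?thesis unfolding w by (auto simp: switch)
  qed
qed

end

section \<open>Coded graphs\<close>

text \<open>An edge is coded as \<open>(u, c, v)\<close>, with \<open>c\<close> the number of its label; a graph with \<open>n\<close> vertices,
  source \<open>s\<close> and target \<open>t\<close> is coded as \<open>(n, s, t)\<close> followed by its edges.\<close>

type_synonym triple = "nat \<times> nat \<times> nat"

text \<open>
  The inverse of \<^const>\<open>label_code\<close>.
\<close>

definition code_label :: "nat \<Rightarrow> letter option" where
  "code_label c = (if c = 0 then None else Some ((c - 1) div 2, odd c))"

lemma code_label_code [simp]: "code_label (label_code l) = l"
  by (cases l rule: label_code.cases) (auto simp: code_label_def)

lemma label_code_label [simp]: "label_code (code_label c) = c"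
  by (cases "even c") (auto simp: code_label_def elim!: evenE oddE)

lemma code_label_le: "(\<forall>i b. code_label c = Some (i, b) \<longrightarrow> i < k) \<longleftrightarrow> c \<le> 2 * k"
  by (auto simp: code_label_def)

definition code_value :: "('a, 'm) monoid_scheme \<Rightarrow> 'a list \<Rightarrow> nat \<Rightarrow> 'a" where
  "code_value G xs c = (case code_label c of None \<Rightarrow> \<one>\<^bsub>G\<^esub> | Some l \<Rightarrow> letter_value G xs l)"

lemma code_value_simps [simp]:
  "code_value G xs 0 = \<one>\<^bsub>G\<^esub>"
  "code_value G xs (Suc (2 * i)) = xs ! i"
  "code_value G xs (Suc (Suc (2 * i))) = inv\<^bsub>G\<^esub> (xs ! i)"
  by (auto simp: code_value_def code_label_def)

lemma code_cases:
  obtains "c = 0" | i where "c = Suc (2 * i)" | i where "c = Suc (Suc (2 * i))"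
proof (cases c)
  case (Suc d)
  then show ?thesis using that by (cases "even d") (auto elim!: evenE oddE)
qed (use that in auto)

lemma code_value_closed:
  assumes "group G" "set xs \<subseteq> carrier G" "c \<le> 2 * length xs"
  shows "code_value G xs c \<in> carrier G"
proof -
  interpret group G by fact
  have "xs ! i \<in> carrier G" if "i < length xs" for i using assms(2) that nth_mem by blast
  with assms(3) show ?thesis by (cases c rule: code_cases) auto
qed

definition arcs :: "triple set \<Rightarrow> (nat \<times> nat) set" where
  "arcs E = {(u, v). \<exists>c. (u, c, v) \<in> E}"

lemma arcs_Un [simp]: "arcs (E \<union> F) = arcs E \<union> arcs F"
  and arcs_empty [simp]: "arcs {} = {}"
  and arcs_insert [simp]: "arcs (insert (u, c, v) E) = insert (u, v) (arcs E)"
  by (auto simp: arcs_def)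

lemma arcsI: "(u, c, v) \<in> E \<Longrightarrow> (u, v) \<in> arcs E"
  by (auto simp: arcs_def)

lemma arcs_mono: "E \<subseteq> F \<Longrightarrow> arcs E \<subseteq> arcs F"
  by (auto simp: arcs_def)

definition valid :: "nat \<Rightarrow> nat \<Rightarrow> nat \<Rightarrow> nat \<Rightarrow> triple set \<Rightarrow> bool" where
  "valid k n s t E \<longleftrightarrow> s < n \<and> t < n \<and> (\<forall>(u, c, v) \<in> E. u < n \<and> v < n \<and> c \<le> 2 * k) \<and> acyclic (arcs E)"

inductive path :: "('a, 'm) monoid_scheme \<Rightarrow> (nat \<Rightarrow> 'a) \<Rightarrow> triple set \<Rightarrow> nat \<Rightarrow> 'a \<Rightarrow> nat \<Rightarrow> bool"
  for M f E where
  refl: "path M f E u \<one>\<^bsub>M\<^esub> u"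
| step: "\<lbrakk>(u, c, v) \<in> E; path M f E v x w\<rbrakk> \<Longrightarrow> path M f E u (f c \<otimes>\<^bsub>M\<^esub> x) w"

lemma path_mono: "path M f E u x v \<Longrightarrow> E \<subseteq> F \<Longrightarrow> path M f F u x v"
  by (induction rule: path.induct) (auto intro: path.intros)

lemma path_closed:
  "path M f E u x v \<Longrightarrow> monoid M \<Longrightarrow> (\<And>u c v. (u, c, v) \<in> E \<Longrightarrow> f c \<in> carrier M) \<Longrightarrow> x \<in> carrier M"
  by (induction rule: path.induct) (auto intro: monoid.m_closed)

lemma path_trans:
  assumes "path M f E u x v" "path M f E v y w" "monoid M" "\<And>u c v. (u, c, v) \<in> E \<Longrightarrow> f c \<in> carrier M"
  shows "path M f E u (x \<otimes>\<^bsub>M\<^esub> y) w"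
  using assms(1,2)
proof (induction arbitrary: y rule: path.induct)
  case (refl u)
  then show ?case using path_closed[OF refl assms(3,4)] by (simp add: monoid.l_one[OF assms(3)])
next
  case (step u c v x w)
  have "x \<in> carrier M" "y \<in> carrier M" "f c \<in> carrier M"
    using path_closed[OF step.hyps(2) assms(3,4)] path_closed[OF step.prems assms(3,4)] assms(4)[OF step.hyps(1)] by auto
  then show ?case
    using path.step[OF step.hyps(1) step.IH[OF step.prems]] by (simp add: monoid.m_assoc[OF assms(3)])
qed

lemma path_edge:
  assumes "(u, c, v) \<in> E" "monoid M" "f c \<in> carrier M"
  shows "path M f E u (f c) v"
  using path.step[OF assms(1) path.refl, of M f] assms by (simp add: monoid.r_one)

lemma path_arcs: "path M f E u x v \<Longrightarrow> (u, v) \<in> (arcs E)\<^sup>*"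
  by (induction rule: path.induct) (auto intro: converse_rtrancl_into_rtrancl arcsI)

lemma path_loop:
  assumes "path M f E u x u" "acyclic (arcs E)" shows "x = \<one>\<^bsub>M\<^esub>"
  using assms(1)
proof cases
  case (step c v y)
  then have "(u, u) \<in> (arcs E)\<^sup>+"
    using path_arcs[OF step(3)] arcsI[OF step(2)] by (meson rtrancl_into_trancl2)
  with assms(2) show ?thesis by (auto simp: acyclic_def)
qed auto

lemma path_range:
  assumes "path M f E u x v" "u \<noteq> v" "\<And>u c v. (u, c, v) \<in> E \<Longrightarrow> u < n \<and> v < n"
  shows "u < n \<and> v < n"
  using assms(1,2)
proof (induction rule: path.induct)
  case (step u c v x w)
  with assms(3)[OF step.hyps(1)] show ?case by (cases "v = w") auto
qed simp

definition encode_triples :: "triple list \<Rightarrow> bool list" where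
  "encode_triples ts = encode_nats (concat (map (\<lambda>(a, b, c). [a, b, c]) ts))"

definition triple_graph :: "nat \<Rightarrow> nat \<Rightarrow> nat \<Rightarrow> triple list \<Rightarrow> graph" where
  "triple_graph n s t es = \<lparr>num_verts = n, edges = map (\<lambda>(u, c, v). (u, code_label c, v)) es, source = s, target = t\<rparr>"

lemma encode_triple_graph: "encode_graph (triple_graph n s t es) = encode_triples ((n, s, t) # es)"
proof -
  have "concat (map (\<lambda>(u, l, v). [u, label_code l, v]) (map (\<lambda>(u, c, v). (u, code_label c, v)) es)) =
      concat (map (\<lambda>(a, b, c). [a, b, c]) es)"
    by (induction es) auto
  then show ?thesis by (simp add: encode_graph_def encode_triples_def triple_graph_def)
qed

lemma graph_is_triple_graph: "\<exists>n s t es. \<Gamma> = triple_graph n s t es"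
proof (cases \<Gamma>)
  case (fields n es s t)
  have "es = map (\<lambda>(u, c, v). (u, code_label c, v)) (map (\<lambda>(u, l, v). (u, label_code l, v)) es)"
    by (induction es) auto
  with fields have "\<Gamma> = triple_graph n s t (map (\<lambda>(u, l, v). (u, label_code l, v)) es)"
    by (simp add: triple_graph_def)
  then show ?thesis by blast
qed

lemma acyclic_triple_graph: "acyclic_graph k (triple_graph n s t es) \<longleftrightarrow> valid k n s t (set es)"
proof -
  have "edge_rel (triple_graph n s t es) = arcs (set es)"
    by (force simp: edge_rel_def arcs_def triple_graph_def)
  then show ?thesis
    by (auto simp: acyclic_graph_def valid_def triple_graph_def code_label_le[symmetric] split_beta)
qed

lemma word_value_Cons: "word_value G xs (label_word l @ w) =
    (case l of None \<Rightarrow> word_value G xs w | Some a \<Rightarrow> letter_value G xs a \<otimes>\<^bsub>G\<^esub> word_value G xs w)"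
  by (auto simp: word_value_def label_word_def split: option.split)

lemma labelled_path_iff:
  assumes "monoid G" "valid (length xs) n s t (set es)" "u < n"
    and val: "\<And>c. c \<le> 2 * length xs \<Longrightarrow> code_value G xs c \<in> carrier G"
  shows "(\<exists>w. labelled_path (triple_graph n s t es) u w v \<and> word_value G xs w = x) \<longleftrightarrow>
    path G (code_value G xs) (set es) u x v"
proof -
  let ?\<Gamma> = "triple_graph n s t es"
  have closed: "code_value G xs c \<in> carrier G" if "(u, c, v) \<in> set es" for u c v
    using that val assms(2) by (fastforce simp: valid_def)
  have 1: "path G (code_value G xs) (set es) u (word_value G xs w) v" if "labelled_path ?\<Gamma> u w v" for u w v
    using that
  proof (induction rule: labelled_path.induct)
    case (Nil u)
    then show ?case by (simp add: word_value_def path.refl)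
  next
    case (Cons u l v w z)
    then have e: "(u, label_code l, v) \<in> set es" by (auto simp: triple_graph_def)
    have "word_value G xs w \<in> carrier G"
      by (rule path_closed[OF Cons.IH assms(1) closed])
    moreover have "code_value G xs (label_code l) = (case l of None \<Rightarrow> \<one>\<^bsub>G\<^esub> | Some a \<Rightarrow> letter_value G xs a)"
      by (simp add: code_value_def)
    ultimately show ?case using path.step[OF e Cons.IH]
      by (auto simp: word_value_Cons monoid.l_one[OF assms(1)] split: option.splits)
  qed
  have 2: "\<exists>w. labelled_path ?\<Gamma> u w v \<and> word_value G xs w = x" if "path G (code_value G xs) (set es) u x v" "u < n" for u x v
    using that
  proof (induction rule: path.induct)
    case (refl u)
    then show ?case
      by (intro exI[of _ "[]"]) (auto simp: word_value_def triple_graph_def intro: labelled_path.Nil)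
  next
    case (step u c v x w)
    have "v < n" using step assms(2) by (auto simp: valid_def)
    with step obtain w' where w': "labelled_path ?\<Gamma> v w' w" "word_value G xs w' = x" by auto
    have e: "(u, code_label c, v) \<in> set (edges ?\<Gamma>)" using step by (force simp: triple_graph_def)
    have "x \<in> carrier G"
      by (rule path_closed[OF step.hyps(2) assms(1) closed])
    then show ?case using labelled_path.Cons[OF e w'(1)] w'(2)
      by (intro exI[of _ "label_word (code_label c) @ w'"])
        (auto simp: word_value_Cons code_value_def monoid.l_one[OF assms(1)] split: option.split)
  qed
  show ?thesis using 1 2 assms(3) by auto
qed

theorem AGWP_iff:
  assumes "group G" "set xs \<subseteq> carrier G"
  shows "encode_triples ((n, s, t) # es) \<in> AGWP G xs \<longleftrightarrow>
    valid (length xs) n s t (set es) \<and> path G (code_value G xs) (set es) s \<one>\<^bsub>G\<^esub> t"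
proof -
  let ?\<Gamma> = "triple_graph n s t es"
  have "encode_triples ((n, s, t) # es) \<in> AGWP G xs \<longleftrightarrow> acyclic_graph (length xs) ?\<Gamma> \<and>
     (\<exists>w. labelled_path ?\<Gamma> (source ?\<Gamma>) w (target ?\<Gamma>) \<and> word_value G xs w = \<one>\<^bsub>G\<^esub>)"
    unfolding AGWP_def encode_triple_graph[symmetric] by (simp add: inj_image_mem_iff[OF inj_encode_graph])
  also have "\<dots> \<longleftrightarrow> valid (length xs) n s t (set es) \<and> path G (code_value G xs) (set es) s \<one>\<^bsub>G\<^esub> t"
    using labelled_path_iff[OF group.is_monoid[OF assms(1)], of xs n s t es s t "\<one>\<^bsub>G\<^esub>"] code_value_closed[OF assms]
    by (auto simp: acyclic_triple_graph) (auto simp: triple_graph_def valid_def)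
  finally show ?thesis .
qed

lemma AGWP_encode_triples:
  assumes "w \<in> AGWP G xs" shows "\<exists>h es. w = encode_triples (h # es)"
proof -
  obtain \<Gamma> where "w = encode_graph \<Gamma>" using assms by (auto simp: AGWP_def)
  then show ?thesis using graph_is_triple_graph[of \<Gamma>] encode_triple_graph by metis
qed

subsection \<open>Reading and writing graphs in polynomial time\<close>

text \<open>
  The state consists of the number being read, the numbers of the unfinished triple in reverse order,
  and the finished triples in reverse order.
\<close>

definition parse_step :: "bool \<Rightarrow> nat \<times> nat list \<times> triple list \<Rightarrow> nat \<times> nat list \<times> triple list" where
  "parse_step b st = (if b then (Suc (fst st), snd st)
     else (case fst (snd st) of [] \<Rightarrow> (0, [fst st], snd (snd st))
       | y # ys \<Rightarrow> (case ys of [] \<Rightarrow> (0, [fst st, y], snd (snd st))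
          | x # _ \<Rightarrow> (0, [], (x, y, fst st) # snd (snd st)))))"

definition parse :: "bool list \<Rightarrow> triple list" where
  "parse w = rev (snd (snd (fold parse_step w (0, [], []))))"

lemma parse_encode: "parse (encode_triples ts) = ts"
proof -
  have T: "fold parse_step (replicate k True) (m, st) = (m + k, st)" for k m st
    by (induction k arbitrary: m) (auto simp: parse_step_def)
  have F: "parse_step False (m, [], acc) = (0, [m], acc)" "parse_step False (m, [y], acc) = (0, [m, y], acc)"
    "parse_step False (m, [y, x], acc) = (0, [], (x, y, m) # acc)" for m y x acc
    by (simp_all add: parse_step_def)
  have "fold parse_step (encode_triples ts) (0, [], acc) = (0, [], rev ts @ acc)" for acc
  proof (induction ts arbitrary: acc)
    case Nil
    then show ?case by (simp add: encode_triples_def)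
  next
    case (Cons t ts)
    obtain a b c where t: "t = (a, b, c)" by (cases t)
    have "encode_triples (t # ts) = replicate a True @ [False] @ replicate b True @ [False] @ replicate c True @ [False] @ encode_triples ts"
      by (simp add: encode_triples_def t)
    with Cons show ?case by (simp add: T F t del: fold_replicate)
  qed
  then show ?thesis by (simp add: parse_def)
qed

lemma pt_parse: "pt parse"
  unfolding parse_def
proof (rule pt_rev, rule pt_snd, rule pt_snd, rule pt_fold[where q = "\<lambda>_. 10"])
  show "sz (parse_step a s) \<le> sz s + 10" for a s
  proof (cases s)
    case (fields m ys acc)
    then show ?thesis by (cases ys; cases "tl ys") (auto simp: parse_step_def)
  qed
  show "pt (\<lambda>p. parse_step (fst (snd p)) (snd (snd p)))"
    unfolding parse_step_def by (intro pt_intros)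
qed (intro pt_intros poly_bounded_const)+

lemma pt_encode_triples:
  assumes "pt f" shows "pt (\<lambda>x. encode_triples (f x))"
proof -
  have "encode_triples ts = concat (map (\<lambda>t. replicate (fst t) True @ False #
      replicate (fst (snd t)) True @ False # replicate (snd (snd t)) True @ [False]) ts)" for ts
    by (induction ts) (auto simp: encode_triples_def)
  then show ?thesis by simp (intro pt_intros assms)
qed

definition query :: "bool list set \<Rightarrow> triple \<Rightarrow> triple list \<Rightarrow> bool" where
  "query A h es \<longleftrightarrow> encode_triples (h # es) \<in> A"

lemma pt_query:
  assumes "A \<in> PTIME" "pt h" "pt es" shows "pt (\<lambda>x. query A (h x) (es x))"
  unfolding query_def by (intro pt_decide[OF assms(1)] pt_encode_triples pt_intros assms)

text \<open>
  Every string is parsed to some list of triples, and a string is a code exactly if encoding that list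
  again gives it back.  So a decision procedure needs to be correct on coded graphs only.
\<close>

lemma AGWP_in_PTIME_I:
  assumes "pt (\<lambda>p. D (fst p) (snd p))" "\<And>h es. query (AGWP G xs) h es \<longleftrightarrow> D h es"
  shows "AGWP G xs \<in> PTIME"
proof (rule PTIME_if_pt)
  have "w \<in> AGWP G xs \<longleftrightarrow> (case parse w of [] \<Rightarrow> False | h # es \<Rightarrow> D h es \<and> encode_triples (h # es) = w)" for w
  proof
    assume "w \<in> AGWP G xs"
    moreover from this obtain h es where "w = encode_triples (h # es)" using AGWP_encode_triples by blast
    ultimately show "case parse w of [] \<Rightarrow> False | h # es \<Rightarrow> D h es \<and> encode_triples (h # es) = w"
      using assms(2)[of h es] by (simp add: parse_encode query_def)
  next
    assume "case parse w of [] \<Rightarrow> False | h # es \<Rightarrow> D h es \<and> encode_triples (h # es) = w"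
    then show "w \<in> AGWP G xs"
      using assms(2) by (auto simp: query_def split: list.splits)
  qed
  moreover have "pt (\<lambda>p. D (fst (snd p)) (snd (snd p)))" 
    by (rule pt_compose[OF assms(1)]) (intro pt_intros)
  then have "pt (\<lambda>w. case parse w of [] \<Rightarrow> False | h # es \<Rightarrow> D h es \<and> encode_triples (h # es) = w)"
    by (intro pt_parse pt_encode_triples pt_intros)
  ultimately show "pt (\<lambda>w. w \<in> AGWP G xs)" by simp
qed

section \<open>Changing the generators\<close>

text \<open>
  With all labels empty, every path has value 1.  So a decider for any group, asked about the erased
  graph, tells whether the graph is acyclic with all vertices in range and joins source to target at all.
\<close>

definition erase :: "triple list \<Rightarrow> triple list" where
  "erase es = map (\<lambda>e. (fst e, 0, snd (snd e))) es"

lemma arcs_erase: "arcs (set (erase es)) = arcs (set es)"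
  by (force simp: arcs_def erase_def)

lemma valid_erase: "valid k n s t (set (erase es)) \<and> (\<forall>(u, c, v) \<in> set es. c \<le> 2 * k') \<longleftrightarrow> valid k' n s t (set es)"
  unfolding valid_def arcs_erase by (auto simp: erase_def)

lemma path_erase:
  "path M f (set es) s x t \<Longrightarrow> monoid N \<Longrightarrow> g 0 = \<one>\<^bsub>N\<^esub> \<Longrightarrow> path N g (set (erase es)) s \<one>\<^bsub>N\<^esub> t"
proof (induction rule: path.induct)
  case (step u c v x w)
  have "(u, 0, v) \<in> set (erase es)" using step.hyps(1) by (force simp: erase_def)
  from path.step[OF this step.IH[OF step.prems]] show ?case
    using step.prems by (simp add: monoid.l_one monoid.one_closed)
qed (auto intro: path.refl)

lemma pt_erase: "pt f \<Longrightarrow> pt (\<lambda>x. erase (f x))"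
  unfolding erase_def by (intro pt_intros)

lemma pt_codes_le: fixes f :: "'a::enc \<Rightarrow> triple list" shows "pt f \<Longrightarrow> pt (\<lambda>x. list_all (\<lambda>e. fst (snd e) \<le> k) (f x))"
proof -
  have "pt (\<lambda>p :: 'a \<times> triple. fst (snd (snd p)) \<le> k)"
    by (rule pt_table[where K = "Suc k" and f = "\<lambda>c. c \<le> k"]) (intro pt_intros | simp)+
  then show "pt f \<Longrightarrow> pt (\<lambda>x. list_all (\<lambda>e. fst (snd e) \<le> k) (f x))"
    by (rule pt_list_all[rotated])
qed

text \<open>
  A label \<open>c\<close> becomes the product of the labels \<open>d c\<close> and \<open>e c\<close>; the new vertex in the middle of edge number \<open>j\<close>
  is \<open>n + j\<close>.
\<close>

definition subdivide :: "(nat \<Rightarrow> nat) \<Rightarrow> (nat \<Rightarrow> nat) \<Rightarrow> nat \<Rightarrow> triple list \<Rightarrow> triple list" where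
  "subdivide d e n es = concat (map (\<lambda>p. [(fst (snd p), d (fst (snd (snd p))), n + fst p),
     (n + fst p, e (fst (snd (snd p))), snd (snd (snd p)))]) (zip [0..<length es] es))"

lemma set_subdivide:
  "set (subdivide d e n es) =
    (\<Union>j<length es. case es ! j of (u, c, v) \<Rightarrow> {(u, d c, n + j), (n + j, e c, v)})"
proof -
  have "zip [0..<length es] es = map (\<lambda>j. (j, es ! j)) [0..<length es]"
    by (rule nth_equalityI) auto
  then show ?thesis by (simp add: subdivide_def split_beta atLeast0LessThan)
qed

lemma subdivideE:
  assumes "(a, l, b) \<in> set (subdivide d e n es)"
  obtains (first) j u c v where "j < length es" "es ! j = (u, c, v)" "a = u" "l = d c" "b = n + j"
    | (second) j u c v where "j < length es" "es ! j = (u, c, v)" "a = n + j" "l = e c" "b = v"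
proof -
  obtain j where j: "j < length es" "(a, l, b) \<in> (case es ! j of (u, c, v) \<Rightarrow> {(u, d c, n + j), (n + j, e c, v)})"
    using assms[unfolded set_subdivide] by (elim UN_E) (rule that, simp_all only: lessThan_iff)
  obtain u c v where ej: "es ! j = (u, c, v)" by (cases "es ! j")
  from j(2) ej have "(a, l, b) = (u, d c, n + j) \<or> (a, l, b) = (n + j, e c, v)" by simp
  then show ?thesis 
  proof
    assume "(a, l, b) = (u, d c, n + j)"
    then have "a = u" "l = d c" "b = n + j" by simp_all
    then show ?thesis by (rule that(1)[OF j(1) ej])
  next
    assume "(a, l, b) = (n + j, e c, v)"
    then have "a = n + j" "l = e c" "b = v" by simp_all
    then show ?thesis by (rule that(2)[OF j(1) ej])
  qed
qed

lemma subdivide_mem: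
  assumes "j < length es" "es ! j = (u, c, v)"
  shows "(u, d c, n + j) \<in> set (subdivide d e n es)" "(n + j, e c, v) \<in> set (subdivide d e n es)"
  unfolding set_subdivide by (rule UN_I[of j]; simp add: assms)+

text \<open>
  Place an old vertex \<open>w\<close> at \<open>(w, 0)\<close> and the middle of an edge with source \<open>u\<close> at \<open>(u, 1)\<close>.  Both halves of an edge
  ascend lexicographically, with the arcs of the original graph as the order of the first component.
\<close>

lemma acyclic_subdivide:
  assumes "acyclic (arcs (set es))" "\<forall>(u, c, v) \<in> set es. u < n \<and> v < n"
  shows "acyclic (arcs (set (subdivide d e n es)))"
proof -
  let ?pos = "\<lambda>w. if w < n then (w, 0 :: nat) else (fst (es ! (w - n)), 1)"
  let ?R = "inv_image (arcs (set es) <*lex*> less_than) ?pos"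
  have "finite (arcs (set es))"
    by (rule finite_subset[of _ "(\<lambda>e. (fst e, snd (snd e))) ` set es"]) (force simp: arcs_def)+
  then have "wf (arcs (set es))" using assms(1) by (rule finite_acyclic_wf)
  then have "acyclic ?R" by (intro wf_acyclic wf_inv_image wf_lex_prod wf_less_than)
  moreover have "arcs (set (subdivide d e n es)) \<subseteq> ?R"
  proof (rule subrelI)
    fix a b assume "(a, b) \<in> arcs (set (subdivide d e n es))"
    then obtain l where "(a, l, b) \<in> set (subdivide d e n es)" by (auto simp: arcs_def)
    then show "(a, b) \<in> ?R"
    proof (cases rule: subdivideE)
      case (first j u c v)
      have "u < n" using assms(2) nth_mem[OF first(1)] first(2) by auto
      with first show ?thesis by simp
    next
      case (second j u c v)
      have "v < n" "(u, c, v) \<in> set es" using assms(2) nth_mem[OF second(1)] second(2) by auto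
      with second show ?thesis by (auto intro: arcsI)
    qed
  qed
  ultimately show ?thesis by (rule acyclic_subset)
qed

lemma valid_subdivide:
  assumes "valid k n s t (set es)" "\<And>c. c \<le> 2 * k \<Longrightarrow> d c \<le> 2 * k' \<and> e c \<le> 2 * k'"
  shows "valid k' (n + length es) s t (set (subdivide d e n es))"
proof -
  have "\<forall>(u, c, v) \<in> set es. u < n \<and> v < n" using assms(1) by (auto simp: valid_def)
  moreover have "a < n + length es \<and> b < n + length es \<and> l \<le> 2 * k'"
    if "(a, l, b) \<in> set (subdivide d e n es)" for a l b
    using that
  proof (cases rule: subdivideE)
    case (first j u c v)
    then show ?thesis using assms nth_mem[OF first(1)] by (auto simp: valid_def)
  next
    case (second j u c v)
    then show ?thesis using assms nth_mem[OF second(1)] by (auto simp: valid_def)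
  qed
  ultimately show ?thesis using assms(1) acyclic_subdivide[of es n d e] by (auto simp: valid_def)
qed

lemma path_subdivide:
  assumes M: "monoid M" and v: "\<forall>(u, c, v) \<in> set es. u < n \<and> v < n"
    and val: "\<And>u c v. (u, c, v) \<in> set es \<Longrightarrow> g (d c) \<in> carrier M \<and> g (e c) \<in> carrier M \<and> f c = g (d c) \<otimes>\<^bsub>M\<^esub> g (e c)"
    and "s < n" "t < n"
  shows "path M g (set (subdivide d e n es)) s x t \<longleftrightarrow> path M f (set es) s x t"
proof
  assume "path M f (set es) s x t"
  then show "path M g (set (subdivide d e n es)) s x t"
  proof (induction rule: path.induct)
    case (step u c v x w)
    from step.hyps(1) obtain j where j: "j < length es" "es ! j = (u, c, v)" by (auto simp: in_set_conv_nth)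
    have "x \<in> carrier M" by (rule path_closed[OF step.hyps(2) M]) (use val M in \<open>auto intro: monoid.m_closed\<close>)
    then have eq: "f c \<otimes>\<^bsub>M\<^esub> x = g (d c) \<otimes>\<^bsub>M\<^esub> (g (e c) \<otimes>\<^bsub>M\<^esub> x)"
      using val[OF step.hyps(1)] by (simp add: monoid.m_assoc[OF M])
    show ?case unfolding eq by (intro path.step[OF subdivide_mem(1)[OF j]] path.step[OF subdivide_mem(2)[OF j]] step.IH)
  qed (rule path.refl)
next
  \<comment> \<open>A path that starts in the middle of an edge first completes that edge.\<close>
  have "(s < n \<longrightarrow> path M f (set es) s x t) \<and> (\<forall>j u c v. j < length es \<longrightarrow> s = n + j \<longrightarrow> es ! j = (u, c, v) \<longrightarrow>
     (\<exists>y. x = g (e c) \<otimes>\<^bsub>M\<^esub> y \<and> path M f (set es) v y t))"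
    if "path M g (set (subdivide d e n es)) s x t" "t < n" for s x t
    using that
  proof (induction rule: path.induct)
    case (refl u)
    then show ?case by (auto intro: path.refl)
  next
    case (step a l b x w)
    from step.hyps(1) show ?case
    proof (cases rule: subdivideE)
      case (first j u c v)
      have e: "(u, c, v) \<in> set es" using first nth_mem by metis
      then have "u < n" using v by auto
      obtain y where y: "x = g (e c) \<otimes>\<^bsub>M\<^esub> y" "path M f (set es) v y w"
        using step.IH[OF step.prems] first by blast
      have "y \<in> carrier M" by (rule path_closed[OF y(2) M]) (use val M in \<open>auto intro: monoid.m_closed\<close>)
      then have "g (d c) \<otimes>\<^bsub>M\<^esub> x = f c \<otimes>\<^bsub>M\<^esub> y"
        using val[OF e] y(1) by (simp add: monoid.m_assoc[OF M])
      with path.step[OF e y(2)] \<open>u < n\<close> first show ?thesis by simp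
    next
      case (second j u c v)
      have "v < n" using v nth_mem[OF second(1)] second(2) by auto
      with step.IH[OF step.prems] second show ?thesis by auto
    qed
  qed
  then show "path M f (set es) s x t" if "path M g (set (subdivide d e n es)) s x t"
    using that assms(4,5) by blast
qed

lemma pt_subdivide:
  fixes n :: "'x::enc \<Rightarrow> nat"
  assumes "pt n" "pt es" "pt d" "pt e"
  shows "pt (\<lambda>x. subdivide d e (n x) (es x))"
proof -
  have "pt (\<lambda>p :: 'x \<times> nat \<times> triple. n (fst p))"
    by (rule pt_compose[OF assms(1)]) (intro pt_intros)
  note this [pt_intros]
  have "pt (\<lambda>p :: 'x \<times> nat \<times> triple. d (fst (snd (snd (snd p)))))"
    by (rule pt_compose[OF assms(3)]) (intro pt_intros)
  note this [pt_intros]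
  have "pt (\<lambda>p :: 'x \<times> nat \<times> triple. e (fst (snd (snd (snd p)))))"
    by (rule pt_compose[OF assms(4)]) (intro pt_intros)
  note this [pt_intros]
  show ?thesis unfolding subdivide_def by (intro pt_intros assms(2))
qed

text \<open>
  The values of single edges: generators, their inverses, and the neutral element.
\<close>

definition letters :: "('a, 'm) monoid_scheme \<Rightarrow> 'a list \<Rightarrow> 'a set" where
  "letters G xs = insert \<one>\<^bsub>G\<^esub> (set xs \<union> (\<lambda>x. inv\<^bsub>G\<^esub> x) ` set xs)"

lemma letters_eq: "letters G xs = code_value G xs ` {..2 * length xs}"
proof
  show "letters G xs \<subseteq> code_value G xs ` {..2 * length xs}"
  proof
    fix x assume "x \<in> letters G xs"
    then consider "x = \<one>\<^bsub>G\<^esub>" | i where "i < length xs" "x = xs ! i" | i where "i < length xs" "x = inv\<^bsub>G\<^esub> (xs ! i)"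
      by (auto simp: letters_def in_set_conv_nth)
    then show "x \<in> code_value G xs ` {..2 * length xs}"
    proof cases
      case 1
      then show ?thesis by (intro image_eqI[of _ _ 0]) auto
    next
      case (2 i)
      then show ?thesis by (intro image_eqI[of _ _ "Suc (2 * i)"]) auto
    next
      case (3 i)
      then show ?thesis by (intro image_eqI[of _ _ "Suc (Suc (2 * i))"]) auto
    qed
  qed
  show "code_value G xs ` {..2 * length xs} \<subseteq> letters G xs"
  proof
    fix x assume "x \<in> code_value G xs ` {..2 * length xs}"
    then obtain c where c: "c \<le> 2 * length xs" "x = code_value G xs c" by auto
    then show "x \<in> letters G xs"
      by (cases c rule: code_cases) (auto simp: letters_def)
  qed
qed

lemma letters_inv: "group G \<Longrightarrow> set xs \<subseteq> carrier G \<Longrightarrow> x \<in> letters G xs \<Longrightarrow> inv\<^bsub>G\<^esub> x \<in> letters G xs"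
  by (auto simp: letters_def group.inv_inv subset_iff group.is_monoid monoid.inv_one)

lemma letters_closed: "group G \<Longrightarrow> set xs \<subseteq> carrier G \<Longrightarrow> letters G xs \<subseteq> carrier G"
  by (auto simp: letters_def group.is_monoid monoid.one_closed group.inv_closed)

text \<open>
  Subdividing all edges translates one problem into the other.  The first query, with erased labels,
  guarantees that the original graph is acyclic and that its vertices are in range; the subdivided
  graph alone would admit edges of the original graph that end in one of the new vertices.
\<close>

lemma AGWP_PTIME_products:
  assumes G: "group G" and xs: "set xs \<subseteq> carrier G" and ys: "set ys \<subseteq> carrier G"
    and P: "AGWP G xs \<in> PTIME"
    and prod: "\<And>y. y \<in> set ys \<Longrightarrow> \<exists>a\<in>letters G xs. \<exists>b\<in>letters G xs. y = a \<otimes>\<^bsub>G\<^esub> b"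
  shows "AGWP G ys \<in> PTIME"
proof -
  interpret group G by (rule G)
  let ?f = "code_value G ys" and ?g = "code_value G xs" and ?k = "length xs" and ?l = "length ys"
  have "\<exists>a\<in>letters G xs. \<exists>b\<in>letters G xs. y = a \<otimes>\<^bsub>G\<^esub> b" if y: "y \<in> letters G ys" for y
  proof -
    from y consider "y = \<one>\<^bsub>G\<^esub>" | "y \<in> set ys" | z where "z \<in> set ys" "y = inv\<^bsub>G\<^esub> z"
      by (auto simp: letters_def)
    then show ?thesis
    proof cases
      case 1
      then show ?thesis by (intro bexI[of _ "\<one>\<^bsub>G\<^esub>"]) (auto simp: letters_def)
    next
      case 2
      then show ?thesis by (rule prod)
    next
      case (3 z)
      then obtain a b where ab: "a \<in> letters G xs" "b \<in> letters G xs" "z = a \<otimes>\<^bsub>G\<^esub> b" using prod by blast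
      then have "y = inv\<^bsub>G\<^esub> b \<otimes>\<^bsub>G\<^esub> inv\<^bsub>G\<^esub> a"
        using 3 letters_closed[OF G xs] by (auto intro: inv_mult_group)
      with ab letters_inv[OF G xs] show ?thesis by blast
    qed
  qed
  then have "\<forall>c\<in>{..2 * ?l}. \<exists>a b. a \<le> 2 * ?k \<and> b \<le> 2 * ?k \<and> ?f c = ?g a \<otimes>\<^bsub>G\<^esub> ?g b"
    unfolding letters_eq by blast
  then obtain d0 e0 where de: "\<And>c. c \<le> 2 * ?l \<Longrightarrow> d0 c \<le> 2 * ?k \<and> e0 c \<le> 2 * ?k \<and> ?f c = ?g (d0 c) \<otimes>\<^bsub>G\<^esub> ?g (e0 c)"
    by (metis atMost_iff)
  define d where "d c = (if c \<le> 2 * ?l then d0 c else 0)" for c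
  define e where "e c = (if c \<le> 2 * ?l then e0 c else 0)" for c
  have d: "c \<le> 2 * ?l \<Longrightarrow> d c \<le> 2 * ?k \<and> e c \<le> 2 * ?k \<and> ?f c = ?g (d c) \<otimes>\<^bsub>G\<^esub> ?g (e c)" for c
    using de by (simp add: d_def e_def)
  let ?D = "\<lambda>h es. list_all (\<lambda>e. fst (snd e) \<le> 2 * ?l) es \<and> query (AGWP G xs) h (erase es) \<and>
     query (AGWP G xs) (fst h + length es, snd h) (subdivide d e (fst h) es)"
  show ?thesis
  proof (rule AGWP_in_PTIME_I)
    show "pt (\<lambda>p. ?D (fst p) (snd p))"
    proof (intro pt_conj pt_codes_le pt_query[OF P] pt_erase pt_subdivide pt_intros)
      show "pt d" "pt e"
        by (rule pt_table[OF pt_id, where K = "Suc (2 * ?l)"]; simp add: d_def e_def)+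
    qed
    fix h :: triple and es
    obtain n s t where h: "h = (n, s, t)" by (cases h)
    have sub: "path G ?g (set (subdivide d e n es)) s x t \<longleftrightarrow> path G ?f (set es) s x t" if "valid ?l n s t (set es)" for x
    proof (rule path_subdivide)
      show "?g (d c) \<in> carrier G \<and> ?g (e c) \<in> carrier G \<and> ?f c = ?g (d c) \<otimes>\<^bsub>G\<^esub> ?g (e c)"
        if "(u, c, v) \<in> set es" for u c v
        using d[of c] \<open>valid ?l n s t (set es)\<close> that code_value_closed[OF G xs] by (auto simp: valid_def)
    qed (use that in \<open>auto simp: valid_def is_monoid\<close>)
    have codes: "list_all (\<lambda>e. fst (snd e) \<le> 2 * ?l) es \<longleftrightarrow> (\<forall>(u, c, v) \<in> set es. c \<le> 2 * ?l)"
      by (auto simp: list_all_iff)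
    show "query (AGWP G ys) h es \<longleftrightarrow> ?D h es"
    proof
      assume "query (AGWP G ys) h es"
      then have 1: "valid ?l n s t (set es)" "path G ?f (set es) s \<one>\<^bsub>G\<^esub> t"
        by (auto simp: query_def h AGWP_iff[OF G ys])
      have "valid ?k (n + length es) s t (set (subdivide d e n es))"
        by (rule valid_subdivide[OF 1(1)]) (use d in auto)
      moreover have "valid ?k n s t (set (erase es)) \<and> (\<forall>(u, c, v) \<in> set es. c \<le> 2 * ?l)"
        using valid_erase 1(1) by blast
      moreover have "path G ?g (set (erase es)) s \<one>\<^bsub>G\<^esub> t"
        by (rule path_erase[OF 1(2) is_monoid]) simp
      ultimately show "?D h es"
        using sub[OF 1(1)] 1(2) by (simp add: query_def h AGWP_iff[OF G xs] codes)
    next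
      assume D: "?D h es"
      then have "valid ?k n s t (set (erase es))" "\<forall>(u, c, v) \<in> set es. c \<le> 2 * ?l"
        by (auto simp only: query_def h AGWP_iff[OF G xs] codes)
      then have 1: "valid ?l n s t (set es)" using valid_erase by blast
      with D sub[OF 1] show "query (AGWP G ys) h es"
        by (simp add: query_def h AGWP_iff[OF G xs] AGWP_iff[OF G ys])
    qed
  qed
qed

text \<open>
  A product of many generators is reached by adding its partial products as generators one at a time,
  each a product of two letters over the previous list.
\<close>

lemma AGWP_PTIME_add_element:
  assumes G: "group G" and a: "a \<in> generate G (set zs)" and zs: "set zs \<subseteq> carrier G"
    and xs: "set zs \<subseteq> set xs" "set xs \<subseteq> carrier G" "AGWP G xs \<in> PTIME"
  shows "\<exists>ys. insert a (set xs) \<subseteq> set ys \<and> set ys \<subseteq> carrier G \<and> AGWP G ys \<in> PTIME"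
proof -
  interpret group G by (rule G)
  have add: "\<exists>ys. insert x (set xs) \<subseteq> set ys \<and> set ys \<subseteq> carrier G \<and> AGWP G ys \<in> PTIME"
    if xs: "set xs \<subseteq> carrier G" "AGWP G xs \<in> PTIME"
      and x: "x = b \<otimes>\<^bsub>G\<^esub> c" "b \<in> letters G xs" "c \<in> letters G xs" for x b c xs
  proof -
    have bc: "b \<in> carrier G" "c \<in> carrier G" using letters_closed[OF G xs(1)] x by auto
    have "\<exists>a\<in>letters G xs. \<exists>b\<in>letters G xs. y = a \<otimes>\<^bsub>G\<^esub> b" if "y \<in> set (x # xs)" for y
    proof (cases "y = x")
      case False
      with that xs(1) show ?thesis
        by (intro bexI[of _ y] bexI[of _ "\<one>\<^bsub>G\<^esub>"]) (auto simp: letters_def)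
    qed (use x in blast)
    then have "AGWP G (x # xs) \<in> PTIME"
      by (intro AGWP_PTIME_products[OF G xs(1) _ xs(2)]) (use xs x bc in auto)
    then show ?thesis using xs x bc by (intro exI[of _ "x # xs"]) auto
  qed
  from a xs show ?thesis
  proof (induction arbitrary: xs rule: generate.induct)
    case one
    show ?case by (rule add[OF one(2,3), of _ "\<one>\<^bsub>G\<^esub>" "\<one>\<^bsub>G\<^esub>"]) (auto simp: letters_def)
  next
    case (incl h)
    then show ?case by (intro exI[of _ xs]) auto
  next
    case (inv h)
    then show ?case
      by (intro add[OF inv.prems(2,3), of _ "inv\<^bsub>G\<^esub> h" "\<one>\<^bsub>G\<^esub>"]) (auto simp: letters_def)
  next
    case (eng h1 h2)
    from eng.IH(1)[OF eng.prems] obtain ys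
      where ys: "insert h1 (set xs) \<subseteq> set ys" "set ys \<subseteq> carrier G" "AGWP G ys \<in> PTIME" by blast
    from eng.IH(2)[of ys] ys eng.prems(1) obtain ys'
      where ys': "insert h2 (set ys) \<subseteq> set ys'" "set ys' \<subseteq> carrier G" "AGWP G ys' \<in> PTIME" by blast
    from add[OF ys'(2,3), of "h1 \<otimes>\<^bsub>G\<^esub> h2" h1 h2] ys ys'
    show ?case by (auto simp: letters_def) (meson order_trans insert_subset subset_iff)
  qed
qed

theorem AGWP_PTIME_change_generators:
  assumes G: "group G" and xs: "generating_list G xs" "AGWP G xs \<in> PTIME" and ys: "set ys \<subseteq> carrier G"
  shows "AGWP G ys \<in> PTIME"
proof -
  interpret group G by (rule G)
  have xs': "set xs \<subseteq> carrier G" "generate G (set xs) = carrier G"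
    using xs(1) by (auto simp: generating_list_def)
  have "\<exists>zs. set xs \<union> set ys \<subseteq> set zs \<and> set zs \<subseteq> carrier G \<and> AGWP G zs \<in> PTIME"
    using ys
  proof (induction ys)
    case Nil
    then show ?case using xs xs' by auto
  next
    case (Cons y ys)
    then obtain zs where zs: "set xs \<union> set ys \<subseteq> set zs" "set zs \<subseteq> carrier G" "AGWP G zs \<in> PTIME" by auto
    have "y \<in> generate G (set xs)" using Cons.prems xs'(2) by auto
    from AGWP_PTIME_add_element[OF G this xs'(1) _ zs(2,3)] zs(1) show ?case by auto
  qed
  then obtain zs where zs: "set xs \<union> set ys \<subseteq> set zs" "set zs \<subseteq> carrier G" "AGWP G zs \<in> PTIME" by blast
  show ?thesis
  proof (rule AGWP_PTIME_products[OF G zs(2) ys zs(3)])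
    fix y assume "y \<in> set ys"
    with zs(1,2) show "\<exists>a\<in>letters G zs. \<exists>b\<in>letters G zs. y = a \<otimes>\<^bsub>G\<^esub> b"
      by (intro bexI[of _ y] bexI[of _ "\<one>\<^bsub>G\<^esub>"]) (auto simp: letters_def)
  qed
qed

section \<open>Saturation of a graph over an amalgamated product\<close>

text \<open>
  The iterates form an increasing chain of sublists of \<open>U\<close>.  Each proper inclusion makes them longer, so
  there are at most \<open>length U\<close> of them, and a chain that stops once stops forever.
\<close>

lemma filter_iteration_fixpoint:
  fixes P :: "'x list \<Rightarrow> 'x \<Rightarrow> bool"
  assumes F: "\<And>R. F R = filter (P R) U" and mono: "\<And>j. set ((F ^^ j) []) \<subseteq> set ((F ^^ Suc j) [])"
  shows "F ((F ^^ length U) []) = (F ^^ length U) []"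
proof -
  let ?A = "\<lambda>j. (F ^^ j) []"
  have A: "?A j = filter (\<lambda>x. x \<in> set (?A j)) U" for j
    by (cases j) (auto simp: F intro: filter_cong)
  have less: "length (?A j) < length (?A (Suc j))" if "?A j \<noteq> ?A (Suc j)" for j
  proof -
    have "set (?A j) \<noteq> set (?A (Suc j))" using that A[of j] A[of "Suc j"] by metis
    then obtain x where x: "x \<in> set (?A (Suc j))" "x \<notin> set (?A j)" using mono[of j] by blast
    have "filter (\<lambda>x. x \<in> set (?A j)) (filter (\<lambda>x. x \<in> set (?A (Suc j))) U) = filter (\<lambda>x. x \<in> set (?A j)) U"
      unfolding filter_filter by (rule filter_cong) (use mono[of j] in auto)
    then have "?A j = filter (\<lambda>x. x \<in> set (?A j)) (?A (Suc j))" using A[of j] A[of "Suc j"] by metis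
    with length_filter_less[of x "?A (Suc j)" "\<lambda>x. x \<in> set (?A j)"] x show ?thesis by metis
  qed
  have "\<exists>j\<le>length U. ?A j = ?A (Suc j)"
  proof (rule ccontr)
    assume "\<not> (\<exists>j\<le>length U. ?A j = ?A (Suc j))"
    then have ne: "\<And>j. j \<le> length U \<Longrightarrow> length (?A j) < length (?A (Suc j))" using less by blast
    have "j \<le> Suc (length U) \<Longrightarrow> j \<le> length (?A j)" for j
    proof (induction j)
      case (Suc j)
      then show ?case using ne[of j] by simp
    qed simp
    from this[of "Suc (length U)"] show False
      using length_filter_le[of "P (?A (length U))" U] by (simp add: F)
  qed
  then obtain j where j: "j \<le> length U" "F (?A j) = ?A j" by auto
  have "?A (j + m) = ?A j" for m
    by (induction m) (use j in auto)
  from this[of "length U - j"] j show ?thesis by simp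
qed

lemma path_insert_sink:
  assumes "path M f (insert (v, l, n) E) u x n" "u \<noteq> n" "monoid M" "v \<noteq> n"
    and cl: "\<And>a c b. (a, c, b) \<in> insert (v, l, n) E \<Longrightarrow> f c \<in> carrier M"
    and sink: "\<And>a c b. (a, c, b) \<in> E \<Longrightarrow> a \<noteq> n \<and> b \<noteq> n"
  shows "\<exists>y. path M f E u y v \<and> x = y \<otimes>\<^bsub>M\<^esub> f l"
proof -
  have fl: "f l \<in> carrier M" using cl by blast
  have "w = n \<longrightarrow> u \<noteq> n \<longrightarrow> (\<exists>y. path M f E u y v \<and> x = y \<otimes>\<^bsub>M\<^esub> f l)"
    if "path M f (insert (v, l, n) E) u x w" for u x w
    using that
  proof (induction rule: path.induct)
    case (step a c b x w)
    show ?case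
    proof (intro impI)
      assume w: "w = n" and a: "a \<noteq> n"
      show "\<exists>y. path M f E a y v \<and> f c \<otimes>\<^bsub>M\<^esub> x = y \<otimes>\<^bsub>M\<^esub> f l"
      proof (cases "(a, c, b) \<in> E")
        case True
        with step.IH w sink obtain y where y: "path M f E b y v" "x = y \<otimes>\<^bsub>M\<^esub> f l" by blast
        have "y \<in> carrier M" by (rule path_closed[OF y(1) assms(3)]) (use cl in blast)
        moreover have "f c \<in> carrier M" using cl True by blast
        ultimately show ?thesis using path.step[OF True y(1)] y(2) fl
          by (auto simp: monoid.m_assoc[OF assms(3)])
      next
        case False
        with step.hyps(1) have e: "a = v" "c = l" "b = n" by auto
        have "x = \<one>\<^bsub>M\<^esub>"
          using step.hyps(2) unfolding e(3) w
        proof cases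
          case (step c' v' x')
          then show ?thesis using sink assms(4) by blast
        qed
        with e fl show ?thesis
          by (intro exI[of _ "\<one>\<^bsub>M\<^esub>"]) (auto intro: path.refl simp: monoid.l_one[OF assms(3)] monoid.r_one[OF assms(3)])
      qed
    qed
  qed simp
  with assms(1,2) show ?thesis by blast
qed

text \<open>
  An additional edge from \<open>v\<close> to a fresh vertex \<open>n\<close>, labelled by the inverse of \<open>gs ! i\<close>, turns the question for
  value \<open>gs ! i\<close> into the question for value 1.
\<close>

lemma query_value:
  assumes K: "group K" and gs: "set gs \<subseteq> carrier K" and i: "i < length gs"
    and E: "\<And>a c b. (a, c, b) \<in> set es \<Longrightarrow> a < n \<and> b < n \<and> c \<le> 2 * length gs" and ac: "acyclic (arcs (set es))"
    and uv: "u < n" "v < n"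
  shows "query (AGWP K gs) (Suc n, u, n) ((v, Suc (Suc (2 * i)), n) # es) \<longleftrightarrow> path K (code_value K gs) (set es) u (gs ! i) v"
proof -
  interpret group K by (rule K)
  let ?f = "code_value K gs" and ?e = "(v, Suc (Suc (2 * i)), n)"
  have closed: "?f c \<in> carrier K" if "(a, c, b) \<in> insert ?e (set es)" for a c b
    using that E i by (intro code_value_closed[OF K gs]) fastforce
  have gi: "gs ! i \<in> carrier K" using gs i by auto
  have "(n, v) \<notin> (arcs (set es))\<^sup>*"
  proof
    assume "(n, v) \<in> (arcs (set es))\<^sup>*"
    then show False using uv E by (cases rule: converse_rtranclE) (auto simp: arcs_def)
  qed
  then have "valid (length gs) (Suc n) u n (set (?e # es))"
    using uv ac i E by (fastforce simp: valid_def acyclic_insert)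
  then have "query (AGWP K gs) (Suc n, u, n) (?e # es) \<longleftrightarrow> path K ?f (insert ?e (set es)) u \<one>\<^bsub>K\<^esub> n"
    by (simp add: query_def AGWP_iff[OF K gs])
  also have "\<dots> \<longleftrightarrow> path K ?f (set es) u (gs ! i) v"
  proof
    assume "path K ?f (insert ?e (set es)) u \<one>\<^bsub>K\<^esub> n"
    then have "\<exists>y. path K ?f (set es) u y v \<and> \<one>\<^bsub>K\<^esub> = y \<otimes>\<^bsub>K\<^esub> ?f (Suc (Suc (2 * i)))"
    proof (rule path_insert_sink)
      show "a \<noteq> n \<and> b \<noteq> n" if "(a, c, b) \<in> set es" for a c b using E[OF that] by simp
    qed (use uv closed is_monoid in auto)
    then obtain y where y: "path K ?f (set es) u y v" "\<one>\<^bsub>K\<^esub> = y \<otimes>\<^bsub>K\<^esub> inv\<^bsub>K\<^esub> (gs ! i)" by auto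
    have "y \<in> carrier K" by (rule path_closed[OF y(1) is_monoid closed]) blast
    then have "y = gs ! i" using y(2) gi by (metis inv_equality inv_inv inv_closed)
    with y show "path K ?f (set es) u (gs ! i) v" by simp
  next
    assume *: "path K ?f (set es) u (gs ! i) v"
    have "path K ?f (insert ?e (set es)) u (gs ! i \<otimes>\<^bsub>K\<^esub> ?f (Suc (Suc (2 * i)))) n"
      by (rule path_trans[OF path_mono[OF *] path_edge is_monoid closed])
        (use closed[of v "Suc (Suc (2 * i))" n] is_monoid in auto)
    then show "path K ?f (insert ?e (set es)) u \<one>\<^bsub>K\<^esub> n" using gi by simp
  qed
  finally show ?thesis .
qed

text \<open>
  The list \<open>cs\<close> of all elements of the amalgamated subgroup exists because that subgroup is finite.
\<close>

locale coded_amalgam = amalgam G H C \<phi> \<psi>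
  for G :: "('a, 'm) monoid_scheme" and H :: "('b, 'n) monoid_scheme"
    and C :: "('c, 'k) monoid_scheme" and \<phi> :: "'c \<Rightarrow> 'a" and \<psi> :: "'c \<Rightarrow> 'b" +
  fixes cs :: "'c list" and xs :: "'a list" and ys :: "'b list"
  assumes cs: "set cs = carrier C" and xs: "set xs \<subseteq> carrier G" and ys: "set ys \<subseteq> carrier H"
begin

abbreviation "P \<equiv> amalgamated_product G H C \<phi> \<psi>"

definition inl :: "'a \<Rightarrow> ('a + 'b) list set" where "inl g = amalg_rel G H C \<phi> \<psi> `` {[Inl g]}"
definition inr :: "'b \<Rightarrow> ('a + 'b) list set" where "inr h = amalg_rel G H C \<phi> \<psi> `` {[Inr h]}"

sublocale P: group P
  by (rule group_amalgamated_product[OF group_G group_H L.f_hom R.f_hom])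

sublocale inl: group_hom G P inl
  unfolding inl_def[abs_def] by unfold_locales (rule amalg_inl_hom[OF group_G group_H L.f_hom R.f_hom])

sublocale inr: group_hom H P inr
  unfolding inr_def[abs_def] by unfold_locales (rule amalg_inr_hom[OF group_G group_H L.f_hom R.f_hom])

lemma inl_inr: "c \<in> carrier C \<Longrightarrow> inl (\<phi> c) = inr (\<psi> c)"
  unfolding inl_def inr_def by (rule amalg_commutes[OF group_G group_H L.f_hom R.f_hom])

text \<open>The two factors use the same numbering of letters as the amalgamated product; the numbers
  of the other factor are filled up with the neutral element.\<close>

definition gensG :: "'a list" where
  "gensG = map \<phi> cs @ xs @ replicate (length ys) \<one>\<^bsub>G\<^esub>"
definition gensH :: "'b list" where
  "gensH = map \<psi> cs @ replicate (length xs) \<one>\<^bsub>H\<^esub> @ ys"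
definition gensP :: "('a + 'b) list set list" where
  "gensP = map (\<lambda>c. inl (\<phi> c)) cs @ map inl xs @ map inr ys"

abbreviation "m \<equiv> length cs + length xs + length ys"

lemma gens_length [simp]: "length gensG = m" "length gensH = m" "length gensP = m"
  by (auto simp: gensG_def gensH_def gensP_def)

lemma gens_closed: "set gensG \<subseteq> carrier G" "set gensH \<subseteq> carrier H" "set gensP \<subseteq> carrier P"
  using cs xs ys by (auto simp: gensG_def gensH_def gensP_def)

abbreviation "valG \<equiv> code_value G gensG"
abbreviation "valH \<equiv> code_value H gensH"
abbreviation "valP \<equiv> code_value P gensP"

lemma val_closed:
  "l \<le> 2 * m \<Longrightarrow> valG l \<in> carrier G" "l \<le> 2 * m \<Longrightarrow> valH l \<in> carrier H" "l \<le> 2 * m \<Longrightarrow> valP l \<in> carrier P"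
  using code_value_closed[OF group_G gens_closed(1)] code_value_closed[OF group_H gens_closed(2)]
    code_value_closed[OF P.is_group gens_closed(3)] by auto

lemma gensP_generating:
  assumes "generate G (set xs) = carrier G" "generate H (set ys) = carrier H"
  shows "generating_list P gensP"
proof -
  have "inl ` carrier G \<subseteq> generate P (set gensP)"
    unfolding assms(1)[symmetric] inl.generate_img[OF xs, symmetric]
    by (rule P.mono_generate) (auto simp: gensP_def)
  then have l: "inl g \<in> generate P (set gensP)" if "g \<in> carrier G" for g using that by blast
  have "inr ` carrier H \<subseteq> generate P (set gensP)"
    unfolding assms(2)[symmetric] inr.generate_img[OF ys, symmetric]
    by (rule P.mono_generate) (auto simp: gensP_def)
  then have r: "inr h \<in> generate P (set gensP)" if "h \<in> carrier H" for h using that by blast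
  have "amalg_rel G H C \<phi> \<psi> `` {w} \<in> generate P (set gensP)" if "w \<in> lists (carrier G <+> carrier H)" for w
    using that
  proof (induction rule: lists.induct)
    case Nil
    then show ?case
      using generate.one[of P] by (simp add: amalg_one[OF group_G group_H L.f_hom R.f_hom])
  next
    case (Cons x w)
    have x: "[x] \<in> lists (carrier G <+> carrier H)" using Cons.hyps by simp
    have "amalg_rel G H C \<phi> \<psi> `` {[x]} \<in> generate P (set gensP)"
      using Cons.hyps(1) l r by (cases x) (auto simp: inl_def inr_def)
    from generate.eng[OF this Cons.IH] show ?case
      by (simp add: amalg_mult_class[OF group_G group_H L.f_hom R.f_hom x Cons.hyps(2)])
  qed
  then have "carrier P \<subseteq> generate P (set gensP)"
    by (auto simp only: amalg_carrier[OF group_G group_H L.f_hom R.f_hom])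
  then show ?thesis
    using gens_closed(3) P.generate_incl by (auto simp: generating_list_def)
qed

text \<open>
  The label numbers that make sense in the first and in the second factor; those of \<open>cs\<close> do so in both.
\<close>

definition inG :: "nat \<Rightarrow> bool" where "inG l \<longleftrightarrow> l \<le> 2 * (length cs + length xs)"
definition inH :: "nat \<Rightarrow> bool" where "inH l \<longleftrightarrow> l \<le> 2 * length cs \<or> 2 * (length cs + length xs) < l"

lemma inG_or_inH: "inG l \<or> inH l"
  by (auto simp: inG_def inH_def)

lemma gensP_G: "i < length cs + length xs \<Longrightarrow> gensP ! i = inl (gensG ! i) \<and> gensG ! i \<in> carrier G"
  using gens_closed(1) nth_mem[of i gensG] by (auto simp: gensP_def gensG_def nth_append)

lemma gensP_H: "i < m \<Longrightarrow> i < length cs \<or> length cs + length xs \<le> i \<Longrightarrow> gensP ! i = inr (gensH ! i) \<and> gensH ! i \<in> carrier H"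
  using gens_closed(2) nth_mem[of i gensH] nth_mem[of i cs] by (auto simp: gensP_def gensH_def nth_append inl_inr cs)

lemma valP_G: "inG l \<Longrightarrow> valP l = inl (valG l)"
  by (cases l rule: code_cases) (auto simp: inG_def gensP_G)

lemma valP_H: "l \<le> 2 * m \<Longrightarrow> inH l \<Longrightarrow> valP l = inr (valH l)"
  by (cases l rule: code_cases) (auto simp: inH_def gensP_H)

lemma nth_gens: "i < length cs \<Longrightarrow> gensG ! i = \<phi> (cs ! i)" "i < length cs \<Longrightarrow> gensH ! i = \<psi> (cs ! i)"
  by (auto simp: gensG_def gensH_def nth_append)

subsection \<open>The algorithm\<close>

text \<open>
  The graph seen by a factor: the edges with labels in this factor, and the list \<open>R\<close> of edges added so
  far, whose labels come from \<open>cs\<close> and belong to both factors.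
\<close>

definition partG :: "triple list \<Rightarrow> triple list \<Rightarrow> triple list" where
  "partG es R = filter (\<lambda>e. inG (fst (snd e))) es @ R"
definition partH :: "triple list \<Rightarrow> triple list \<Rightarrow> triple list" where
  "partH es R = filter (\<lambda>e. inH (fst (snd e))) es @ R"

text \<open>
  The edge \<open>e\<close> may be added if one of the factors has a path between its ends with the value of its
  label.  A label of \<open>e\<close> is the number of a generator, and its successor is the number of the inverse.
\<close>

definition test :: "nat \<Rightarrow> triple list \<Rightarrow> triple list \<Rightarrow> triple \<Rightarrow> bool" where
  "test n es R e \<longleftrightarrow>
     query (AGWP G gensG) (Suc n, fst e, n) ((snd (snd e), Suc (fst (snd e)), n) # partG es R) \<or>
     query (AGWP H gensH) (Suc n, fst e, n) ((snd (snd e), Suc (fst (snd e)), n) # partH es R)"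

text \<open>
  All edges between distinct vertices with labels from \<open>cs\<close>.  There are polynomially many of them because
  the amalgamated subgroup is finite.  Loops are left out to keep the graph acyclic.
\<close>

definition candidates :: "nat \<Rightarrow> triple list" where
  "candidates n = filter (\<lambda>e. fst e \<noteq> snd (snd e)) (concat (map (\<lambda>u. concat (map (\<lambda>l. map (\<lambda>v. (u, l, v)) [0..<n])
     (map (\<lambda>i. Suc (2 * i)) [0..<length cs]))) [0..<n]))"

definition round :: "nat \<Rightarrow> triple list \<Rightarrow> triple list \<Rightarrow> triple list" where
  "round n es R = filter (test n es R) (candidates n)"

definition saturation :: "nat \<Rightarrow> triple list \<Rightarrow> triple list" where
  "saturation n es = (round n es ^^ length (candidates n)) []"

text \<open>
  The first two conditions establish that the graph is valid.  After saturation, every path of value 1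
  in the amalgamated product is witnessed inside the first factor.
\<close>

definition decide :: "triple \<Rightarrow> triple list \<Rightarrow> bool" where
  "decide h es \<longleftrightarrow> list_all (\<lambda>e. fst (snd e) \<le> 2 * m) es \<and> query (AGWP G gensG) h (erase es) \<and>
     query (AGWP G gensG) h (partG es (saturation (fst h) es))"

lemma set_candidates: "(u, l, v) \<in> set (candidates n) \<longleftrightarrow> u < n \<and> v < n \<and> u \<noteq> v \<and> (\<exists>i<length cs. l = Suc (2 * i))"
  by (simp add: candidates_def image_iff) auto

lemma set_parts: "set (partG es R) = {(u, l, v) \<in> set es. inG l} \<union> set R"
  "set (partH es R) = {(u, l, v) \<in> set es. inH l} \<union> set R"
  by (auto simp: partG_def partH_def)

subsection \<open>Soundness and completeness\<close>

text \<open>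
  The invariant of saturation: every added edge runs parallel to a path of the original graph.
\<close>

definition sound :: "nat \<Rightarrow> triple set \<Rightarrow> triple set \<Rightarrow> bool" where
  "sound n E R \<longleftrightarrow> (\<forall>(u, l, v) \<in> R. u < n \<and> v < n \<and> u \<noteq> v \<and>
     (\<exists>i<length cs. l = Suc (2 * i) \<and> path P valP E u (inl (\<phi> (cs ! i))) v))"

context
  fixes n s t :: nat and es :: "triple list"
  assumes valid: "valid m n s t (set es)"
begin

lemma edgeD: "(u, l, v) \<in> set es \<Longrightarrow> u < n \<and> v < n \<and> l \<le> 2 * m"
  using valid by (auto simp: valid_def)

lemma val_edge: "(u, l, v) \<in> set es \<Longrightarrow> valP l \<in> carrier P"
  using edgeD val_closed(3) by blast

lemma acyclic_es: "acyclic (arcs (set es))"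
  using valid by (auto simp: valid_def)

lemma soundD:
  assumes "sound n (set es) R" "(u, l, v) \<in> R"
  shows "u < n" "v < n" "u \<noteq> v" "l \<le> 2 * m" "inG l" "inH l"
    "path P valP (set es) u (inl (valG l)) v" "path P valP (set es) u (inr (valH l)) v"
proof -
  obtain i where i: "i < length cs" "l = Suc (2 * i)" "path P valP (set es) u (inl (\<phi> (cs ! i))) v"
    and uv: "u < n" "v < n" "u \<noteq> v"
    using bspec[OF assms(1)[unfolded sound_def] assms(2)] unfolding prod.case by blast
  have c: "cs ! i \<in> carrier C" using nth_mem[OF i(1)] cs by simp
  show "u < n" "v < n" "u \<noteq> v" by (simp_all add: uv)
  show "l \<le> 2 * m" "inG l" "inH l" using i(1) unfolding i(2) by (simp_all add: inG_def inH_def)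
  show "path P valP (set es) u (inl (valG l)) v" "path P valP (set es) u (inr (valH l)) v"
    using i(3) by (simp_all only: i(2) code_value_simps nth_gens[OF i(1)] inl_inr[OF c])
qed

lemma partD:
  assumes "sound n (set es) (set R)"
  shows "(u, l, v) \<in> set (partG es R) \<Longrightarrow> u < n \<and> v < n \<and> l \<le> 2 * m"
    and "(u, l, v) \<in> set (partH es R) \<Longrightarrow> u < n \<and> v < n \<and> l \<le> 2 * m"
  by (auto simp: set_parts dest: edgeD soundD(1,2,4)[OF assms])

text \<open>
  Added edges run parallel to nonempty paths, so they close no cycle.
\<close>

lemma acyclic_parts:
  assumes "sound n (set es) (set R)"
  shows "acyclic (arcs (set es \<union> set R))" "acyclic (arcs (set (partG es R)))" "acyclic (arcs (set (partH es R)))"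
proof -
  have "arcs (set R) \<subseteq> (arcs (set es))\<^sup>+"
  proof (rule subrelI)
    fix u v assume "(u, v) \<in> arcs (set R)"
    then obtain l where "(u, l, v) \<in> set R" by (auto simp: arcs_def)
    with soundD(3,7)[OF assms this] show "(u, v) \<in> (arcs (set es))\<^sup>+"
      by (blast dest: path_arcs rtranclD)
  qed
  then have "arcs (set es \<union> set R) \<subseteq> (arcs (set es))\<^sup>+" by auto
  moreover have "acyclic ((arcs (set es))\<^sup>+)" using acyclic_es by (simp add: acyclic_def)
  ultimately show *: "acyclic (arcs (set es \<union> set R))" by (rule acyclic_subset[rotated])
  show "acyclic (arcs (set (partG es R)))" "acyclic (arcs (set (partH es R)))"
    by (rule acyclic_subset[OF * arcs_mono]; auto simp: set_parts)+
qed

lemma path_partG: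
  assumes "sound n (set es) (set R)" "path G valG (set (partG es R)) u x v"
  shows "path P valP (set es) u (inl x) v"
  using assms(2)
proof (induction rule: path.induct)
  case (refl u)
  then show ?case using path.refl[of P valP "set es" u] by simp
next
  case (step u l v x w)
  have x: "x \<in> carrier G"
    by (rule path_closed[OF step.hyps(2) L.A.is_monoid val_closed(1)]) (use partD[OF assms(1)] in blast)
  have l: "valG l \<in> carrier G" using partD(1)[OF assms(1) step.hyps(1)] val_closed by blast
  have "path P valP (set es) u (inl (valG l)) v"
  proof (cases "(u, l, v) \<in> set R")
    case True
    then show ?thesis by (rule soundD(7)[OF assms(1)])
  next
    case False
    then have e: "(u, l, v) \<in> set es" "inG l" using step.hyps(1) by (auto simp: set_parts)
    then show ?thesis
      using path_edge[of u l v "set es" P valP, OF e(1) P.is_monoid val_edge[OF e(1)]] valP_G[OF e(2)] edgeD[OF e(1)] by simp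
  qed
  from path_trans[OF this step.IH P.is_monoid val_edge] show ?case using x l by simp
qed

lemma path_partH:
  assumes "sound n (set es) (set R)" "path H valH (set (partH es R)) u x v"
  shows "path P valP (set es) u (inr x) v"
  using assms(2)
proof (induction rule: path.induct)
  case (refl u)
  then show ?case using path.refl[of P valP "set es" u] by simp
next
  case (step u l v x w)
  have x: "x \<in> carrier H"
    by (rule path_closed[OF step.hyps(2) R.A.is_monoid val_closed(2)]) (use partD[OF assms(1)] in blast)
  have l: "valH l \<in> carrier H" using partD(2)[OF assms(1) step.hyps(1)] val_closed by blast
  have "path P valP (set es) u (inr (valH l)) v"
  proof (cases "(u, l, v) \<in> set R")
    case True
    then show ?thesis by (rule soundD(8)[OF assms(1)])
  next
    case False
    then have e: "(u, l, v) \<in> set es" "inH l" using step.hyps(1) by (auto simp: set_parts)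
    then show ?thesis
      using path_edge[of u l v "set es" P valP, OF e(1) P.is_monoid val_edge[OF e(1)]] valP_H[OF _ e(2)] edgeD[OF e(1)] by simp
  qed
  from path_trans[OF this step.IH P.is_monoid val_edge] show ?case using x l by simp
qed

lemma test_iff:
  assumes R: "sound n (set es) (set R)" and uv: "u < n" "v < n" and i: "i < length cs"
  shows "test n es R (u, Suc (2 * i), v) \<longleftrightarrow>
    path G valG (set (partG es R)) u (\<phi> (cs ! i)) v \<or> path H valH (set (partH es R)) u (\<psi> (cs ! i)) v"
proof -
  have "query (AGWP G gensG) (Suc n, u, n) ((v, Suc (Suc (2 * i)), n) # partG es R) \<longleftrightarrow>
      path G valG (set (partG es R)) u (gensG ! i) v"
    by (rule query_value[OF group_G gens_closed(1)]) (use partD[OF R] acyclic_parts[OF R] uv i in auto)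
  moreover have "query (AGWP H gensH) (Suc n, u, n) ((v, Suc (Suc (2 * i)), n) # partH es R) \<longleftrightarrow>
      path H valH (set (partH es R)) u (gensH ! i) v"
    by (rule query_value[OF group_H gens_closed(2)]) (use partD[OF R] acyclic_parts[OF R] uv i in auto)
  ultimately show ?thesis using i by (simp add: test_def nth_gens)
qed

lemma sound_round:
  assumes R: "sound n (set es) (set R)" shows "sound n (set es) (set (round n es R))"
  unfolding sound_def
proof clarify
  fix u l v assume "(u, l, v) \<in> set (round n es R)"
  then have t: "test n es R (u, l, v)" and "(u, l, v) \<in> set (candidates n)" by (auto simp: round_def)
  then obtain i where i: "i < length cs" "l = Suc (2 * i)" and uv: "u < n" "v < n" "u \<noteq> v"
    by (auto simp: set_candidates)
  have "cs ! i \<in> carrier C" using nth_mem[OF i(1)] cs by simp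
  note c = this
  have "path P valP (set es) u (inl (\<phi> (cs ! i))) v"
    using t[unfolded i(2) test_iff[OF R uv(1,2) i(1)]]
  proof
    assume "path G valG (set (partG es R)) u (\<phi> (cs ! i)) v"
    then show ?thesis by (rule path_partG[OF R])
  next
    assume "path H valH (set (partH es R)) u (\<psi> (cs ! i)) v"
    then show ?thesis unfolding inl_inr[OF c] by (rule path_partH[OF R])
  qed
  with i uv show "u < n \<and> v < n \<and> u \<noteq> v \<and> (\<exists>i<length cs. l = Suc (2 * i) \<and> path P valP (set es) u (inl (\<phi> (cs ! i))) v)"
    by blast
qed

lemma round_increasing:
  assumes R: "sound n (set es) (set R)" shows "set R \<subseteq> set (round n es R)"
proof clarify
  fix u l v assume e: "(u, l, v) \<in> set R"
  then obtain i where i: "i < length cs" "l = Suc (2 * i)" and uv: "u < n" "v < n" "u \<noteq> v"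
    using R by (auto simp: sound_def)
  have "path G valG (set (partG es R)) u (valG l) v"
    by (rule path_edge) (use e soundD(4)[OF R e] val_closed L.A.is_monoid in \<open>auto simp: set_parts\<close>)
  then show "(u, l, v) \<in> set (round n es R)"
    using i uv test_iff[OF R uv(1,2) i(1)] by (auto simp: round_def set_candidates nth_gens)
qed

lemma sound_iterate: "sound n (set es) (set ((round n es ^^ j) []))"
  by (induction j) (auto simp: sound_round, simp add: sound_def)

lemma sound_saturation: "sound n (set es) (set (saturation n es))"
  unfolding saturation_def by (rule sound_iterate)

lemma saturation_fixpoint: "round n es (saturation n es) = saturation n es"
  unfolding saturation_def
proof (rule filter_iteration_fixpoint[where P = "test n es"])
  show "round n es R = filter (test n es R) (candidates n)" for R
    by (simp add: round_def)
  show "set ((round n es ^^ j) []) \<subseteq> set ((round n es ^^ Suc j) [])" for j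
    using round_increasing[OF sound_iterate[of j]] by simp
qed

text \<open>
  The candidate edge for a path with value in \<open>C\<close> between distinct vertices has been added, since nothing
  more can be added, and it is available to both factors.  A path from a vertex to itself is empty in
  an acyclic graph, so there the value is 1 in both factors.
\<close>

lemma saturation_closed:
  assumes "c \<in> carrier C" and p: "path G valG (set (partG es (saturation n es))) u (\<phi> c) v \<or>
     path H valH (set (partH es (saturation n es))) u (\<psi> c) v"
  shows "path G valG (set (partG es (saturation n es))) u (\<phi> c) v"
    "path H valH (set (partH es (saturation n es))) u (\<psi> c) v"
proof -
  let ?R = "saturation n es"
  note R = sound_saturation
  obtain i where i: "i < length cs" "c = cs ! i" using assms(1) cs by (metis in_set_conv_nth)
  have "path G valG (set (partG es ?R)) u (\<phi> c) v \<and> path H valH (set (partH es ?R)) u (\<psi> c) v"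
  proof (cases "u = v")
    case True
    have "\<phi> c = \<one>\<^bsub>G\<^esub> \<or> \<psi> c = \<one>\<^bsub>H\<^esub>"
      using p unfolding True by (auto dest: path_loop[OF _ acyclic_parts(2)[OF R]] path_loop[OF _ acyclic_parts(3)[OF R]])
    then have "c = \<one>\<^bsub>C\<^esub>"
      using L.f_inj R.f_inj assms(1) L.f.hom_one R.f.hom_one L.C.one_closed by (metis inj_onD)
    then show ?thesis using path.refl[of G] path.refl[of H] by (simp add: True)
  next
    case False
    have uv: "u < n \<and> v < n"
      using p
    proof
      assume "path G valG (set (partG es ?R)) u (\<phi> c) v"
      then show ?thesis by (rule path_range[OF _ False]) (use partD[OF R] in blast)
    next
      assume "path H valH (set (partH es ?R)) u (\<psi> c) v"
      then show ?thesis by (rule path_range[OF _ False]) (use partD[OF R] in blast)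
    qed
    have "(u, Suc (2 * i), v) \<in> set (round n es ?R)"
      using uv False i p test_iff[OF R _ _ i(1)] by (auto simp: round_def set_candidates)
    then have e: "(u, Suc (2 * i), v) \<in> set ?R" by (simp add: saturation_fixpoint)
    have "path G valG (set (partG es ?R)) u (valG (Suc (2 * i))) v"
      by (rule path_edge) (use e soundD(4)[OF R e] val_closed(1)[of "Suc (2 * i)"] L.A.is_monoid in \<open>auto simp: set_parts\<close>)
    moreover have "path H valH (set (partH es ?R)) u (valH (Suc (2 * i))) v"
      by (rule path_edge) (use e soundD(4)[OF R e] val_closed(2)[of "Suc (2 * i)"] R.A.is_monoid in \<open>auto simp: set_parts\<close>)
    ultimately show ?thesis using i by (simp add: nth_gens)
  qed
  then show "path G valG (set (partG es ?R)) u (\<phi> c) v" "path H valH (set (partH es ?R)) u (\<psi> c) v" by auto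
qed

interpretation sat: saturated G H C \<phi> \<psi> "path G valG (set (partG es (saturation n es)))"
  "path H valH (set (partH es (saturation n es)))"
proof
  let ?R = "saturation n es"
  have g: "valG l \<in> carrier G" if "(u, l, v) \<in> set (partG es ?R)" for u l v
    using partD(1)[OF sound_saturation that] val_closed by blast
  have h: "valH l \<in> carrier H" if "(u, l, v) \<in> set (partH es ?R)" for u l v
    using partD(2)[OF sound_saturation that] val_closed by blast
  fix u v w :: nat
  show "x \<in> carrier G" if "path G valG (set (partG es ?R)) u x v" for x
    by (rule path_closed[OF that L.A.is_monoid g])
  show "x \<in> carrier H" if "path H valH (set (partH es ?R)) u x v" for x
    by (rule path_closed[OF that R.A.is_monoid h])
  show "path G valG (set (partG es ?R)) u (x \<otimes>\<^bsub>G\<^esub> y) w"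
    if "path G valG (set (partG es ?R)) u x v" "path G valG (set (partG es ?R)) v y w" for x y
    by (rule path_trans[OF that L.A.is_monoid g])
  show "path H valH (set (partH es ?R)) u (x \<otimes>\<^bsub>H\<^esub> y) w"
    if "path H valH (set (partH es ?R)) u x v" "path H valH (set (partH es ?R)) v y w" for x y
    by (rule path_trans[OF that R.A.is_monoid h])
  show "path G valG (set (partG es ?R)) u (\<phi> c) v \<longleftrightarrow> path H valH (set (partH es ?R)) u (\<psi> c) v"
    if "c \<in> carrier C" for c
    using saturation_closed[OF that] by blast
qed

text \<open>
  A path is a chain of one-edge syllables.
\<close>

lemma path_chain:
  assumes "path P valP (set es) u x v"
  shows "\<exists>w. sat.chain u w v \<and> x = amalg_rel G H C \<phi> \<psi> `` {w}"
  using assms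
proof (induction rule: path.induct)
  case (refl u)
  then show ?case
    by (intro exI[of _ "[]"]) (simp add: amalg_one[OF group_G group_H L.f_hom R.f_hom])
next
  case (step u l v x z)
  then obtain w where w: "sat.chain v w z" "x = amalg_rel G H C \<phi> \<psi> `` {w}" by blast
  have l: "l \<le> 2 * m" using edgeD step.hyps(1) by blast
  obtain y where y: "valP l = amalg_rel G H C \<phi> \<psi> `` {[y]}" "sat.chain u [y] v" "[y] \<in> lists (carrier G <+> carrier H)"
  proof (cases "inG l")
    case True
    have "path G valG (set (partG es (saturation n es))) u (valG l) v"
      by (rule path_edge) (use True l step.hyps(1) val_closed(1) L.A.is_monoid in \<open>auto simp: set_parts\<close>)
    then show ?thesis using that[of "Inl (valG l)"] valP_G[OF True] val_closed(1)[OF l] by (auto simp: inl_def)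
  next
    case False
    then have True: "inH l" using inG_or_inH by blast
    have "path H valH (set (partH es (saturation n es))) u (valH l) v"
      by (rule path_edge) (use True l step.hyps(1) val_closed(2) R.A.is_monoid in \<open>auto simp: set_parts\<close>)
    then show ?thesis using that[of "Inr (valH l)"] valP_H[OF l True] val_closed(2)[OF l] by (auto simp: inr_def)
  qed
  have "valP l \<otimes>\<^bsub>P\<^esub> x = amalg_rel G H C \<phi> \<psi> `` {[y] @ w}"
    unfolding y(1) w(2) by (rule amalg_mult_class[OF group_G group_H L.f_hom R.f_hom y(3) sat.chain_lists[OF w(1)]])
  moreover have "sat.chain u ([y] @ w) z" using y(2) w(1) unfolding sat.chain_append by blast
  ultimately show ?case by blast
qed

text \<open>
  A path of value 1 in the amalgamated product is a chain with value \<open>\<phi>(1)\<close>, so it collapses to a single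
  syllable in \<open>G\<close>.
\<close>

lemma path_one_iff:
  "path P valP (set es) u \<one>\<^bsub>P\<^esub> v \<longleftrightarrow> path G valG (set (partG es (saturation n es))) u \<one>\<^bsub>G\<^esub> v"
proof
  assume "path G valG (set (partG es (saturation n es))) u \<one>\<^bsub>G\<^esub> v"
  from path_partG[OF sound_saturation this] show "path P valP (set es) u \<one>\<^bsub>P\<^esub> v" by simp
next
  assume "path P valP (set es) u \<one>\<^bsub>P\<^esub> v"
  then obtain w where w: "sat.chain u w v" "\<one>\<^bsub>P\<^esub> = amalg_rel G H C \<phi> \<psi> `` {w}" using path_chain by blast
  show "path G valG (set (partG es (saturation n es))) u \<one>\<^bsub>G\<^esub> v"
  proof (cases "w = []")
    case True
    with w(1) show ?thesis by (auto intro: path.refl)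
  next
    case False
    have wl: "w \<in> lists (carrier G <+> carrier H)" using sat.chain_lists[OF w(1)] .
    have "amalg_rel G H C \<phi> \<psi> `` {w} = amalg_rel G H C \<phi> \<psi> `` {[Inl (\<phi> \<one>\<^bsub>C\<^esub>)]}"
      unfolding w(2)[symmetric] using inl.hom_one by (simp add: inl_def)
    then have "w \<approx> [Inl (\<phi> \<one>\<^bsub>C\<^esub>)]"
      using amalg_class_eq_iff[OF group_G group_H L.f_hom R.f_hom wl, of "[Inl (\<phi> \<one>\<^bsub>C\<^esub>)]"] by (simp add: InlI)
    from sat.chain_collapse[OF w(1) False this] show ?thesis by simp
  qed
qed

end

lemma decide_iff: "query (AGWP P gensP) h es \<longleftrightarrow> decide h es"
proof -
  obtain n s t where h: "h = (n, s, t)" by (cases h)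
  have q: "query (AGWP P gensP) h es \<longleftrightarrow> valid m n s t (set es) \<and> path P valP (set es) s \<one>\<^bsub>P\<^esub> t"
    by (simp add: query_def h AGWP_iff[OF P.is_group gens_closed(3)])
  have codes: "list_all (\<lambda>e. fst (snd e) \<le> 2 * m) es \<longleftrightarrow> (\<forall>(u, c, v) \<in> set es. c \<le> 2 * m)"
    by (auto simp: list_all_iff)
  have "list_all (\<lambda>e. fst (snd e) \<le> 2 * m) es \<and> query (AGWP G gensG) h (erase es) \<longleftrightarrow>
      valid m n s t (set es) \<and> path G valG (set (erase es)) s \<one>\<^bsub>G\<^esub> t"
    unfolding codes query_def h AGWP_iff[OF group_G gens_closed(1)] gens_length
    using valid_erase[of m n s t es m] by blast
  moreover have "path P valP (set es) s \<one>\<^bsub>P\<^esub> t \<longleftrightarrow> path G valG (set (erase es)) s \<one>\<^bsub>G\<^esub> t \<and> query (AGWP G gensG) h (partG es (saturation n es))"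
    if v: "valid m n s t (set es)"
  proof -
    have "valid m n s t (set (partG es (saturation n es)))"
      using v partD(1)[OF v sound_saturation[OF v]] acyclic_parts(2)[OF v sound_saturation[OF v]]
      by (auto simp: valid_def)
    moreover have "path P valP (set es) s \<one>\<^bsub>P\<^esub> t \<Longrightarrow> path G valG (set (erase es)) s \<one>\<^bsub>G\<^esub> t"
      by (rule path_erase[OF _ L.A.is_monoid]) auto
    ultimately show ?thesis
      using path_one_iff[OF v] by (auto simp: query_def h AGWP_iff[OF group_G gens_closed(1)])
  qed
  ultimately show ?thesis unfolding q decide_def by (auto simp: h)
qed

subsection \<open>Running time\<close>

lemma pt_inG: "pt f \<Longrightarrow> pt (\<lambda>x. inG (f x))"
  by (rule pt_table[where K = "Suc (2 * m)"]) (auto simp: inG_def)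

lemma pt_inH: "pt f \<Longrightarrow> pt (\<lambda>x. inH (f x))"
  by (rule pt_table[where K = "Suc (2 * m)"]) (auto simp: inH_def)

lemma pt_parts:
  assumes "pt f" "pt g" shows "pt (\<lambda>x. partG (f x) (g x))" "pt (\<lambda>x. partH (f x) (g x))"
  unfolding partG_def partH_def by (intro pt_inG pt_inH pt_intros assms)+

lemma pt_candidates: "pt candidates"
proof -
  have "pt (\<lambda>n. filter (\<lambda>e. fst e \<noteq> snd (snd e))
      (concat (map (\<lambda>u. concat (map (\<lambda>l. map (\<lambda>v. (u, l, v)) [0..<n]) L)) [0..<n])))" for L :: "nat list"
    by (intro pt_intros)
  then show ?thesis unfolding candidates_def .
qed

lemma pt_test:
  assumes "AGWP G gensG \<in> PTIME" "AGWP H gensH \<in> PTIME" "pt n" "pt es" "pt R" "pt e"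
  shows "pt (\<lambda>x. test (n x) (es x) (R x) (e x))"
  unfolding test_def by (intro pt_disj pt_query assms(1,2) pt_parts pt_intros assms(3-6))

lemma sz_filter: "sz (filter Q l) \<le> sz l"
  by (induction l) auto

text \<open>
  A round only ever returns a sublist of the candidates, so the states of the loop stay small.
\<close>

lemma pt_saturation:
  assumes "AGWP G gensG \<in> PTIME" "AGWP H gensH \<in> PTIME"
  shows "pt (\<lambda>x. saturation (fst x) (snd x))"
proof -
  obtain q where q: "poly_bounded q" "\<And>n. sz (candidates n) \<le> q (sz n)" "mono q"
    by (rule pt_sz[OF pt_candidates], rule that)
  show ?thesis
    unfolding saturation_def
  proof (rule pt_funpow[OF _ _ _ q(1)])
    show "pt (\<lambda>p. round (fst (fst p)) (snd (fst p)) (snd p))"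
      unfolding round_def
      by (intro pt_filter pt_test assms pt_compose[OF pt_candidates] pt_intros)
    show "pt (\<lambda>x :: nat \<times> triple list. length (candidates (fst x)))"
      by (intro pt_length pt_compose[OF pt_candidates] pt_intros)
    fix x :: "nat \<times> triple list" and R
    have "sz (round (fst x) (snd x) R) \<le> sz (candidates (fst x))"
      unfolding round_def by (rule sz_filter)
    also have "\<dots> \<le> q (sz (fst x))" by (rule q)
    also have "\<dots> \<le> q (sz x)" by (rule monoD[OF q(3)]) (simp add: enc_prod_def)
    finally show "sz (round (fst x) (snd x) R) \<le> sz R + q (sz x)" by simp
  qed (rule pt_const)
qed

lemma pt_decide_amalgam:
  assumes "AGWP G gensG \<in> PTIME" and "AGWP H gensH \<in> PTIME"
  shows "pt (\<lambda>p. decide (fst p) (snd p))"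
proof -
  have "pt (\<lambda>p :: triple \<times> triple list. saturation (fst (fst p)) (snd p))"
    using pt_compose[OF pt_saturation[OF assms], of "\<lambda>p. (fst (fst p), snd p)"]
    by (simp add: pt_intros)
  then show ?thesis
    unfolding decide_def
    by (intro pt_conj pt_codes_le pt_query[OF assms(1)] pt_erase pt_parts pt_intros)
qed

lemma AGWP_gensP:
  assumes "AGWP G gensG \<in> PTIME" and "AGWP H gensH \<in> PTIME"
  shows "AGWP P gensP \<in> PTIME"
  by (rule AGWP_in_PTIME_I[OF pt_decide_amalgam[OF assms] decide_iff])

end


section \<open>Amalgamation over a finite group\<close>

theorem corollary4p2:
  fixes G :: "('a, 'm) monoid_scheme" and H :: "('b, 'n) monoid_scheme"
    and C :: "('c, 'k) monoid_scheme"
    and \<phi> :: "'c \<Rightarrow> 'a" and \<psi> :: "'c \<Rightarrow> 'b"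
    and xs :: "'a list" and ys :: "'b list" and zs :: "('a + 'b) list set list"
  assumes "group G" and "group H"
    and "generating_list G xs" and "generating_list H ys"
    and "group C" and "finite (carrier C)"
    and "\<phi> \<in> mon C G" and "\<psi> \<in> mon C H"
    and "AGWP G xs \<in> PTIME" and "AGWP H ys \<in> PTIME"
    and "generating_list (amalgamated_product G H C \<phi> \<psi>) zs"
  shows "AGWP (amalgamated_product G H C \<phi> \<psi>) zs \<in> PTIME"
proof -
  obtain cs where cs: "set cs = carrier C" using finite_list[OF assms(6)] by blast
  interpret coded_amalgam G H C \<phi> \<psi> cs xs ys
    using assms cs
    by (simp add: coded_amalgam_def amalgam_def coded_amalgam_axioms_def generating_list_def)
  have "AGWP G gensG \<in> PTIME" "AGWP H gensH \<in> PTIME"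
    by (rule AGWP_PTIME_change_generators; use assms gens_closed in simp)+
  then have P: "AGWP P gensP \<in> PTIME" by (rule AGWP_gensP)
  have "generating_list P gensP"
    by (rule gensP_generating) (use assms in \<open>simp_all add: generating_list_def\<close>)
  from AGWP_PTIME_change_generators[OF P.is_group this P] assms(11) show ?thesis
    by (simp add: generating_list_def)
qed

end
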